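(* Let $X$ be a Peano continuum (a nonempty compact, connected, locally path connected metrizable space), and let $H_1(X)$ be its first singular homology group. For an abelian group $A$ let $\mathrm{tor}(A)$ be its torsion subgroup and $\mathrm{tf}(A) = A/\mathrm{tor}(A)$. If $\mathrm{card}(\mathrm{tf}(H_1(X))) < 2^{\aleph_0}$, then $H_1(X)$ is a direct sum of cyclic groups and $\mathrm{tor}(H_1(X))$ is of bounded exponent.
   Context: A Peano continuum is a path connected, locally path connected, compact metrizable space. $\mathrm{tor}(A)$ denotes the subgroup of torsion elements of an abelian group $A$, and $\mathrm{tf}(A)$ the quotient $A/\mathrm{tor}(A)$. *)

theory Defs
  imports "HOL-Analysis.Analysis" "HOL-Homology.Homology" "HOL-Library.Equipollence"
begin

definition peano_continuum :: "'a topology \<Rightarrow> bool" where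
  "peano_continuum X \<longleftrightarrow> topspace X \<noteq> {} \<and> compact_space X \<and> connected_space X
     \<and> locally_path_connected_space X \<and> metrizable_space X"

definition tor_set :: "('a, 'b) monoid_scheme \<Rightarrow> 'a set" where
  "tor_set G = {x \<in> carrier G. \<exists>n::nat. n > 0 \<and> x [^]\<^bsub>G\<^esub> n = \<one>\<^bsub>G\<^esub>}"

definition tf_group :: "('a, 'b) monoid_scheme \<Rightarrow> 'a set monoid" where
  "tf_group G = G Mod (tor_set G)"

definition direct_sum_of_cyclic :: "('a, 'b) monoid_scheme \<Rightarrow> bool" where
  "direct_sum_of_cyclic G \<longleftrightarrow>
     (\<exists>S \<subseteq> carrier G. sum_group S (\<lambda>g. subgroup_generated G {g}) \<cong> G)"

definition bounded_exponent :: "('a, 'b) monoid_scheme \<Rightarrow> 'a set \<Rightarrow> bool" where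
  "bounded_exponent G A \<longleftrightarrow> (\<exists>n::nat. n > 0 \<and> (\<forall>x\<in>A. x [^]\<^bsub>G\<^esub> n = \<one>\<^bsub>G\<^esub>))"

end

theory Submission
  imports Defs "HOL-Computational_Algebra.Primes"
begin

text \<open>
  Write \<open>B\<close> for the group of singular 1-boundaries.  Suppose that for some \<open>N > 0\<close> and
  \<open>\<epsilon> > 0\<close> every loop of size less than \<open>\<epsilon>\<close> is killed by \<open>N\<close> modulo \<open>B\<close>.  A finite net of points,
  joined by finitely many short paths, then shows that \<open>N H\<^sub>1(X)\<close> lies in a finitely generated
  group, and the conclusion is algebra: a subgroup of a free abelian group of finite rank is free,
  and an abelian group \<open>A\<close> is a direct sum of cyclic groups as soon as \<open>p A\<close> is, \<open>p\<close> prime.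

  Otherwise there are a point \<open>x\<close> and loops \<open>l\<^sub>n\<close> at \<open>x\<close> that shrink to \<open>x\<close> with \<open>n! [l\<^sub>n] \<noteq> 0\<close>.
  For \<open>S \<subseteq> \<nat>\<close> let \<open>g\<^sub>S\<close> be the infinite concatenation of the \<open>l\<^sub>n\<close>, \<open>n \<in> S\<close>.  The relation
  \<open>m! ([g\<^sub>S] - [g\<^sub>T]) = 0\<close> is analytic in \<open>(S, T)\<close>, since it is witnessed by finitely many continuous
  maps of a triangle.  So it is meagre or comeagre in a basic open set.  The latter is impossible:
  adding or removing one \<open>n \<ge> m\<close> changes \<open>[g\<^sub>S]\<close> by \<open>[l\<^sub>n]\<close>, which \<open>m!\<close> does not kill.  A perfect set avoiding
  these countably many meagre relations yields \<open>2\<^sup>\<aleph>\<^sup>0\<close> elements of \<open>H\<^sub>1(X)\<close> that are distinct modulo torsion.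
\<close>

section \<open>Direct sums of cyclic groups\<close>

text \<open>Factorials handle all torsion orders at once. Whatever is killed by some n > 0 is killed
  by n!, and a loop not killed by n! is not killed by m! for any m \<le> n. So a single sequence of
  loops, with size bound 1/(n+1) and exponent n! tied to the same index, serves for every m.

  The obstacle in the second case is that the class of an infinite concatenation is not an infinite
  sum of classes: only the effect of changing finitely many coordinates can be computed. Category is
  suited to this, since changing one coordinate preserves meagreness. Analyticity needs a space of
  witnesses with limits; these exist because a bounding chain consists of finitely many triangles
  with integer coefficients, continuous maps of a triangle into a compact metric space can be coded
  countably at every precision, and the coincidences among faces that make the boundary cancel
  persist in a uniform limit.

  The algebra is carried out with subgroups B \<subseteq> Z of the chain group, all notions being
  relative to B; the quotient Z/B enters only when the result is transferred to homology.\<close>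

lemma (in comm_group) direct_sum_of_cyclicI:
  assumes S: "S \<subseteq> carrier G"
    and gen: "\<And>x. x \<in> carrier G \<Longrightarrow> \<exists>T (c::_ \<Rightarrow> int). finite T \<and> T \<subseteq> S \<and> x = (\<Otimes>s\<in>T. s [^] c s)"
    and ind: "\<And>T (c::_ \<Rightarrow> int) s. finite T \<Longrightarrow> T \<subseteq> S \<Longrightarrow> (\<Otimes>s\<in>T. s [^] c s) = \<one> \<Longrightarrow> s \<in> T \<Longrightarrow> s [^] c s = \<one>"
  shows "direct_sum_of_cyclic G"
proof -
  let ?C = "\<lambda>g. subgroup_generated G {g}"
  let ?A = "sum_group S ?C"
  have cyc: "carrier (?C s) = range (\<lambda>n::int. s [^] n)" if "s \<in> S" for s
    by (rule carrier_subgroup_generated_by_singleton) (use S that in blast)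
  have carA: "carrier ?A = {f \<in> \<Pi>\<^sub>E s\<in>S. carrier (?C s). finite {s \<in> S. f s \<noteq> \<one>}}"
    by (subst carrier_sum_group) simp_all
  have fG: "f \<in> S \<rightarrow> carrier G" if "f \<in> carrier ?A" for f
    using that carrier_subgroup_generated_subset by (fastforce simp: carA PiE_iff)
  have fin: "finite {s \<in> S. f s \<noteq> \<one>}" if "f \<in> carrier ?A" for f
    using that by (simp add: carA)
  \<comment> \<open>\<open>gfinprod\<close> multiplies only the factors different from
    \<open>\<one>\<close>, so it makes sense for finitely supported families on an infinite
    \<open>S\<close>. Multiplying out is the isomorphism: \<open>gen\<close> makes it onto,
    \<open>ind\<close> makes its kernel trivial.\<close>
  define h where "h f = gfinprod G f S" for f
  have hom: "h \<in> hom ?A G"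
  proof (rule homI)
    show "h f \<in> carrier G" if "f \<in> carrier ?A" for f
      unfolding h_def by (rule gfinprod_closed[OF fG[OF that]])
    show "h (f \<otimes>\<^bsub>?A\<^esub> g) = h f \<otimes> h g" if f: "f \<in> carrier ?A" and g: "g \<in> carrier ?A" for f g
    proof -
      have "h (f \<otimes>\<^bsub>?A\<^esub> g) = gfinprod G (\<lambda>s. f s \<otimes> g s) S"
        unfolding h_def mult_sum_group
        by (rule gfinprod_cong) (use fG[OF f] fG[OF g] in \<open>auto simp: simp_implies_def Pi_iff\<close>)
      also have "\<dots> = h f \<otimes> h g"
        unfolding h_def by (rule gfinprod_distrib[OF fin[OF f] fin[OF g] fG[OF f] fG[OF g]])
      finally show ?thesis .
    qed
  qed
  have grpA: "group ?A" by (rule sum_group) simp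
  interpret gh: group_hom ?A G h
    using grpA hom by (simp add: group_hom_def group_hom_axioms_def)
  have "inj_on h (carrier ?A)"
    unfolding gh.inj_on_one_iff
  proof (intro allI impI)
    fix f assume f: "f \<in> carrier ?A" and h1: "h f = \<one>"
    let ?T = "{s \<in> S. f s \<noteq> \<one>}"
    have "\<forall>s\<in>S. \<exists>n::int. f s = s [^] n" using f cyc by (fastforce simp: carA PiE_iff)
    then obtain c :: "'a \<Rightarrow> int" where c: "\<And>s. s \<in> S \<Longrightarrow> f s = s [^] c s" by metis
    have "h f = finprod G f ?T" using fin[OF f] by (simp add: h_def gfinprod_def)
    also have "\<dots> = (\<Otimes>s\<in>?T. s [^] c s)" by (rule finprod_cong') (use c S in auto)
    finally have "(\<Otimes>s\<in>?T. s [^] c s) = \<one>" using h1 by simp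
    then have one: "f s = \<one>" if "s \<in> ?T" for s
      using ind[OF fin[OF f], of c s] that c by auto
    have "f = (\<lambda>s\<in>S. \<one>)"
    proof
      fix s show "f s = (\<lambda>s\<in>S. \<one>) s"
        using one[of s] f by (cases "s \<in> S") (auto simp: carA PiE_iff extensional_def)
    qed
    then show "f = \<one>\<^bsub>?A\<^esub>" by simp
  qed
  moreover have "h ` carrier ?A = carrier G"
  proof (intro subset_antisym subsetI)
    fix x assume x: "x \<in> carrier G"
    obtain T and c :: "'a \<Rightarrow> int" where T: "finite T" "T \<subseteq> S" "x = (\<Otimes>s\<in>T. s [^] c s)"
      using gen[OF x] by (elim exE conjE)
    define f where "f = (\<lambda>s\<in>S. if s \<in> T then s [^] c s else \<one>)"
    have fC: "f s \<in> carrier (?C s)" if "s \<in> S" for s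
    proof (cases "s \<in> T")
      case True
      then show ?thesis unfolding cyc[OF that] using that by (simp add: f_def)
    next
      case False
      have "f s = s [^] (0::int)" using that False by (simp add: f_def)
      then show ?thesis unfolding cyc[OF that] by (rule range_eqI)
    qed
    have "{s \<in> S. f s \<noteq> \<one>} \<subseteq> T" by (auto simp: f_def)
    then have f: "f \<in> carrier ?A"
      using fC T(1) by (auto simp: carA PiE_iff f_def finite_subset)
    have "h f = gfinprod G f T"
      unfolding h_def by (rule gfinprod_mono_neutral_cong_right[OF T(2) _ refl fG[OF f]]) (auto simp: f_def)
    also have "\<dots> = finprod G f T" using fG[OF f] T(1,2) by (intro gfinprod_eq_finprod) auto
    also have "\<dots> = x" unfolding T(3) by (rule finprod_cong') (use T S in \<open>auto simp: f_def\<close>)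
    finally show "x \<in> h ` carrier ?A" using f by (metis imageI)
  qed (use gh.hom_closed in auto)
  ultimately have "h \<in> iso ?A G" using hom by (simp add: iso_def bij_betw_def)
  then have "?A \<cong> G" unfolding is_iso_def by blast
  then show ?thesis unfolding direct_sum_of_cyclic_def using S by blast
qed

section \<open>Cyclic decompositions of a quotient Z/B of subgroups\<close>

locale int_module = Modules.module scale
  for scale :: "int \<Rightarrow> 'b::ab_group_add \<Rightarrow> 'b" (infixr "\<cdot>" 75)
begin

text \<open>Generators of finite order are allowed, so the terms vanish modulo \<open>B\<close> and
  not the coefficients. Distinct members of \<open>S\<close> with the same class are then both in
  \<open>B\<close>.\<close>

definition indep_mod :: "'b set \<Rightarrow> 'b set \<Rightarrow> bool" where
  "indep_mod B S \<longleftrightarrow> (\<forall>T c. finite T \<longrightarrow> T \<subseteq> S \<longrightarrow> (\<Sum>t\<in>T. c t \<cdot> t) \<in> B \<longrightarrow> (\<forall>t\<in>T. c t \<cdot> t \<in> B))"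

text \<open>The torsion-free counterpart: the classes of \<open>S\<close> are a basis of a free
  abelian group.\<close>

definition free_mod :: "'b set \<Rightarrow> 'b set \<Rightarrow> bool" where
  "free_mod B S \<longleftrightarrow> (\<forall>T c. finite T \<longrightarrow> T \<subseteq> S \<longrightarrow> (\<Sum>t\<in>T. c t \<cdot> t) \<in> B \<longrightarrow> (\<forall>t\<in>T. c t = 0))"

definition cyclic_sum_mod :: "'b set \<Rightarrow> 'b set \<Rightarrow> bool" where
  "cyclic_sum_mod B Z \<longleftrightarrow> (\<exists>S\<subseteq>Z. indep_mod B S \<and> Z \<subseteq> span (S \<union> B))"

lemma indep_modD:
  "indep_mod B S \<Longrightarrow> finite T \<Longrightarrow> T \<subseteq> S \<Longrightarrow> (\<Sum>t\<in>T. c t \<cdot> t) \<in> B \<Longrightarrow> t \<in> T \<Longrightarrow> c t \<cdot> t \<in> B"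
  unfolding indep_mod_def by (elim allE[of _ T] allE[of _ c]) simp

lemma free_modD:
  "free_mod B S \<Longrightarrow> finite T \<Longrightarrow> T \<subseteq> S \<Longrightarrow> (\<Sum>t\<in>T. c t \<cdot> t) \<in> B \<Longrightarrow> t \<in> T \<Longrightarrow> c t = 0"
  unfolding free_mod_def by (elim allE[of _ T] allE[of _ c]) simp

lemma free_imp_indep_mod: "subspace B \<Longrightarrow> free_mod B S \<Longrightarrow> indep_mod B S"
proof (unfold indep_mod_def, intro allI impI ballI)
  fix T c t
  assume "subspace B" "free_mod B S" "finite T" "T \<subseteq> S" "(\<Sum>t\<in>T. c t \<cdot> t) \<in> B" "t \<in> T"
  then show "c t \<cdot> t \<in> B" using free_modD[of B S T c t] by (simp add: subspace_0)
qed

lemma free_mod_mono: "free_mod B S \<Longrightarrow> S' \<subseteq> S \<Longrightarrow> free_mod B S'"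
  unfolding free_mod_def by (meson order_trans)

lemma indep_mod_mono: "indep_mod B S \<Longrightarrow> S' \<subseteq> S \<Longrightarrow> indep_mod B S'"
  unfolding indep_mod_def by (meson order_trans)

lemma span_mod_explicit:
  assumes B: "subspace B" and y: "y \<in> span (S \<union> B)"
  obtains T c where "finite T" "T \<subseteq> S" "y - (\<Sum>t\<in>T. c t \<cdot> t) \<in> B"
proof -
  obtain u b where ub: "y = u + b" "u \<in> span S" "b \<in> B"
    using y span_eq_iff[of B] B unfolding span_Un by blast
  then obtain T c where "finite T" "T \<subseteq> S" "u = (\<Sum>t\<in>T. c t \<cdot> t)"
    unfolding span_explicit by blast
  then show ?thesis using that[of T c] ub by simp
qed

lemma free_mod_insert:
  assumes B: "subspace B" and F: "free_mod B F"
    and x: "\<And>n. n \<cdot> x \<in> span (F \<union> B) \<Longrightarrow> n = 0"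
  shows "free_mod B (insert x F)"
  unfolding free_mod_def
proof (intro allI impI)
  fix T c
  assume T: "finite T" "T \<subseteq> insert x F" and s: "(\<Sum>t\<in>T. c t \<cdot> t) \<in> B"
  have xF: "(\<Sum>t\<in>T - {x}. c t \<cdot> t) \<in> span (F \<union> B)"
    by (intro span_sum span_scale span_base) (use T in auto)
  show "\<forall>t\<in>T. c t = 0"
  proof (cases "x \<in> T")
    case True
    then have eq: "(\<Sum>t\<in>T. c t \<cdot> t) = c x \<cdot> x + (\<Sum>t\<in>T - {x}. c t \<cdot> t)"
      using T by (simp add: sum.remove)
    have "(\<Sum>t\<in>T. c t \<cdot> t) \<in> span (F \<union> B)"
      by (rule span_base) (use s in auto)
    then have "(\<Sum>t\<in>T. c t \<cdot> t) - (\<Sum>t\<in>T - {x}. c t \<cdot> t) \<in> span (F \<union> B)" using xF by (intro span_diff)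
    then have "c x \<cdot> x \<in> span (F \<union> B)" unfolding eq by simp
    then have 0: "c x = 0" by (rule x)
    then have "(\<Sum>t\<in>T - {x}. c t \<cdot> t) \<in> B" using s eq by simp
    moreover have "T - {x} \<subseteq> F" "finite (T - {x})" using T by auto
    ultimately have "\<forall>t\<in>T - {x}. c t = 0"
      using free_modD[OF F, of "T - {x}" c] by blast
    then show ?thesis using 0 by blast
  next
    case False
    then have "T \<subseteq> F" using T by auto
    then show ?thesis using free_modD[OF F, of T c] T s by blast
  qed
qed

text \<open>Induction on the rank. The coefficients at the last generator \<open>x\<close> of the
  elements of \<open>Z\<close> form an ideal of the integers. If it is nonzero, an element
  \<open>h\<close> of \<open>Z\<close> whose coefficient is the positive generator \<open>d\<close>
  splits \<open>Z\<close> into its part \<open>Z'\<close> without \<open>x\<close> and the multiples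
  of \<open>h\<close>.\<close>

lemma subspace_of_free_mod:
  assumes B: "subspace B" and "finite F" "free_mod B F"
    and "subspace Z" "Z \<subseteq> span (F \<union> B)"
  shows "\<exists>S\<subseteq>Z. free_mod B S \<and> Z \<subseteq> span (S \<union> B)"
  using assms(2-)
proof (induction F arbitrary: Z rule: finite_induct)
  case empty
  then show ?case by (intro exI[of _ "{}"]) (auto simp: free_mod_def)
next
  case (insert x F)
  have F: "free_mod B F"
    using free_mod_mono[OF insert.prems(1)] by blast
  have xfree: "n = 0" if n: "n \<cdot> x \<in> span (F \<union> B)" for n
  proof -
    obtain T c where T: "finite T" "T \<subseteq> F" "n \<cdot> x - (\<Sum>t\<in>T. c t \<cdot> t) \<in> B"
      using span_mod_explicit[OF B n] by blast
    have xT: "x \<notin> T" using T insert.hyps by blast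
    let ?c = "\<lambda>t. if t = x then n else - c t"
    have "(\<Sum>t\<in>T. ?c t \<cdot> t) = (\<Sum>t\<in>T. - (c t \<cdot> t))"
      by (rule sum.cong) (use xT in auto)
    then have "(\<Sum>t\<in>insert x T. ?c t \<cdot> t) \<in> B"
      using T xT by (simp add: sum_negf)
    then have "?c x = 0"
      by (intro free_modD[OF insert.prems(1), of "insert x T"]) (use T in auto)
    then show ?thesis by simp
  qed
  define Z' where "Z' = Z \<inter> span (F \<union> B)"
  have "subspace Z'" unfolding Z'_def by (intro subspace_inter insert.prems subspace_span)
  then obtain S where S: "S \<subseteq> Z'" "free_mod B S" "Z' \<subseteq> span (S \<union> B)"
    using insert.IH[OF F, of Z'] Z'_def by blast
  \<comment> \<open>The ideal of coefficients at \<open>x\<close>.\<close>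
  define J where "J n \<longleftrightarrow> (\<exists>z\<in>Z. z - n \<cdot> x \<in> span (F \<union> B))" for n
  have Zx: "\<exists>n. z - n \<cdot> x \<in> span (F \<union> B)" if "z \<in> Z" for z
    using that insert.prems(3) span_breakdown_eq[of z x "F \<union> B"] by auto
  have ZZ': "Z' \<subseteq> Z" by (auto simp: Z'_def)
  show ?case
  proof (cases "\<exists>n. J n \<and> n \<noteq> 0")
    case False
    have "Z \<subseteq> Z'"
    proof
      fix z assume z: "z \<in> Z"
      then obtain n where n: "z - n \<cdot> x \<in> span (F \<union> B)" using Zx by blast
      then have "n = 0" using False z unfolding J_def by blast
      then show "z \<in> Z'" using n z by (simp add: Z'_def)
    qed
    then show ?thesis using S by (metis order_trans ZZ')
  next
    case True
    have Jneg: "J (-n)" if Jn: "J n" for n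
    proof -
      obtain z where z: "z \<in> Z" "z - n \<cdot> x \<in> span (F \<union> B)" using Jn unfolding J_def by blast
      have "- z \<in> Z" "- (z - n \<cdot> x) \<in> span (F \<union> B)"
        using z insert.prems(2) by (auto intro: subspace_neg span_neg simp del: minus_diff_eq)
      then show ?thesis unfolding J_def by (intro bexI[of _ "-z"]) auto
    qed
    have "\<exists>k::nat. k > 0 \<and> J (int k)"
    proof -
      obtain n where n: "J n" "n \<noteq> 0" using True by blast
      then have "J \<bar>n\<bar>" using Jneg[of n] by (cases "n \<ge> 0") auto
      then show ?thesis using n by (intro exI[of _ "nat \<bar>n\<bar>"]) auto
    qed
    then obtain d where d: "d > 0" "J (int d)" and dmin: "\<And>k. k < d \<Longrightarrow> \<not> (k > 0 \<and> J (int k))"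
      using exists_least_iff[of "\<lambda>k. k > 0 \<and> J (int k)"] by blast
    obtain h where h: "h \<in> Z" "h - int d \<cdot> x \<in> span (F \<union> B)" using d J_def by blast
    have SF: "S \<union> B \<subseteq> span (F \<union> B)" using S Z'_def by (auto intro: span_base)
    have SFs: "span (S \<union> B) \<subseteq> span (F \<union> B)" using SF by (simp add: span_minimal)
    have fr: "free_mod B (insert h S)"
    proof (rule free_mod_insert[OF B S(2)])
      fix n assume "n \<cdot> h \<in> span (S \<union> B)"
      then have 1: "n \<cdot> h \<in> span (F \<union> B)" using SFs by blast
      have "n \<cdot> (h - int d \<cdot> x) \<in> span (F \<union> B)" using h by (intro span_scale)
      then have "n \<cdot> h - n \<cdot> (h - int d \<cdot> x) \<in> span (F \<union> B)" using 1 by (rule span_diff[rotated])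
      then have "(n * int d) \<cdot> x \<in> span (F \<union> B)" by (simp add: scale_right_diff_distrib)
      then show "n = 0" using xfree d by fastforce
    qed
    have gen: "Z \<subseteq> span (insert h S \<union> B)"
    proof
      fix z assume z: "z \<in> Z"
      obtain n where n: "z - n \<cdot> x \<in> span (F \<union> B)" using Zx z by blast
      define q where "q = n div int d"
      define r where "r = n mod int d"
      have nqr: "n = q * int d + r" by (simp add: q_def r_def)
      have "(z - n \<cdot> x) - q \<cdot> (h - int d \<cdot> x) \<in> span (F \<union> B)"
        by (intro span_diff span_scale n h)
      then have 1: "(z - q \<cdot> h) - r \<cdot> x \<in> span (F \<union> B)"
        unfolding nqr by (simp add: algebra_simps)
      moreover have zq: "z - q \<cdot> h \<in> Z" using z h insert.prems(2) by (intro subspace_diff subspace_scale)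
      ultimately have "J r" unfolding J_def by blast
      moreover have "0 \<le> r" "r < int d" using d by (auto simp: r_def)
      \<comment> \<open>The remainder is again a coefficient, and it is smaller than the least
        positive one.\<close>
      ultimately have "r = 0" using dmin[of "nat r"] d by (cases "r = 0") (auto simp: nat_less_iff)
      then have "z - q \<cdot> h \<in> Z'" using 1 zq by (simp add: Z'_def)
      then have "z - q \<cdot> h \<in> span (insert h S \<union> B)"
        using S(3) span_mono[of "S \<union> B" "insert h S \<union> B"] by blast
      moreover have "q \<cdot> h \<in> span (insert h S \<union> B)" by (intro span_scale span_base) auto
      ultimately show "z \<in> span (insert h S \<union> B)" by (metis diff_add_cancel span_add)
    qed
    show ?thesis using fr gen h S ZZ' by (intro exI[of _ "insert h S"]) blast
  qed
qed

text \<open>Elements are examined one at a time: a new \<open>x\<close> either keeps the set free or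
  has a nonzero multiple in the span, and then the factor enters \<open>M\<close>.\<close>

lemma maximal_free_subset:
  assumes B: "subspace B" and "finite F"
  shows "\<exists>F0\<subseteq>F. free_mod B F0 \<and> (\<exists>M::nat. M > 0 \<and> (\<forall>f\<in>F. int M \<cdot> f \<in> span (F0 \<union> B)))"
  using assms(2)
proof (induction F rule: finite_induct)
  case empty
  then show ?case by (intro exI[of _ "{}"]) (auto simp: free_mod_def intro: exI[of _ 1])
next
  case (insert x F)
  then obtain F0 M where F0: "F0 \<subseteq> F" "free_mod B F0" and M: "M > 0"
      "\<And>f. f \<in> F \<Longrightarrow> int M \<cdot> f \<in> span (F0 \<union> B)"
    by blast
  show ?case
  proof (cases "\<exists>n. n \<noteq> 0 \<and> n \<cdot> x \<in> span (F0 \<union> B)")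
    case True
    then obtain n where n: "n \<noteq> 0" "n \<cdot> x \<in> span (F0 \<union> B)" by blast
    define k where "k = nat \<bar>n\<bar>"
    have k: "int k = sgn n * n" using abs_sgn[of n] by (simp add: k_def mult.commute)
    have "k > 0" using n by (simp add: k_def)
    have kx: "int k \<cdot> x \<in> span (F0 \<union> B)"
      using span_scale[OF n(2), of "sgn n"] by (simp add: k)
    have "int (M * k) \<cdot> f \<in> span (F0 \<union> B)" if "f \<in> insert x F" for f
    proof (cases "f = x")
      case True
      then show ?thesis using span_scale[OF kx, of "int M"] by simp
    next
      case False
      then have "f \<in> F" using that by blast
      then show ?thesis using span_scale[OF M(2), of f "int k"] by (simp add: mult.commute)
    qed
    then show ?thesis using F0 M(1) \<open>k > 0\<close>
      by (intro exI[of _ F0]) (auto intro!: exI[of _ "M * k"] simp del: of_nat_mult)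
  next
    case False
    then have "free_mod B (insert x F0)" by (intro free_mod_insert[OF B F0(2)]) blast
    moreover have "int M \<cdot> f \<in> span (insert x F0 \<union> B)" if "f \<in> insert x F" for f
    proof (cases "f = x")
      case True
      then show ?thesis by (intro span_scale span_base) auto
    next
      case False
      then show ?thesis using M(2)[of f] that span_mono[of "F0 \<union> B" "insert x F0 \<union> B"] by blast
    qed
    ultimately show ?thesis using F0 M(1) by (intro exI[of _ "insert x F0"]) blast
  qed
qed

lemma int_in_subspace_coprime:
  assumes B: "subspace B" and "n \<cdot> x \<in> B" "m \<cdot> x \<in> B" "coprime n m"
  shows "x \<in> B"
proof -
  obtain u v where "u * n + v * m = 1" using bezout_int[of n m] assms(4) by auto
  then have "x = u \<cdot> (n \<cdot> x) + v \<cdot> (m \<cdot> x)"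
    by (metis scale_left_distrib scale_one scale_scale)
  moreover have "u \<cdot> (n \<cdot> x) + v \<cdot> (m \<cdot> x) \<in> B"
    by (intro subspace_add subspace_scale B assms)
  ultimately show ?thesis by simp
qed

text \<open>\<open>E/D\<close> is a vector space over the field with \<open>p\<close> elements.\<close>

lemma exists_complement_mod_prime:
  assumes D: "subspace D" and p: "prime (p::int)" and E: "subspace E"
    and pE: "\<And>x. x \<in> E \<Longrightarrow> p \<cdot> x \<in> D"
  shows "\<exists>C\<subseteq>E. (\<forall>T c. finite T \<longrightarrow> T \<subseteq> C \<longrightarrow> (\<Sum>t\<in>T. c t \<cdot> t) \<in> D \<longrightarrow> (\<forall>t\<in>T. p dvd c t))
              \<and> E \<subseteq> span (C \<union> D)"
proof -
  define ind where "ind C \<longleftrightarrow> (\<forall>T c. finite T \<longrightarrow> T \<subseteq> C \<longrightarrow> (\<Sum>t\<in>T. c t \<cdot> t) \<in> D \<longrightarrow> (\<forall>t\<in>T. p dvd c t))" for C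
  have indD: "p dvd c t" if "ind C" "finite T" "T \<subseteq> C" "(\<Sum>t\<in>T. c t \<cdot> t) \<in> D" "t \<in> T" for C T c t
    using that(1)[unfolded ind_def, THEN spec[of _ T], THEN spec[of _ c]] that(2-) by simp
  define A where "A = {C. C \<subseteq> E \<and> ind C}"
  have "\<exists>M\<in>A. \<forall>X\<in>A. M \<subseteq> X \<longrightarrow> X = M"
  proof (rule subset_Zorn)
    fix Ch assume Ch: "subset.chain A Ch"
    show "\<exists>U\<in>A. \<forall>X\<in>Ch. X \<subseteq> U"
    proof (cases "Ch = {}")
      case True
      have "{} \<in> A" by (auto simp: A_def ind_def)
      then show ?thesis using True by blast
    next
      case False
      have "ind (\<Union>Ch)"
        unfolding ind_def
      proof (intro allI impI)
        fix T c assume T: "finite T" "T \<subseteq> \<Union>Ch" "(\<Sum>t\<in>T. c t \<cdot> t) \<in> D"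
        obtain C where "C \<in> Ch" "T \<subseteq> C"
          using finite_subset_Union_chain[OF T(1,2) False Ch] by blast
        moreover have "Ch \<subseteq> A" using Ch by (simp add: subset_chain_def)
        ultimately show "\<forall>t\<in>T. p dvd c t" using indD[of C T c] T(1,3) by (auto simp: A_def)
      qed
      moreover have "\<Union>Ch \<subseteq> E" using Ch by (auto simp: subset_chain_def A_def)
      ultimately have "\<Union>Ch \<in> A" by (simp add: A_def)
      then show ?thesis by blast
    qed
  qed
  then obtain C where CA: "C \<in> A" and mx: "\<And>X. X \<in> A \<Longrightarrow> C \<subseteq> X \<Longrightarrow> X = C" by blast
  have C: "C \<subseteq> E" "ind C" using CA by (simp_all add: A_def)
  have "x \<in> span (C \<union> D)" if x: "x \<in> E" for x
  proof (cases "x \<in> C")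
    case True
    then show ?thesis by (intro span_base) auto
  next
    case False
    then have "insert x C \<notin> A" using mx[of "insert x C"] by blast
    then have "\<not> ind (insert x C)" using x C by (auto simp: A_def)
    then have "\<exists>T c. finite T \<and> T \<subseteq> insert x C \<and> (\<Sum>t\<in>T. c t \<cdot> t) \<in> D \<and> \<not> (\<forall>t\<in>T. p dvd c t)"
      unfolding ind_def by (simp only: not_all not_imp)
    then obtain T c t where T: "finite T" "T \<subseteq> insert x C" "(\<Sum>t\<in>T. c t \<cdot> t) \<in> D"
        and t: "t \<in> T" "\<not> p dvd c t" by blast
    have xT: "x \<in> T"
    proof (rule ccontr)
      assume "x \<notin> T"
      then have "T \<subseteq> C" using T by blast
      then show False using indD[OF C(2) T(1) _ T(3) t(1)] t(2) by blast
    qed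
    then have eq: "(\<Sum>t\<in>T. c t \<cdot> t) = c x \<cdot> x + (\<Sum>t\<in>T - {x}. c t \<cdot> t)"
      using T by (simp add: sum.remove)
    have npx: "\<not> p dvd c x"
    proof
      assume "p dvd c x"
      then obtain k where "c x = k * p" by (metis dvd_def mult.commute)
      then have "c x \<cdot> x \<in> D" using pE[OF x] subspace_scale[OF D, of "p \<cdot> x" k] by simp
      then have "(\<Sum>t\<in>T. c t \<cdot> t) - c x \<cdot> x \<in> D"
        using T(3) by (intro subspace_diff[OF D])
      then have "(\<Sum>t\<in>T - {x}. c t \<cdot> t) \<in> D" unfolding eq by simp
      moreover have "T - {x} \<subseteq> C" "finite (T - {x})" using T by auto
      ultimately have "\<forall>t\<in>T - {x}. p dvd c t" using indD[OF C(2), of "T - {x}" c] by blast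
      then show False using t \<open>p dvd c x\<close> by blast
    qed
    have "(\<Sum>t\<in>T - {x}. c t \<cdot> t) \<in> span (C \<union> D)"
      by (intro span_sum span_scale span_base) (use T in auto)
    moreover have "(\<Sum>t\<in>T. c t \<cdot> t) \<in> span (C \<union> D)" by (intro span_base) (use T in auto)
    ultimately have "(\<Sum>t\<in>T. c t \<cdot> t) - (\<Sum>t\<in>T - {x}. c t \<cdot> t) \<in> span (C \<union> D)" by (intro span_diff)
    then have 1: "c x \<cdot> x \<in> span (C \<union> D)" unfolding eq by simp
    have 2: "p \<cdot> x \<in> span (C \<union> D)" by (intro span_base) (use pE x in auto)
    have "coprime p (c x)" using p npx prime_imp_coprime by blast
    then show ?thesis by (intro int_in_subspace_coprime[OF subspace_span 2 1])
  qed
  then show ?thesis using C(1) C(2)[unfolded ind_def] by (intro exI[of _ C] conjI) auto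
qed

text \<open>Dropping the members of \<open>S\<close> that lie in \<open>B\<close> does not change
  the span together with \<open>B\<close>, and it makes the classes of the others distinct, as
  reindexing along roots or images requires.\<close>

lemma cyclic_sum_mod_nonzero:
  assumes B: "subspace B" and "cyclic_sum_mod B Z"
  obtains S where "S \<subseteq> Z" "S \<inter> B = {}" "indep_mod B S" "Z \<subseteq> span (S \<union> B)"
proof -
  obtain S where S: "S \<subseteq> Z" "indep_mod B S" "Z \<subseteq> span (S \<union> B)"
    using assms unfolding cyclic_sum_mod_def by blast
  have "indep_mod B (S - B)" using S(2) indep_mod_mono by blast
  moreover have "(S - B) \<union> B = S \<union> B" by auto
  ultimately show ?thesis using that[of "S - B"] S by auto
qed

text \<open>A basis \<open>S\<close> of pZ modulo \<open>B\<close> has roots \<open>a s\<close> with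
  \<open>p \<cdot> a s\<close> equal to \<open>s\<close> modulo \<open>B\<close>. They need not
  generate \<open>Z\<close>: writing \<open>p \<cdot> z\<close> in terms of \<open>S\<close>
  determines \<open>z\<close> through the roots only up to an element killed by \<open>p\<close>.
  Modulo \<open>B\<close> such elements form a vector space \<open>E\<close> over the field with
  \<open>p\<close> elements. Its part \<open>D\<close> divisible by \<open>p\<close> is already
  spanned by \<open>S\<close>, and a complement \<open>C\<close> of \<open>D\<close> completes the
  roots to a basis.\<close>

lemma cyclic_sum_mod_of_prime_multiple:
  assumes B: "subspace B" and Z: "subspace Z" "B \<subseteq> Z" and p: "prime (p::int)"
    and cs: "cyclic_sum_mod B {p \<cdot> z + b |z b. z \<in> Z \<and> b \<in> B}" (is "cyclic_sum_mod B ?pZ")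
  shows "cyclic_sum_mod B Z"
proof -
  obtain S where S: "S \<subseteq> ?pZ" "S \<inter> B = {}" "indep_mod B S" "?pZ \<subseteq> span (S \<union> B)"
    using cyclic_sum_mod_nonzero[OF B cs] by blast
  have pZZ: "?pZ \<subseteq> Z" using Z by (auto intro!: subspace_add[OF Z(1)] subspace_scale[OF Z(1)])
  \<comment> \<open>Independence of the roots \<open>a s\<close> of the basis elements \<open>s\<close> needs \<open>a s\<close> to be a multiple of \<open>s\<close>
    whenever the order of \<open>s\<close> is prime to \<open>p\<close>.\<close>
  have "\<exists>a. a \<in> Z \<and> p \<cdot> a - s \<in> B \<and> (\<forall>n. n \<cdot> s \<in> B \<longrightarrow> p dvd n \<or> (\<exists>v. a = v \<cdot> s))"
    if s: "s \<in> S" for s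
  proof (cases "\<exists>n. n \<cdot> s \<in> B \<and> \<not> p dvd n")
    case True
    then obtain n where n: "n \<cdot> s \<in> B" "\<not> p dvd n" by blast
    then have "coprime n p" using p prime_imp_coprime by (metis coprime_commute)
    then obtain u v where "u * n + v * p = 1" using bezout_int[of n p] by auto
    then have "v * p - 1 = - u * n" by (simp add: algebra_simps)
    then have "p \<cdot> (v \<cdot> s) - s = (- u) \<cdot> (n \<cdot> s)"
      by (metis mult.commute scale_left_diff_distrib scale_one scale_scale)
    then have "p \<cdot> (v \<cdot> s) - s \<in> B" using subspace_scale[OF B n(1)] by metis
    moreover have "v \<cdot> s \<in> Z" using s S(1) pZZ Z(1) by (intro subspace_scale) auto
    ultimately show ?thesis by blast
  next
    case False
    obtain z b where "s = p \<cdot> z + b" "z \<in> Z" "b \<in> B" using s S(1) by blast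
    then have "z \<in> Z" "p \<cdot> z - s \<in> B" using subspace_neg[OF B] by auto
    then show ?thesis using False by blast
  qed
  then obtain a where a: "\<And>s. s \<in> S \<Longrightarrow> a s \<in> Z" "\<And>s. s \<in> S \<Longrightarrow> p \<cdot> a s - s \<in> B"
      "\<And>s n. s \<in> S \<Longrightarrow> n \<cdot> s \<in> B \<Longrightarrow> p dvd n \<or> (\<exists>v. a s = v \<cdot> s)"
    by metis
  have pa_sum: "(\<Sum>s\<in>T. c s \<cdot> (p \<cdot> a s - s)) \<in> B" if "T \<subseteq> S" for T c
    by (rule subspace_sum[OF B], rule subspace_scale[OF B], rule a(2)) (use that in blast)
  \<comment> \<open>The purpose of the special choice of roots: whatever kills \<open>s\<close>
    turns the root of \<open>s\<close> into a multiple of \<open>s\<close> itself, hence into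
    something divisible by \<open>p\<close>.\<close>
  have mult_a: "\<exists>k. n \<cdot> a s - k \<cdot> s \<in> B" if s: "s \<in> S" "n \<cdot> s \<in> B" for s n
  proof -
    consider "p dvd n" | v where "a s = v \<cdot> s" using a(3)[OF s] by blast
    then show ?thesis
    proof cases
      case 1
      then obtain k where "n = k * p" by (metis dvd_def mult.commute)
      then have "n \<cdot> a s - k \<cdot> s = k \<cdot> (p \<cdot> a s - s)" by (simp add: scale_right_diff_distrib)
      then show ?thesis using subspace_scale[OF B a(2)[OF s(1)]] by metis
    next
      case 2
      then show ?thesis using subspace_0[OF B] by (intro exI[of _ "n * v"]) simp
    qed
  qed
  have inj: "inj_on a S"
  proof (rule inj_onI, rule ccontr)
    fix s s' assume ss: "s \<in> S" "s' \<in> S" "a s = a s'" "s \<noteq> s'"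
    have "(p \<cdot> a s' - s') - (p \<cdot> a s - s) \<in> B" by (rule subspace_diff[OF B a(2)[OF ss(2)] a(2)[OF ss(1)]])
    then have "s - s' \<in> B" unfolding ss(3) by simp
    moreover have "(\<Sum>t\<in>{s,s'}. (if t = s then 1 else -1) \<cdot> t) = s - s'" using ss(4) by simp
    ultimately have B': "(\<Sum>t\<in>{s,s'}. (if t = s then 1 else -1) \<cdot> t) \<in> B" by metis
    have "(if s = s then 1 else -1) \<cdot> s \<in> B" by (rule indep_modD[OF S(3) _ _ B']) (use ss(1,2) in auto)
    then have "s \<in> B" by simp
    then show False using ss(1) S(2) by blast
  qed
  \<comment> \<open>\<open>E\<close> is the part of \<open>Z\<close> killed by \<open>p\<close>
    modulo \<open>B\<close>, and \<open>D\<close> consists of its elements that are also divisible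
    by \<open>p\<close>.\<close>
  define E where "E = {z \<in> Z. p \<cdot> z \<in> B}"
  define D where "D = {z \<in> E. \<exists>w\<in>Z. z - p \<cdot> w \<in> B}"
  have E: "subspace E"
  proof (rule subspaceI)
    show "0 \<in> E" using subspace_0[OF Z(1)] subspace_0[OF B] by (simp add: E_def)
    show "x + y \<in> E" if "x \<in> E" "y \<in> E" for x y
      using that subspace_add[OF Z(1)] subspace_add[OF B] by (simp add: E_def scale_right_distrib)
    show "c \<cdot> x \<in> E" if "x \<in> E" for c x
      using that subspace_scale[OF Z(1)] subspace_scale[OF B, of "p \<cdot> x" c]
      by (simp add: E_def mult.commute)
  qed
  have D: "subspace D"
  proof (rule subspaceI)
    show "0 \<in> D" using subspace_0[OF E] subspace_0[OF Z(1)] subspace_0[OF B] unfolding D_def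
      by (auto intro!: bexI[of _ 0])
    fix x y assume "x \<in> D" "y \<in> D"
    then obtain w v where wv: "x \<in> E" "y \<in> E" "w \<in> Z" "v \<in> Z" "x - p \<cdot> w \<in> B" "y - p \<cdot> v \<in> B"
      unfolding D_def by blast
    have "(x - p \<cdot> w) + (y - p \<cdot> v) \<in> B" by (intro subspace_add[OF B] wv)
    then have "x + y - p \<cdot> (w + v) \<in> B" by (simp add: algebra_simps)
    then show "x + y \<in> D" using wv E Z(1) unfolding D_def by (blast intro: subspace_add)
  next
    fix x c assume "x \<in> D"
    then obtain w where w: "x \<in> E" "w \<in> Z" "x - p \<cdot> w \<in> B" unfolding D_def by blast
    have "c \<cdot> (x - p \<cdot> w) \<in> B" by (intro subspace_scale[OF B] w)
    then have "c \<cdot> x - p \<cdot> (c \<cdot> w) \<in> B" by (simp add: scale_right_diff_distrib mult.commute)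
    then show "c \<cdot> x \<in> D" using w E Z(1) unfolding D_def by (blast intro: subspace_scale)
  qed
  have BD: "B \<subseteq> D"
    using Z subspace_0[OF Z(1)] subspace_scale[OF B] unfolding D_def E_def by (auto intro!: bexI[of _ 0])
  have pE: "p \<cdot> x \<in> D" if "x \<in> E" for x using that BD by (auto simp: E_def)
  obtain C where C: "C \<subseteq> E" "E \<subseteq> span (C \<union> D)"
    and Cind0: "\<forall>T c. finite T \<longrightarrow> T \<subseteq> C \<longrightarrow> (\<Sum>t\<in>T. c t \<cdot> t) \<in> D \<longrightarrow> (\<forall>t\<in>T. p dvd c t)"
    by (rule exE[OF exists_complement_mod_prime[OF D p E]]) (use pE in auto)
  have Cind: "p dvd c t" if "finite T" "T \<subseteq> C" "(\<Sum>t\<in>T. c t \<cdot> t) \<in> D" "t \<in> T" for T c t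
    using Cind0[THEN spec[of _ T], THEN spec[of _ c]] that by simp
  let ?S = "a ` S \<union> C"
  have disj: "a ` S \<inter> C = {}"
  proof (rule ccontr)
    assume "a ` S \<inter> C \<noteq> {}"
    then obtain s where s: "s \<in> S" "a s \<in> C" by blast
    then have "p \<cdot> a s \<in> B" using C E_def by blast
    then have "s \<in> B" using a(2)[OF s(1)] subspace_diff[OF B, of "p \<cdot> a s" "p \<cdot> a s - s"] by simp
    then show False using s S(2) by blast
  qed
  have ind: "indep_mod B ?S"
    unfolding indep_mod_def
  proof (intro allI impI)
    fix T c assume T: "finite T" "T \<subseteq> ?S" and sB: "(\<Sum>t\<in>T. c t \<cdot> t) \<in> B"
    define T1 where "T1 = {s \<in> S. a s \<in> T}"
    define T2 where "T2 = T \<inter> C"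
    have Teq: "T = a ` T1 \<union> T2" using T(2) by (auto simp: T1_def T2_def)
    have inj1: "inj_on a T1" using inj by (rule inj_on_subset) (simp add: T1_def)
    have "finite (a ` T1)" by (rule finite_subset[OF _ T(1)]) (auto simp: T1_def)
    then have fin: "finite T1" "finite T2" using T(1) inj1 by (simp_all add: finite_image_iff T2_def)
    define x where "x = (\<Sum>s\<in>T1. c (a s) \<cdot> a s)"
    define y where "y = (\<Sum>t\<in>T2. c t \<cdot> t)"
    have xy: "(\<Sum>t\<in>T. c t \<cdot> t) = x + y"
    proof -
      have "a ` T1 \<inter> T2 = {}" using disj by (auto simp: T1_def T2_def)
      then have "(\<Sum>t\<in>T. c t \<cdot> t) = (\<Sum>t\<in>a ` T1. c t \<cdot> t) + y"
        unfolding Teq y_def using fin by (intro sum.union_disjoint) simp_all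
      then show ?thesis unfolding x_def by (simp add: sum.reindex[OF inj1])
    qed
    have T1S: "T1 \<subseteq> S" and T2C: "T2 \<subseteq> C" by (auto simp: T1_def T2_def)
    have yE: "y \<in> E" unfolding y_def using C(1) T2C by (intro subspace_sum[OF E] subspace_scale[OF E]) auto
    \<comment> \<open>Multiplication by \<open>p\<close> removes the part from \<open>C\<close> and
      turns the roots back into \<open>S\<close>, whose independence can then be used.\<close>
    have pxB: "p \<cdot> x \<in> B"
    proof -
      have "p \<cdot> (x + y) - p \<cdot> y \<in> B"
        using subspace_diff[OF B subspace_scale[OF B sB, of p], of "p \<cdot> y"] yE
        unfolding xy E_def by simp
      then show ?thesis by (simp add: scale_right_distrib)
    qed
    have "(\<Sum>s\<in>T1. c (a s) \<cdot> s) = p \<cdot> x - (\<Sum>s\<in>T1. c (a s) \<cdot> (p \<cdot> a s - s))"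
      unfolding x_def scale_sum_right sum_subtractf[symmetric]
      by (rule sum.cong) (auto simp: scale_right_diff_distrib mult.commute)
    also have "\<dots> \<in> B" by (rule subspace_diff[OF B pxB pa_sum[OF T1S]])
    finally have "c (a s) \<cdot> s \<in> B" if "s \<in> T1" for s
      using indep_modD[OF S(3) fin(1) T1S _ that, of "\<lambda>s. c (a s)"] by blast
    then have "\<forall>s\<in>T1. \<exists>k. c (a s) \<cdot> a s - k \<cdot> s \<in> B" using mult_a T1S by blast
    then obtain k where k: "\<And>s. s \<in> T1 \<Longrightarrow> c (a s) \<cdot> a s - k s \<cdot> s \<in> B" by metis
    have xk: "x - (\<Sum>s\<in>T1. k s \<cdot> s) \<in> B"
      unfolding x_def sum_subtractf[symmetric] by (intro subspace_sum[OF B] k)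
    \<comment> \<open>Being killed by \<open>p\<close> and divisible by \<open>p\<close>, the part
      \<open>x\<close> lies in \<open>D\<close>. Then so does \<open>y\<close>, and the choice of
      \<open>C\<close> forces its coefficients to be multiples of \<open>p\<close>.\<close>
    have "\<exists>w\<in>Z. x - p \<cdot> w \<in> B"
    proof -
      let ?w = "\<Sum>s\<in>T1. k s \<cdot> a s"
      have "?w \<in> Z" using a(1) T1S by (intro subspace_sum[OF Z(1)] subspace_scale[OF Z(1)]) auto
      have "(\<Sum>s\<in>T1. k s \<cdot> s) - p \<cdot> ?w = - (\<Sum>s\<in>T1. k s \<cdot> (p \<cdot> a s - s))"
        unfolding scale_sum_right sum_subtractf[symmetric] sum_negf[symmetric]
        by (rule sum.cong) (auto simp: scale_right_diff_distrib mult.commute)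
      also have "\<dots> \<in> B" by (rule subspace_neg[OF B pa_sum[OF T1S]])
      finally have "(x - (\<Sum>s\<in>T1. k s \<cdot> s)) + ((\<Sum>s\<in>T1. k s \<cdot> s) - p \<cdot> ?w) \<in> B"
        by (intro subspace_add[OF B] xk)
      then show ?thesis using \<open>?w \<in> Z\<close> by auto
    qed
    moreover have "x \<in> Z" unfolding x_def using a(1) T1S by (intro subspace_sum[OF Z(1)] subspace_scale[OF Z(1)]) auto
    ultimately have "x \<in> D" using pxB by (auto simp: D_def E_def)
    moreover have "x + y \<in> D" using BD sB xy by auto
    ultimately have "y \<in> D" using subspace_diff[OF D, of "x + y" x] by simp
    then have pd: "p dvd c t" if "t \<in> T2" for t using Cind[OF fin(2) T2C _ that, of c] unfolding y_def by blast
    have cB2: "c t \<cdot> t \<in> B" if t: "t \<in> T2" for t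
    proof -
      obtain k where "c t = k * p" using pd[OF t] by (metis dvd_def mult.commute)
      moreover have "p \<cdot> t \<in> B" using t T2C C(1) E_def by blast
      ultimately show ?thesis using subspace_scale[OF B, of "p \<cdot> t" k] by simp
    qed
    \<comment> \<open>With \<open>y\<close> disposed of, \<open>x\<close> is in \<open>B\<close>,
      and independence of \<open>S\<close> is used a second time, now for the coefficients
      \<open>k\<close>.\<close>
    have "y \<in> B" unfolding y_def by (intro subspace_sum[OF B] cB2)
    then have "x \<in> B" using sB xy subspace_diff[OF B, of "x + y" y] by simp
    then have "(\<Sum>s\<in>T1. k s \<cdot> s) \<in> B" using xk subspace_diff[OF B, of x "x - (\<Sum>s\<in>T1. k s \<cdot> s)"] by simp
    then have ks: "k s \<cdot> s \<in> B" if "s \<in> T1" for s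
      using indep_modD[OF S(3) fin(1) T1S _ that, of k] by blast
    have cB1: "c (a s) \<cdot> a s \<in> B" if "s \<in> T1" for s
      using subspace_add[OF B k[OF that] ks[OF that]] by simp
    show "\<forall>t\<in>T. c t \<cdot> t \<in> B" using cB1 cB2 Teq by blast
  qed
  have Sspan: "span (S \<union> B) \<subseteq> span (?S \<union> B)"
  proof (rule span_minimal)
    show "S \<union> B \<subseteq> span (?S \<union> B)"
    proof
      fix s assume "s \<in> S \<union> B"
      then consider "s \<in> B" | "s \<in> S" by blast
      then show "s \<in> span (?S \<union> B)"
      proof cases
        case 1
        then show ?thesis by (intro span_base) auto
      next
        case 2
        have "p \<cdot> a s - (p \<cdot> a s - s) \<in> span (?S \<union> B)"
          by (rule span_diff; (intro span_scale)?; rule span_base) (use 2 a in auto)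
        then show ?thesis by simp
      qed
    qed
  qed simp
  have DS: "D \<subseteq> span (?S \<union> B)"
  proof
    fix z assume "z \<in> D"
    then obtain w where w: "w \<in> Z" "z - p \<cdot> w \<in> B" by (auto simp: D_def)
    have "z = p \<cdot> w + (z - p \<cdot> w)" by simp
    then have "z \<in> ?pZ" using w by blast
    then show "z \<in> span (?S \<union> B)" using S(4) Sspan by blast
  qed
  have ES: "E \<subseteq> span (?S \<union> B)"
  proof -
    have "C \<union> D \<subseteq> span (?S \<union> B)" using DS by (auto intro: span_base)
    then have "span (C \<union> D) \<subseteq> span (?S \<union> B)" by (simp add: span_minimal)
    then show ?thesis using C by blast
  qed
  have gen: "Z \<subseteq> span (?S \<union> B)"
  proof
    fix z assume z: "z \<in> Z"
    have "p \<cdot> z + 0 \<in> ?pZ" using z subspace_0[OF B] by blast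
    then have "p \<cdot> z \<in> span (S \<union> B)" using S(4) by auto
    then obtain T c where T: "finite T" "T \<subseteq> S" "p \<cdot> z - (\<Sum>s\<in>T. c s \<cdot> s) \<in> B"
      using span_mod_explicit[OF B] by blast
    \<comment> \<open>Replacing every \<open>s\<close> by its root divides the expansion of
      \<open>p \<cdot> z\<close> by \<open>p\<close>; the error \<open>z - u\<close> is killed by
      \<open>p\<close>.\<close>
    define u where "u = (\<Sum>s\<in>T. c s \<cdot> a s)"
    have uZ: "u \<in> Z" unfolding u_def using a(1) T by (intro subspace_sum[OF Z(1)] subspace_scale[OF Z(1)]) auto
    have "(\<Sum>s\<in>T. c s \<cdot> s) - p \<cdot> u = - (\<Sum>s\<in>T. c s \<cdot> (p \<cdot> a s - s))"
      unfolding u_def scale_sum_right sum_subtractf[symmetric] sum_negf[symmetric]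
      by (rule sum.cong) (auto simp: scale_right_diff_distrib mult.commute)
    also have "\<dots> \<in> B" by (rule subspace_neg[OF B pa_sum[OF T(2)]])
    finally have "(p \<cdot> z - (\<Sum>s\<in>T. c s \<cdot> s)) + ((\<Sum>s\<in>T. c s \<cdot> s) - p \<cdot> u) \<in> B"
      by (intro subspace_add[OF B] T)
    then have "p \<cdot> (z - u) \<in> B" by (simp add: scale_right_diff_distrib)
    then have "z - u \<in> E" using z uZ Z(1) by (auto simp: E_def intro: subspace_diff)
    moreover have "u \<in> span (?S \<union> B)" unfolding u_def
      by (intro span_sum span_scale span_base) (use T in auto)
    ultimately show "z \<in> span (?S \<union> B)" using ES by (metis diff_add_cancel span_add subsetD)
  qed
  have "?S \<subseteq> Z" using a(1) C(1) by (auto simp: E_def)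
  then show ?thesis using ind gen unfolding cyclic_sum_mod_def by blast
qed

text \<open>Primes are split off \<open>K\<close> one at a time: if K = p k, then \<open>k\<close>
  alone carries pZ + B into the free part. For K = 1 the group itself lies in a free group of finite
  rank modulo \<open>B\<close>.\<close>

lemma cyclic_sum_mod_of_multiple:
  assumes B: "subspace B" and F: "finite F" "free_mod B F"
    and Z: "subspace Z" "B \<subseteq> Z" and K: "K > 0"
    and span: "\<And>z. z \<in> Z \<Longrightarrow> int K \<cdot> z \<in> span (F \<union> B)"
  shows "cyclic_sum_mod B Z"
  using K Z span
proof (induction K arbitrary: Z rule: less_induct)
  case (less K)
  show ?case
  proof (cases "K = 1")
    case True
    then have "Z \<subseteq> span (F \<union> B)" using less.prems by auto
    then show ?thesis
      using subspace_of_free_mod[OF B F less.prems(2)] free_imp_indep_mod[OF B]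
      unfolding cyclic_sum_mod_def by blast
  next
    case False
    then obtain p where p: "prime p" "p dvd K" using prime_factor_nat by blast
    then obtain k where k: "K = p * k" by blast
    then have k0: "k > 0" "k < K" using less.prems(1) prime_gt_1_nat[OF p(1)] by auto
    let ?pZ = "{int p \<cdot> z + b |z b. z \<in> Z \<and> b \<in> B}"
    have 1: "subspace ?pZ"
    proof (rule subspaceI)
      show "0 \<in> ?pZ" using subspace_0[OF B] subspace_0[OF less.prems(2)]
        by (intro CollectI exI[of _ 0]) auto
      fix x y assume "x \<in> ?pZ" "y \<in> ?pZ"
      then obtain z b z' b' where h: "x = int p \<cdot> z + b" "y = int p \<cdot> z' + b'" "z \<in> Z" "z' \<in> Z" "b \<in> B" "b' \<in> B"
        by blast
      have "x + y = int p \<cdot> (z + z') + (b + b')" unfolding h by (simp add: algebra_simps)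
      then show "x + y \<in> ?pZ" using h subspace_add[OF B] subspace_add[OF less.prems(2)] by blast
    next
      fix x c assume "x \<in> ?pZ"
      then obtain z b where h: "x = int p \<cdot> z + b" "z \<in> Z" "b \<in> B" by blast
      have "c \<cdot> x = int p \<cdot> (c \<cdot> z) + c \<cdot> b" unfolding h by (simp add: algebra_simps)
      then show "c \<cdot> x \<in> ?pZ" using h subspace_scale[OF B] subspace_scale[OF less.prems(2)] by blast
    qed
    have 2: "B \<subseteq> ?pZ"
    proof
      fix b assume "b \<in> B"
      then have "int p \<cdot> 0 + b \<in> ?pZ" using subspace_0[OF less.prems(2)] by blast
      then show "b \<in> ?pZ" by (simp only: scale_zero_right add_0_left)
    qed
    have 3: "int k \<cdot> y \<in> span (F \<union> B)" if y: "y \<in> ?pZ" for y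
    proof -
      obtain z b where h: "y = int p \<cdot> z + b" "z \<in> Z" "b \<in> B" using y by blast
      have "int k \<cdot> y = int K \<cdot> z + int k \<cdot> b" unfolding h k by (simp add: algebra_simps)
      moreover have "int k \<cdot> b \<in> span (F \<union> B)" by (intro span_scale span_base) (use h in auto)
      ultimately show ?thesis using less.prems(4)[OF h(2)] by (simp add: span_add)
    qed
    have "cyclic_sum_mod B ?pZ" by (rule less.IH[OF k0(2,1) 1 2 3])
    then show ?thesis
      by (rule cyclic_sum_mod_of_prime_multiple[OF B less.prems(2,3), rotated]) (use p(1) in simp)
  qed
qed

text \<open>A free subset of \<open>F\<close> replaces \<open>F\<close> at the price of a factor
  \<open>M\<close>. Modulo \<open>B\<close> only zero has finite order in the free part, so
  \<open>M * K\<close>, which carries \<open>Z\<close> there, kills all torsion.\<close>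

theorem multiple_in_finite_span:
  assumes B: "subspace B" and F: "finite F" and Z: "subspace Z" "B \<subseteq> Z" and K: "K > 0"
    and span: "\<And>z. z \<in> Z \<Longrightarrow> int K \<cdot> z \<in> span (F \<union> B)"
  shows "cyclic_sum_mod B Z"
    and "\<exists>M::nat. M > 0 \<and> (\<forall>z\<in>Z. (\<exists>n::nat. n > 0 \<and> int n \<cdot> z \<in> B) \<longrightarrow> int M \<cdot> z \<in> B)"
proof -
  obtain F0 M where F0: "F0 \<subseteq> F" "free_mod B F0" and M: "M > 0"
      "\<And>f. f \<in> F \<Longrightarrow> int M \<cdot> f \<in> span (F0 \<union> B)"
    using maximal_free_subset[OF B F] by blast
  have fin: "finite F0" using F0 F finite_subset by blast
  have sp: "int (M * K) \<cdot> z \<in> span (F0 \<union> B)" if z: "z \<in> Z" for z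
  proof -
    have "span (F \<union> B) \<subseteq> {y. int M \<cdot> y \<in> span (F0 \<union> B)}"
    proof (rule span_minimal)
      show "F \<union> B \<subseteq> {y. int M \<cdot> y \<in> span (F0 \<union> B)}"
        using M(2) by (auto intro: span_scale span_base)
      show "subspace {y. int M \<cdot> y \<in> span (F0 \<union> B)}"
        by (rule subspaceI) (auto simp: scale_right_distrib span_add span_zero scale_left_commute[of "int M"] span_scale simp del: scale_scale)
    qed
    then show ?thesis using span[OF z] by auto
  qed
  have MK: "M * K > 0" using M K by simp
  show "cyclic_sum_mod B Z" by (rule cyclic_sum_mod_of_multiple[OF B fin F0(2) Z MK sp])
  have "int (M * K) \<cdot> z \<in> B" if z: "z \<in> Z" and n: "n > 0" "int n \<cdot> z \<in> B" for z n
  proof -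
    obtain T c where T: "finite T" "T \<subseteq> F0" "int (M * K) \<cdot> z - (\<Sum>t\<in>T. c t \<cdot> t) \<in> B"
      using span_mod_explicit[OF B sp[OF z]] by blast
    have "int (M * K) \<cdot> (int n \<cdot> z) - int n \<cdot> (int (M * K) \<cdot> z - (\<Sum>t\<in>T. c t \<cdot> t)) \<in> B"
      by (intro subspace_diff[OF B] subspace_scale[OF B] n T)
    then have "int n \<cdot> (\<Sum>t\<in>T. c t \<cdot> t) \<in> B"
      by (simp add: scale_right_diff_distrib mult_ac)
    then have "(\<Sum>t\<in>T. (int n * c t) \<cdot> t) \<in> B" by (simp add: scale_sum_right)
    then have "int n * c t = 0" if "t \<in> T" for t
      using free_modD[OF F0(2) T(1,2) _ that, of "\<lambda>t. int n * c t"] by blast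
    then have "c t = 0" if "t \<in> T" for t using that n by simp
    then have "(\<Sum>t\<in>T. c t \<cdot> t) = 0" by simp
    then show ?thesis using T(3) by simp
  qed
  then show "\<exists>M::nat. M > 0 \<and> (\<forall>z\<in>Z. (\<exists>n::nat. n > 0 \<and> int n \<cdot> z \<in> B) \<longrightarrow> int M \<cdot> z \<in> B)"
    using MK by blast
qed

section \<open>Transfer from Z/B to a group isomorphic to it\<close>

lemma additive_onto_group_scale:
  fixes G :: "('g, 'm) monoid_scheme" (structure)
  assumes G: "comm_group G" and Z: "subspace Z" and fZ: "f ` Z \<subseteq> carrier G"
    and add: "\<And>x y. x \<in> Z \<Longrightarrow> y \<in> Z \<Longrightarrow> f (x + y) = f x \<otimes>\<^bsub>G\<^esub> f y" and x: "x \<in> Z"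
  shows "f (n \<cdot> x) = f x [^]\<^bsub>G\<^esub> n"
proof -
  interpret comm_group G by (rule G)
  have fc: "f y \<in> carrier G" if "y \<in> Z" for y using fZ that by blast
  have f0: "f 0 = \<one>"
  proof -
    have 0: "0 \<in> Z" by (rule subspace_0[OF Z])
    have "f 0 \<otimes> f 0 = f 0" using add[OF 0 0] by simp
    then show ?thesis using fc[OF 0] by simp
  qed
  have nat: "f (int k \<cdot> x) = f x [^] k" for k
  proof (induction k)
    case (Suc k)
    have "int (Suc k) \<cdot> x = int k \<cdot> x + x" by (simp add: scale_left_distrib add.commute)
    then show ?case using Suc add[OF subspace_scale[OF Z x] x] by simp
  qed (simp add: f0)
  have neg: "f (- y) = inv (f y)" if y: "y \<in> Z" for y
  proof -
    have "f (- y) \<otimes> f y = \<one>" using add[OF subspace_neg[OF Z y] y] f0 by simp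
    then show ?thesis using fc[OF y] fc[OF subspace_neg[OF Z y]] by (metis inv_equality)
  qed
  show ?thesis
  proof (cases n rule: int_cases2)
    case (nonneg k)
    then show ?thesis using nat by (simp add: int_pow_int)
  next
    case (nonpos k)
    have "n \<cdot> x = - (int k \<cdot> x)" using nonpos by simp
    then have "f (n \<cdot> x) = inv (f x [^] k)" using neg[OF subspace_scale[OF Z x]] nat by simp
    then show ?thesis using nonpos int_pow_neg_int[OF fc[OF x]] by simp
  qed
qed

lemma direct_sum_of_cyclic_quotient:
  fixes G :: "('g, 'm) monoid_scheme" (structure)
  assumes G: "comm_group G" and B: "subspace B" and Z: "subspace Z" and fZ: "f ` Z = carrier G"
    and add: "\<And>x y. x \<in> Z \<Longrightarrow> y \<in> Z \<Longrightarrow> f (x + y) = f x \<otimes>\<^bsub>G\<^esub> f y"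
    and ker: "\<And>x. x \<in> Z \<Longrightarrow> f x = \<one>\<^bsub>G\<^esub> \<longleftrightarrow> x \<in> B" and BZ: "B \<subseteq> Z"
    and cs: "cyclic_sum_mod B Z"
  shows "direct_sum_of_cyclic G"
proof -
  interpret comm_group G by (rule G)
  have fc: "f y \<in> carrier G" if "y \<in> Z" for y using fZ that by blast
  have scale: "f (n \<cdot> x) = f x [^] n" if "x \<in> Z" for n x
    by (rule additive_onto_group_scale[OF G Z _ add that]) (simp_all add: fZ)
  obtain S where S: "S \<subseteq> Z" "S \<inter> B = {}" "indep_mod B S" "Z \<subseteq> span (S \<union> B)"
    using cyclic_sum_mod_nonzero[OF B cs] by blast
  have fsum: "f (\<Sum>t\<in>T. c t \<cdot> t) = (\<Otimes>t\<in>T. f t [^] c t)" if "finite T" "T \<subseteq> Z" for T c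
    using that
  proof (induction T rule: finite_induct)
    case empty
    then show ?case using ker[OF subspace_0[OF Z]] subspace_0[OF B] by simp
  next
    case (insert t T)
    have "(\<Sum>t\<in>T. c t \<cdot> t) \<in> Z" using insert.prems by (intro subspace_sum[OF Z] subspace_scale[OF Z]) auto
    moreover have "t \<in> Z" using insert.prems by simp
    ultimately have "f (\<Sum>t\<in>insert t T. c t \<cdot> t) = f t [^] c t \<otimes> f (\<Sum>t\<in>T. c t \<cdot> t)"
      using insert.hyps add[of "c t \<cdot> t" "\<Sum>t\<in>T. c t \<cdot> t"] scale[of t "c t"] subspace_scale[OF Z] by simp
    moreover have "(\<lambda>t. f t [^] c t) \<in> T \<rightarrow> carrier G" using fc insert.prems by auto
    ultimately show ?case using insert fc by simp
  qed
  have eq_iff: "f x = f y \<longleftrightarrow> x - y \<in> B" if "x \<in> Z" "y \<in> Z" for x y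
  proof -
    have xy: "x - y \<in> Z" using that by (intro subspace_diff[OF Z])
    have "f x = f (x - y) \<otimes> f y" using add[OF xy that(2)] by simp
    then have "f x = f y \<longleftrightarrow> f (x - y) = \<one>" using fc[OF xy] fc[OF that(2)] r_cancel_one by simp
    then show ?thesis using ker[OF xy] by simp
  qed
  have inj: "inj_on f S"
  proof (rule inj_onI, rule ccontr)
    fix s s' assume ss: "s \<in> S" "s' \<in> S" "f s = f s'" "s \<noteq> s'"
    have "s - s' \<in> B" using eq_iff[of s s'] ss S(1) by blast
    moreover have "(\<Sum>t\<in>{s,s'}. (if t = s then 1 else -1) \<cdot> t) = s - s'" using ss(4) by simp
    ultimately have B': "(\<Sum>t\<in>{s,s'}. (if t = s then 1 else -1) \<cdot> t) \<in> B" by metis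
    have "(if s = s then 1 else -1) \<cdot> s \<in> B" by (rule indep_modD[OF S(3) _ _ B']) (use ss(1,2) in auto)
    then have "s \<in> B" by simp
    then show False using ss(1) S(2) by blast
  qed
  have reindex: "(\<Otimes>t\<in>f ` T. t [^] (c t :: int)) = (\<Otimes>t\<in>T. f t [^] c (f t))" if "T \<subseteq> S" for T c
    by (rule finprod_reindex) (use that fc S(1) inj_on_subset[OF inj that] in auto)
  show ?thesis
  proof (rule direct_sum_of_cyclicI[of "f ` S"])
    show "f ` S \<subseteq> carrier G" using fc S(1) by blast
  next
    fix x assume "x \<in> carrier G"
    then obtain z where z: "z \<in> Z" "x = f z" using fZ by blast
    then obtain T c where T: "finite T" "T \<subseteq> S" "z - (\<Sum>t\<in>T. c t \<cdot> t) \<in> B"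
      using span_mod_explicit[OF B, of z S] S(4) by blast
    \<comment> \<open>Coefficients have to be indexed by the images; \<open>f\<close> is injective
      on \<open>S\<close>, so each image remembers its generator.\<close>
    define e where "e u = c (inv_into S f u)" for u
    have TZ: "T \<subseteq> Z" using T(2) S(1) by blast
    have "(\<Sum>t\<in>T. c t \<cdot> t) \<in> Z" using TZ by (intro subspace_sum[OF Z] subspace_scale[OF Z]) auto
    then have "x = f (\<Sum>t\<in>T. c t \<cdot> t)" using eq_iff z T(3) by blast
    also have "\<dots> = (\<Otimes>t\<in>T. f t [^] c t)" by (rule fsum[OF T(1) TZ])
    also have "\<dots> = (\<Otimes>t\<in>T. f t [^] e (f t))"
    proof (rule finprod_cong')
      show "(\<lambda>t. f t [^] e (f t)) \<in> T \<rightarrow> carrier G" using fc TZ by auto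
      show "f t [^] c t = f t [^] e (f t)" if "t \<in> T" for t
      proof -
        have "inv_into S f (f t) = t" by (rule inv_into_f_f[OF inj]) (use that T(2) in blast)
        then show ?thesis by (simp add: e_def)
      qed
    qed simp
    also have "\<dots> = (\<Otimes>t\<in>f ` T. t [^] e t)" by (rule reindex[OF T(2), symmetric])
    finally show "\<exists>T (c::_ \<Rightarrow> int). finite T \<and> T \<subseteq> f ` S \<and> x = (\<Otimes>s\<in>T. s [^] c s)"
      using T(1,2) by (intro exI[of _ "f ` T"] exI[of _ e]) auto
  next
    fix T and c :: "_ \<Rightarrow> int" and s
    assume T: "finite T" "T \<subseteq> f ` S" "(\<Otimes>s\<in>T. s [^] c s) = \<one>" "s \<in> T"
    obtain U where U: "U \<subseteq> S" "T = f ` U" using T(2) by (metis subset_imageE)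
    have finU: "finite U" using T(1) U inj_on_subset[OF inj U(1)] by (simp add: finite_image_iff)
    have UZ: "U \<subseteq> Z" using U(1) S(1) by blast
    have "f (\<Sum>t\<in>U. c (f t) \<cdot> t) = \<one>"
      using T(3) unfolding U(2) reindex[OF U(1)] fsum[OF finU UZ] .
    moreover have "(\<Sum>t\<in>U. c (f t) \<cdot> t) \<in> Z" using UZ by (intro subspace_sum[OF Z] subspace_scale[OF Z]) auto
    ultimately have sB: "(\<Sum>t\<in>U. c (f t) \<cdot> t) \<in> B" using ker by blast
    obtain u where u: "u \<in> U" "s = f u" using T(4) U(2) by blast
    have "c (f u) \<cdot> u \<in> B" by (rule indep_modD[OF S(3) finU U(1) sB u(1)])
    then have "f (c (f u) \<cdot> u) = \<one>" using ker BZ by blast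
    then show "s [^] c s = \<one>" using scale[of u "c (f u)"] u UZ by auto
  qed
qed

end

section \<open>Baire category in sequence spaces\<close>

text \<open>The basic open sets of the product of countably many discrete spaces. The topology is
  used only through these finite words.\<close>

definition cyl :: "'a list \<Rightarrow> (nat \<Rightarrow> 'a) set" where
  "cyl p = {z. \<forall>i<length p. z i = p ! i}"

text \<open>Nowhere dense: every basic open set contains a smaller one that misses
  \<open>N\<close>.\<close>

definition nwd :: "(nat \<Rightarrow> 'a) set \<Rightarrow> bool" where
  "nwd N \<longleftrightarrow> (\<forall>p. \<exists>q. cyl (p @ q) \<inter> N = {})"

definition meagre :: "(nat \<Rightarrow> 'a) set \<Rightarrow> bool" where
  "meagre M \<longleftrightarrow> (\<exists>N::nat \<Rightarrow> _. (\<forall>n. nwd (N n)) \<and> M \<subseteq> (\<Union>n. N n))"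

lemma cyl_append: "cyl (p @ q) \<subseteq> cyl p"
  unfolding cyl_def by (auto simp: nth_append)

lemma in_cyl_iff: "z \<in> cyl p \<longleftrightarrow> p = map z [0..<length p]"
proof
  assume "z \<in> cyl p"
  then show "p = map z [0..<length p]" by (intro nth_equalityI) (simp_all add: cyl_def)
next
  assume eq: "p = map z [0..<length p]"
  show "z \<in> cyl p"
    unfolding cyl_def
  proof (intro CollectI allI impI)
    fix i assume "i < length p"
    then have "map z [0..<length p] ! i = z i" by simp
    then show "z i = p ! i" by (subst eq) (rule sym)
  qed
qed

lemma in_cyl_extend:
  assumes z: "z \<in> cyl p" and le: "length p \<le> n"
  obtains q where "map z [0..<n] = p @ q"
proof -
  obtain m where m: "n = length p + m" using le le_Suc_ex by blast
  have "[0..<n] = [0..<length p] @ [length p..<n]"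
    unfolding m by (rule upt_add_eq_append) simp
  then have "map z [0..<n] = map z [0..<length p] @ map z [length p..<n]" by (simp only: map_append)
  also have "map z [0..<length p] = p" by (rule in_cyl_iff[THEN iffD1, OF z, symmetric])
  finally show ?thesis by (rule that)
qed

lemma cyl_compatible:
  assumes "cyl p \<inter> cyl q \<noteq> {}"
  obtains p' q' where "p @ p' = q @ q'"
proof -
  obtain z where z: "z \<in> cyl p" "z \<in> cyl q" using assms by blast
  let ?n = "max (length p) (length q)"
  obtain p' where p': "map z [0..<?n] = p @ p'" using in_cyl_extend[OF z(1), of ?n] by auto
  obtain q' where "map z [0..<?n] = q @ q'" using in_cyl_extend[OF z(2), of ?n] by auto
  then show ?thesis using that p' by simp
qed

lemma nwd_Un: 
  assumes "nwd M" "nwd N" shows "nwd (M \<union> N)"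
  unfolding nwd_def
proof
  fix p
  obtain q where "cyl (p @ q) \<inter> M = {}" using assms(1) nwd_def by blast
  moreover obtain r where "cyl ((p @ q) @ r) \<inter> N = {}" using assms(2) nwd_def by blast
  ultimately show "\<exists>q. cyl (p @ q) \<inter> (M \<union> N) = {}"
    using cyl_append[of "p @ q" r] by (intro exI[of _ "q @ r"]) auto
qed

lemma nwd_UN_lessThan: "(\<And>i. nwd (N i)) \<Longrightarrow> nwd (\<Union>i<n. N (i::nat))"
proof (induction n)
  case 0
  show ?case by (simp add: nwd_def)
next
  case (Suc n)
  then show ?case by (simp add: lessThan_Suc nwd_Un)
qed

lemma meagre_subset: "meagre N \<Longrightarrow> M \<subseteq> N \<Longrightarrow> meagre M"
  unfolding meagre_def by blast

lemma nwd_imp_meagre: "nwd N \<Longrightarrow> meagre N"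
  unfolding meagre_def by (intro exI[of _ "\<lambda>_. N"]) auto

lemma meagre_UN_nat:
  assumes "\<And>i::nat. meagre (M i)"
  shows "meagre (\<Union>i. M i)"
proof -
  have "\<forall>i. \<exists>N::nat \<Rightarrow> _. (\<forall>n. nwd (N n)) \<and> M i \<subseteq> (\<Union>n. N n)" using assms meagre_def by blast
  then obtain N :: "nat \<Rightarrow> nat \<Rightarrow> _" where N: "\<And>i n. nwd (N i n)" "\<And>i. M i \<subseteq> (\<Union>n. N i n)"
    by metis
  have "(\<Union>i. M i) \<subseteq> (\<Union>k. N (fst (prod_decode k)) (snd (prod_decode k)))"
  proof
    fix z assume "z \<in> (\<Union>i. M i)"
    then obtain i n where "z \<in> N i n" using N(2) by blast
    then show "z \<in> (\<Union>k. N (fst (prod_decode k)) (snd (prod_decode k)))"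
      by (intro UN_I[of "prod_encode (i, n)"]) auto
  qed
  then show ?thesis unfolding meagre_def using N(1)
    by (intro exI[of _ "\<lambda>k. N (fst (prod_decode k)) (snd (prod_decode k))"]) auto
qed

lemma meagre_empty: "meagre {}"
  unfolding meagre_def nwd_def by (intro exI[of _ "\<lambda>_. {}"]) auto

lemma meagre_UN:
  assumes "\<And>i::'i::countable. i \<in> I \<Longrightarrow> meagre (M i)"
  shows "meagre (\<Union>i\<in>I. M i)"
proof -
  have "meagre (\<Union>n. if from_nat n \<in> I then M (from_nat n) else {})"
    by (rule meagre_UN_nat) (simp add: assms meagre_empty)
  then show ?thesis
  proof (rule meagre_subset, intro subsetI)
    fix z assume "z \<in> (\<Union>i\<in>I. M i)"
    then obtain i where "i \<in> I" "z \<in> M i" by blast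
    then show "z \<in> (\<Union>n. if from_nat n \<in> I then M (from_nat n) else {})"
      by (intro UN_I[of "to_nat i"]) auto
  qed
qed

lemma meagre_Un: "meagre M \<Longrightarrow> meagre N \<Longrightarrow> meagre (M \<union> N)"
  using meagre_UN[of UNIV "\<lambda>b. if b then M else N"] by (simp add: UNIV_bool Un_commute)

lemma baire_cyl:
  assumes "meagre M"
  obtains z where "z \<in> cyl p" "z \<notin> M"
proof -
  obtain N :: "nat \<Rightarrow> _" where N: "\<And>n. nwd (N n)" "M \<subseteq> (\<Union>n. N n)"
    using assms meagre_def by blast
  \<comment> \<open>Nonempty extensions make the lengths of the words grow, so that the words
    determine a whole sequence.\<close>
  have "\<exists>q. q \<noteq> [] \<and> cyl (r @ q) \<inter> N n = {}" for r n
  proof -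
    obtain q where "cyl (r @ q) \<inter> N n = {}" using N(1) nwd_def by blast
    then show ?thesis using cyl_append[of "r @ q" "[undefined]"] by (intro exI[of _ "q @ [undefined]"]) auto
  qed
  then obtain Q where Q: "\<And>r n. Q r n \<noteq> []" "\<And>r n. cyl (r @ Q r n) \<inter> N n = {}" by metis
  define P where "P = rec_nat p (\<lambda>n r. r @ Q r n)"
  have P: "P 0 = p" "\<And>n. P (Suc n) = P n @ Q (P n) n" by (simp_all add: P_def)
  have len: "n \<le> length (P n)" for n
  proof (induction n)
    case (Suc n)
    have "length (Q (P n) n) > 0" using Q(1) by simp
    then show ?case using Suc by (simp only: P length_append)
  qed simp
  have ext: "\<exists>q. P (n + k) = P n @ q" for n k
    by (induction k) (auto simp: P)
  define z where "z i = P (Suc i) ! i" for i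
  have zP: "z \<in> cyl (P n)" for n
    unfolding cyl_def
  proof (intro CollectI allI impI)
    fix i assume i: "i < length (P n)"
    obtain q where q: "P (n + Suc i) = P n @ q" using ext by blast
    obtain q' where q': "P (Suc i + n) = P (Suc i) @ q'" using ext by blast
    have "P n ! i = P (n + Suc i) ! i" using i q by (simp add: nth_append)
    also have "\<dots> = P (Suc i) ! i" using q' len[of "Suc i"] by (simp add: nth_append add.commute)
    finally show "z i = P n ! i" by (simp add: z_def)
  qed
  have "z \<notin> N n" for n using Q(2)[of "P n" n] zP[of "Suc n"] by (auto simp: P)
  then show ?thesis using that[of z] zP[of 0] N(2) P(1) by auto
qed

text \<open>Otherwise the words \<open>w\<close> with \<open>R\<close> meagre in
  \<open>cyl w\<close> are dense below \<open>p\<close>: their cylinders cover \<open>cyl p\<close>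
  up to a nowhere dense set. There are only countably many words, so \<open>R\<close> would be
  meagre in \<open>cyl p\<close>.\<close>

lemma nonmeagre_extend:
  fixes R :: "(nat \<Rightarrow> 'a::countable) set"
  assumes "\<not> meagre (R \<inter> cyl p)"
  shows "\<exists>q. \<forall>r. \<not> meagre (R \<inter> cyl (p @ q @ r))"
proof (rule ccontr)
  assume "\<not> ?thesis"
  then have *: "\<And>q. \<exists>r. meagre (R \<inter> cyl (p @ q @ r))" by blast
  define W where "W = {w. meagre (R \<inter> cyl w)}"
  have 1: "meagre (\<Union>w\<in>W. R \<inter> cyl w)" by (rule meagre_UN) (simp add: W_def)
  have "nwd (cyl p - (\<Union>w\<in>W. cyl w))"
    unfolding nwd_def
  proof
    fix v
    show "\<exists>q. cyl (v @ q) \<inter> (cyl p - (\<Union>w\<in>W. cyl w)) = {}"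
    proof (cases "cyl v \<inter> cyl p = {}")
      case True
      then show ?thesis by (intro exI[of _ "[]"]) auto
    next
      case False
      then obtain v' p' where vp: "v @ v' = p @ p'" using cyl_compatible by blast
      obtain r where "meagre (R \<inter> cyl (p @ p' @ r))" using * by blast
      then have "v @ v' @ r \<in> W" using vp by (metis W_def append.assoc mem_Collect_eq)
      then show ?thesis by (intro exI[of _ "v' @ r"]) blast
    qed
  qed
  then have "meagre ((\<Union>w\<in>W. R \<inter> cyl w) \<union> (cyl p - (\<Union>w\<in>W. cyl w)))"
    by (intro meagre_Un 1 nwd_imp_meagre)
  then have "meagre (R \<inter> cyl p)" by (rule meagre_subset) blast
  then show False using assms by blast
qed

text \<open>
  \<open>code j\<close> divides \<open>Y\<close> into countably many pieces, and \<open>lim\<close> says that points in the intersection of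
  the closures of the images of nested pieces belong to the image of \<open>Y\<close>.  This replaces \<open>Y\<close> being a
  Polish space and \<open>f\<close> being continuous.
\<close>

theorem analytic_meagre_or_comeagre:
  fixes f :: "'y \<Rightarrow> nat \<Rightarrow> 'a::countable" and code :: "nat \<Rightarrow> 'y \<Rightarrow> 'c::countable"
  assumes lim: "\<And>s y z. (\<And>n. y n \<in> Y) \<Longrightarrow> (\<And>n j. j < n \<Longrightarrow> code j (y n) = s j)
       \<Longrightarrow> (\<And>n i. i < n \<Longrightarrow> f (y n) i = z i) \<Longrightarrow> z \<in> f ` Y"
    and nm: "\<not> meagre (f ` Y)"
  shows "\<exists>p. meagre (cyl p - f ` Y)"
proof -
  \<comment> \<open>\<open>R s\<close> is the image of the piece with code prefix \<open>s\<close>,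
    and \<open>D s\<close> the open set in which that image is nowhere meagre.\<close>
  define R where "R s = f ` {y \<in> Y. \<forall>j<length s. code j y = s ! j}" for s
  define U where "U s p \<longleftrightarrow> (\<forall>q. \<not> meagre (R s \<inter> cyl (p @ q)))" for s p
  define D where "D s = (\<Union>p\<in>{p. U s p}. cyl p)" for s
  have R_split: "R s = (\<Union>c. R (s @ [c]))" for s
  proof (intro subset_antisym subsetI)
    fix z assume "z \<in> R s"
    then obtain y where y: "y \<in> Y" "\<forall>j<length s. code j y = s ! j" "z = f y" unfolding R_def by blast
    then have "y \<in> {y \<in> Y. \<forall>j<length (s @ [code (length s) y]). code j y = (s @ [code (length s) y]) ! j}"
      by (auto simp: nth_append less_Suc_eq)
    then have "z \<in> R (s @ [code (length s) y])" unfolding R_def using y(3) by blast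
    then show "z \<in> (\<Union>c. R (s @ [c]))" by blast
  next
    fix z assume "z \<in> (\<Union>c. R (s @ [c]))"
    then obtain c y where "y \<in> Y" "z = f y" and y: "\<forall>j<Suc (length s). code j y = (s @ [c]) ! j"
      unfolding R_def by auto
    moreover have "\<forall>j<length s. code j y = s ! j"
      using y by (metis less_SucI nth_append)
    ultimately show "z \<in> R s" unfolding R_def by blast
  qed
  have U_ext: "\<exists>q. U s (p @ q)" if "\<not> meagre (R s \<inter> cyl p)" for s p
    using nonmeagre_extend[OF that] unfolding U_def by auto
  \<comment> \<open>\<open>R s\<close> is the countable union of the \<open>R (s @ [c])\<close>, so
    below any cylinder counted in \<open>D s\<close> one of these is nonmeagre, and then it is
    nonmeagre everywhere in some smaller cylinder.\<close>
  have nwdN: "nwd (D s - (\<Union>c. D (s @ [c])))" for s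
    unfolding nwd_def
  proof
    fix v
    show "\<exists>q. cyl (v @ q) \<inter> (D s - (\<Union>c. D (s @ [c]))) = {}"
    proof (cases "cyl v \<inter> D s = {}")
      case True
      then show ?thesis by (intro exI[of _ "[]"]) auto
    next
      case False
      then obtain p where p: "U s p" "cyl v \<inter> cyl p \<noteq> {}" unfolding D_def by blast
      then obtain v' p' where vp: "v @ v' = p @ p'" using cyl_compatible by blast
      have "\<not> meagre (R s \<inter> cyl (p @ p'))" using p(1) U_def by blast
      moreover have "R s \<inter> cyl (p @ p') = (\<Union>c\<in>UNIV. R (s @ [c]) \<inter> cyl (p @ p'))" using R_split[of s] by blast
      ultimately obtain c where "\<not> meagre (R (s @ [c]) \<inter> cyl (p @ p'))"
        using meagre_UN[of UNIV "\<lambda>c. R (s @ [c]) \<inter> cyl (p @ p')"] by auto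
      then obtain q where "U (s @ [c]) ((p @ p') @ q)" using U_ext by blast
      then have "U (s @ [c]) (v @ v' @ q)" using vp by (metis append.assoc)
      then have "cyl (v @ v' @ q) \<subseteq> D (s @ [c])" unfolding D_def by blast
      then show ?thesis by (intro exI[of _ "v' @ q"]) blast
    qed
  qed
  have "R [] = f ` Y" by (simp add: R_def)
  moreover have "f ` Y \<inter> cyl [] = f ` Y" by (auto simp: cyl_def)
  ultimately have "\<not> meagre (R [] \<inter> cyl [])" using nm by simp
  then obtain p0 where p0: "U [] p0" using U_ext[of "[]" "[]"] by auto
  \<comment> \<open>A point outside all exceptional sets stays in \<open>D\<close> along one
    infinite branch of codes. Every cylinder around it meets the images of all pieces on the branch,
    since these are nonmeagre there; this provides the sequence that \<open>lim\<close> asks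
    for.\<close>
  have "cyl p0 - f ` Y \<subseteq> (\<Union>s\<in>UNIV. D s - (\<Union>c. D (s @ [c])))"
  proof (rule subsetI, rule ccontr)
    fix z assume z: "z \<in> cyl p0 - f ` Y" and "z \<notin> (\<Union>s\<in>UNIV. D s - (\<Union>c. D (s @ [c])))"
    then have "\<forall>s. \<exists>c. z \<in> D s \<longrightarrow> z \<in> D (s @ [c])" by blast
    then obtain g where g: "\<And>s. z \<in> D s \<Longrightarrow> z \<in> D (s @ [g s])" by metis
    define L where "L = rec_nat [] (\<lambda>n l. l @ [g l])"
    have L: "L 0 = []" "\<And>n. L (Suc n) = L n @ [g (L n)]" by (simp_all add: L_def)
    define s where "s n = g (L n)" for n
    have Lmap: "L n = map s [0..<n]" for n by (induction n) (simp_all add: L s_def)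
    have zL: "z \<in> D (L n)" for n
    proof (induction n)
      case 0
      then show ?case using z p0 by (auto simp: D_def L)
    next
      case (Suc n)
      then show ?case using g by (simp add: L)
    qed
    have "\<exists>y. y \<in> Y \<and> (\<forall>j<n. code j y = s j) \<and> (\<forall>i<n. f y i = z i)" for n
    proof -
      obtain p where p: "U (L n) p" "z \<in> cyl p" using zL[of n] D_def by auto
      \<comment> \<open>Reading \<open>z\<close> at least up to \<open>n\<close> makes the chosen
        image agree with \<open>z\<close> below \<open>n\<close>.\<close>
      obtain q where q: "map z [0..<max n (length p)] = p @ q"
        using in_cyl_extend[OF p(2), of "max n (length p)"] by auto
      have "\<not> meagre (R (L n) \<inter> cyl (p @ q))" using p(1) U_def by blast
      then have "R (L n) \<inter> cyl (p @ q) \<noteq> {}" using meagre_empty by metis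
      then obtain y where y: "y \<in> Y" "\<forall>j<length (L n). code j y = L n ! j"
          "f y \<in> cyl (map z [0..<max n (length p)])"
        unfolding R_def q by blast
      have "\<forall>j<n. code j y = s j" using y(2) by (simp add: Lmap)
      moreover have "\<forall>i<n. f y i = z i" using y(3) by (simp add: cyl_def)
      ultimately show ?thesis using y(1) by blast
    qed
    then obtain y where "\<And>n. y n \<in> Y" "\<And>n j. j < n \<Longrightarrow> code j (y n) = s j" "\<And>n i. i < n \<Longrightarrow> f (y n) i = z i"
      by metis
    then have "z \<in> f ` Y" by (rule lim)
    then show False using z by blast
  qed
  moreover have "meagre (\<Union>s\<in>UNIV. D s - (\<Union>c. D (s @ [c])))"
    by (intro meagre_UN nwd_imp_meagre nwdN)
  ultimately show ?thesis using meagre_subset by blast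
qed

section \<open>Perfect sets avoiding a meagre relation\<close>

definition pair_seq :: "(nat \<Rightarrow> 'a) \<Rightarrow> (nat \<Rightarrow> 'b) \<Rightarrow> nat \<Rightarrow> 'a \<times> 'b" where
  "pair_seq x y i = (x i, y i)"

lemma pair_seq_in_cyl:
  assumes "x \<in> cyl p" "y \<in> cyl q" "length p = length q"
  shows "pair_seq x y \<in> cyl (zip p q)"
  using assms by (simp add: cyl_def pair_seq_def)

text \<open>One pair at a time: a word of pairs that leads out of \<open>K\<close> is split into its
  two components. The other words are padded to the same length, so that zipping loses no letters,
  and pairs settled earlier stay settled because cylinders only shrink.\<close>

lemma avoid_finitely_many_pairs:
  fixes G :: "'u \<Rightarrow> 'a list"
  assumes K: "nwd (K :: (nat \<Rightarrow> 'a \<times> 'a) set)" and "finite P"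
    and ne: "\<And>u v. (u, v) \<in> P \<Longrightarrow> u \<noteq> v \<and> u \<in> A \<and> v \<in> A" and G: "\<And>u. u \<in> A \<Longrightarrow> length (G u) = L"
  shows "\<exists>H m. (\<forall>u. \<exists>q. length q = m \<and> H u = G u @ q)
            \<and> (\<forall>(u,v)\<in>P. cyl (zip (H u) (H v)) \<inter> K = {})"
  using assms(2) ne
proof (induction P rule: finite_induct)
  case empty
  then show ?case by (intro exI[of _ G] exI[of _ 0]) auto
next
  case (insert uv P)
  obtain u v where uv: "uv = (u, v)" by force
  have uvA: "u \<noteq> v" "u \<in> A" "v \<in> A" using insert.prems[of u v] uv by auto
  obtain H m where H: "\<forall>w. \<exists>q. length q = m \<and> H w = G w @ q"
      and HP: "\<forall>(u,v)\<in>P. cyl (zip (H u) (H v)) \<inter> K = {}"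
  proof -
    have "\<And>u v. (u, v) \<in> P \<Longrightarrow> u \<noteq> v \<and> u \<in> A \<and> v \<in> A" using insert.prems by blast
    from insert.IH[OF this] show ?thesis using that by blast
  qed
  have lenH: "length (H w) = L + m" if "w \<in> A" for w using H G[OF that] by (metis length_append)
  obtain q where q: "cyl (zip (H u) (H v) @ q) \<inter> K = {}" using K nwd_def by blast
  \<comment> \<open>As \<open>u \<noteq> v\<close>, the two components of \<open>q\<close> can be
    prescribed independently.\<close>
  define e where "e w = (if w = u then map fst q else if w = v then map snd q else replicate (length q) undefined)" for w
  define H' where "H' w = H w @ e w" for w
  have len_e: "length (e w) = length q" for w by (simp add: e_def)
  have zip': "zip (H' a) (H' b) = zip (H a) (H b) @ zip (e a) (e b)" if "a \<in> A" "b \<in> A" for a b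
    using lenH[OF that(1)] lenH[OF that(2)] by (simp add: H'_def zip_append)
  have "\<forall>w. \<exists>r. length r = m + length q \<and> H' w = G w @ r"
  proof
    fix w
    obtain r where "length r = m" "H w = G w @ r" using H by blast
    then show "\<exists>r. length r = m + length q \<and> H' w = G w @ r"
      by (intro exI[of _ "r @ e w"]) (simp add: H'_def len_e)
  qed
  moreover have "cyl (zip (H' a) (H' b)) \<inter> K = {}" if ab: "(a, b) \<in> insert uv P" for a b
  proof (cases "(a, b) = uv")
    case True
    have "zip (e u) (e v) = q" using uvA by (simp add: e_def zip_map_fst_snd)
    then show ?thesis using True uv q zip'[OF uvA(2,3)] by auto
  next
    case False
    then have "(a, b) \<in> P" using ab by blast
    then have "cyl (zip (H a) (H b)) \<inter> K = {}" and "a \<in> A" "b \<in> A" using HP insert.prems by auto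
    then show ?thesis using zip' cyl_append[of "zip (H a) (H b)" "zip (e a) (e b)"] by auto
  qed
  ultimately show ?case by (intro exI[of _ H'] exI[of _ "m + length q"]) auto
qed

text \<open>Mycielski's theorem, by fusion along the binary tree: to the binary words of length
  \<open>n\<close> are attached words such that any two different ones keep their pair cylinder away
  from the first \<open>n\<close> nowhere dense sets. A branch of the tree then yields one
  sequence.\<close>

theorem meagre_avoiding_pairs:
  assumes "meagre (M :: (nat \<Rightarrow> 'a \<times> 'a) set)"
  shows "\<exists>\<phi>::(nat \<Rightarrow> bool) \<Rightarrow> nat \<Rightarrow> 'a. \<forall>x y. x \<noteq> y \<longrightarrow> pair_seq (\<phi> x) (\<phi> y) \<notin> M"
proof -
  obtain N :: "nat \<Rightarrow> _" where N: "\<And>n. nwd (N n)" "M \<subseteq> (\<Union>n. N n)"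
    using assms meagre_def by blast
  define K where "K n = (\<Union>i<n. N i)" for n
  have K: "nwd (K n)" for n unfolding K_def by (rule nwd_UN_lessThan) (rule N)
  define good where "good n F \<longleftrightarrow> (\<exists>L\<ge>n. \<forall>u. length u = n \<longrightarrow> length (F u) = L) \<and>
      (\<forall>u v. length u = n \<longrightarrow> length v = n \<longrightarrow> u \<noteq> v \<longrightarrow> cyl (zip (F u) (F v)) \<inter> K n = {})"
    for n and F :: "bool list \<Rightarrow> 'a list"
  have "\<exists>F. \<forall>n. good n (F n) \<and> (\<forall>u b. length u = n \<longrightarrow> (\<exists>q. F (Suc n) (u @ [b]) = F n u @ q))"
  proof (rule dependent_nat_choice)
    show "\<exists>F. good 0 F" by (rule exI[of _ "\<lambda>_. []"]) (auto simp: good_def)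
  next
    fix F n assume gF: "good n F"
    have "\<exists>L\<ge>n. \<forall>u. length u = n \<longrightarrow> length (F u) = L" using gF[unfolded good_def] by (rule conjunct1)
    then obtain L where L: "L \<ge> n" "\<And>u. length u = n \<Longrightarrow> length (F u) = L" by blast
    define A where "A = {u::bool list. length u = Suc n}"
    \<comment> \<open>One extra letter per level keeps the length at level \<open>n\<close> at least
      \<open>n\<close>, so that branches give infinite sequences.\<close>
    define G where "G u = F (butlast u) @ [undefined]" for u
    define P where "P = {(u, v). u \<in> A \<and> v \<in> A \<and> u \<noteq> v}"
    have "finite A" using finite_lists_length_eq[of "UNIV :: bool set" "Suc n"] by (simp add: A_def)
    then have "finite (A \<times> A)" by simp
    then have finP: "finite P" by (rule finite_subset[rotated]) (auto simp: P_def)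
    have PA: "u \<noteq> v \<and> u \<in> A \<and> v \<in> A" if "(u, v) \<in> P" for u v
      using that by (simp add: P_def)
    have lenG: "length (G u) = Suc L" if "u \<in> A" for u
      using that L(2)[of "butlast u"] by (simp add: G_def A_def)
    have "\<exists>H m. (\<forall>u. \<exists>q. length q = m \<and> H u = G u @ q)
        \<and> (\<forall>(u,v)\<in>P. cyl (zip (H u) (H v)) \<inter> K (Suc n) = {})"
      by (rule avoid_finitely_many_pairs[OF K finP PA lenG])
    then obtain H m where H: "\<forall>u. \<exists>q. length q = m \<and> H u = G u @ q"
        and HP: "\<forall>(u,v)\<in>P. cyl (zip (H u) (H v)) \<inter> K (Suc n) = {}"
      by (elim exE conjE)
    have "good (Suc n) H"
      unfolding good_def
    proof
      have "length (H u) = Suc L + m" if "length u = Suc n" for u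
        using H[THEN spec[of _ u]] L(2)[of "butlast u"] that by (auto simp: G_def)
      then show "\<exists>L\<ge>Suc n. \<forall>u. length u = Suc n \<longrightarrow> length (H u) = L"
        using L(1) by (intro exI[of _ "Suc L + m"]) auto
      show "\<forall>u v. length u = Suc n \<longrightarrow> length v = Suc n \<longrightarrow> u \<noteq> v \<longrightarrow> cyl (zip (H u) (H v)) \<inter> K (Suc n) = {}"
        using HP by (auto simp: P_def A_def)
    qed
    moreover have "\<exists>q. H (u @ [b]) = F u @ q" for u b
      using H[THEN spec[of _ "u @ [b]"]] by (auto simp: G_def)
    ultimately show "\<exists>F'. good (Suc n) F' \<and> (\<forall>u b. length u = n \<longrightarrow> (\<exists>q. F' (u @ [b]) = F u @ q))"
      by (intro exI[of _ H] conjI) simp_all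
  qed
  then obtain F where FF: "\<forall>n. good n (F n) \<and> (\<forall>u b. length u = n \<longrightarrow> (\<exists>q. F (Suc n) (u @ [b]) = F n u @ q))" ..
  have F: "good n (F n)" and Fext: "length u = n \<Longrightarrow> \<exists>q. F (Suc n) (u @ [b]) = F n u @ q" for n u b
    using FF by simp_all
  define X where "X x n = F n (map x [0..<n])" for x :: "nat \<Rightarrow> bool" and n
  have X_Suc: "\<exists>q. X x (Suc n) = X x n @ q" for x n
    using Fext[of "map x [0..<n]" n "x n"] by (simp add: X_def)
  have X_add: "\<exists>q. X x (n + k) = X x n @ q" for x n k
  proof (induction k)
    case (Suc k)
    then show ?case using X_Suc[of x "n + k"] by auto
  qed auto
  have X_len: "n \<le> length (X x n)" "length (X x n) = length (X y n)" for x y n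
  proof -
    have "\<exists>L\<ge>n. \<forall>u. length u = n \<longrightarrow> length (F n u) = L" using F[of n, unfolded good_def] by (rule conjunct1)
    then obtain L where "L \<ge> n" "\<And>u. length u = n \<Longrightarrow> length (F n u) = L" by blast
    then show "n \<le> length (X x n)" "length (X x n) = length (X y n)" by (simp_all add: X_def)
  qed
  define \<phi> where "\<phi> x i = X x (Suc i) ! i" for x i
  have \<phi>: "\<phi> x \<in> cyl (X x n)" for x n
    unfolding cyl_def
  proof (intro CollectI allI impI)
    fix i assume i: "i < length (X x n)"
    obtain q where q: "X x (n + Suc i) = X x n @ q" using X_add by blast
    obtain q' where q': "X x (Suc i + n) = X x (Suc i) @ q'" using X_add by blast
    have "X x n ! i = X x (n + Suc i) ! i" using i q by (simp add: nth_append)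
    also have "\<dots> = X x (Suc i) ! i" using q' X_len(1)[of "Suc i" x] by (simp add: nth_append add.commute)
    finally show "\<phi> x i = X x n ! i" by (simp add: \<phi>_def)
  qed
  have "pair_seq (\<phi> x) (\<phi> y) \<notin> N i" if xy: "x \<noteq> y" for x y i
  proof -
    obtain k where k: "x k \<noteq> y k" using xy by blast
    \<comment> \<open>Above \<open>k\<close> the two branches carry different words, and above
      \<open>i\<close> the set \<open>N i\<close> is among those avoided.\<close>
    define n where "n = Suc (max i k)"
    have "k < n" by (simp add: n_def)
    have "map x [0..<n] \<noteq> map y [0..<n]"
    proof
      assume "map x [0..<n] = map y [0..<n]"
      then have "map x [0..<n] ! k = map y [0..<n] ! k" by (rule arg_cong)
      then show False using k \<open>k < n\<close> by simp
    qed
    then have "cyl (zip (X x n) (X y n)) \<inter> K n = {}"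
      using F[of n] unfolding good_def X_def by simp
    moreover have "pair_seq (\<phi> x) (\<phi> y) \<in> cyl (zip (X x n) (X y n))"
      by (intro pair_seq_in_cyl \<phi> X_len)
    moreover have "N i \<subseteq> K n" unfolding K_def by (rule UN_upper) (simp add: n_def)
    ultimately show ?thesis by blast
  qed
  then show ?thesis using N(2) by (intro exI[of _ \<phi>]) blast
qed

section \<open>Path chains\<close>

global_interpretation frag: int_module "frag_cmul :: int \<Rightarrow> ('c \<Rightarrow>\<^sub>0 int) \<Rightarrow> ('c \<Rightarrow>\<^sub>0 int)"
  by unfold_locales (simp_all add: frag_cmul_distrib frag_cmul_distrib2)

\<comment> \<open>loops with \<open>minus_frag_cmul\<close>\<close>
declare frag.scale_minus_left [simp del]

abbreviation bdry :: "'a topology \<Rightarrow> 'a chain set" where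
  "bdry X \<equiv> singular_relboundary_set 1 X {}"

text \<open>The parameter is the second barycentric coordinate, so \<open>g 0\<close> sits at vertex
  0. The restriction is there because singular simplices are extensional.\<close>

definition path_simplex :: "(real \<Rightarrow> 'a) \<Rightarrow> (nat \<Rightarrow> real) \<Rightarrow> 'a" where
  "path_simplex g = restrict (\<lambda>x. g (x 1)) (standard_simplex 1)"

definition path_chain :: "(real \<Rightarrow> 'a) \<Rightarrow> 'a chain" where
  "path_chain g = frag_of (path_simplex g)"

definition pt_chain :: "'a \<Rightarrow> 'a chain" where
  "pt_chain a = frag_of (restrict (\<lambda>_. a) (standard_simplex 0))"

text \<open>The order of \<open>a\<close> and \<open>b\<close> is free: \<open>seg g 1 0\<close> is
  the reversed path and \<open>seg g a a\<close> is constant.\<close>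

definition seg :: "(real \<Rightarrow> 'a) \<Rightarrow> real \<Rightarrow> real \<Rightarrow> real \<Rightarrow> 'a" where
  "seg g a b t = g ((1 - t) * a + t * b)"

definition join_path :: "(real \<Rightarrow> 'a) \<Rightarrow> (real \<Rightarrow> 'a) \<Rightarrow> real \<Rightarrow> 'a" where
  "join_path p q t = (if t \<le> 1/2 then p (2 * t) else q (2 * t - 1))"

lemma subspace_bdry: "frag.subspace (bdry X)"
  by (rule frag.subspaceI) (auto intro: singular_relboundary_add singular_relboundary_cmul)

lemma standard_simplex_1: "x \<in> standard_simplex 1 \<Longrightarrow> x 0 = 1 - x 1 \<and> 0 \<le> x 1 \<and> x 1 \<le> 1"
  unfolding standard_simplex_def by (auto simp: algebra_simps)

lemma path_simplex_cong:
  assumes "\<And>t. 0 \<le> t \<Longrightarrow> t \<le> 1 \<Longrightarrow> g t = h t"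
  shows "path_simplex g = path_simplex h"
  unfolding path_simplex_def
proof (rule restrict_ext)
  fix x :: "nat \<Rightarrow> real" assume "x \<in> standard_simplex 1"
  from standard_simplex_1[OF this] show "g (x 1) = h (x 1)" by (intro assms) auto
qed

lemma path_chain_cong:
  assumes "\<And>t. 0 \<le> t \<Longrightarrow> t \<le> 1 \<Longrightarrow> g t = h t"
  shows "path_chain g = path_chain h"
  unfolding path_chain_def by (simp only: path_simplex_cong[of g h, OF assms])

lemma continuous_map_simplex_coord:
  "continuous_map (subtopology (powertop_real UNIV) S) euclideanreal (\<lambda>x. x i)"
  by (intro continuous_map_from_subtopology continuous_map_product_projection) simp

lemma continuous_map_into_interval:
  assumes "continuous_map X euclideanreal f" "\<And>x. x \<in> topspace X \<Longrightarrow> 0 \<le> f x \<and> f x \<le> 1" "pathin Y g"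
  shows "continuous_map X Y (\<lambda>x. g (f x))"
proof -
  have "continuous_map X (top_of_set {0..1}) f"
    using assms(1,2) by (auto simp: continuous_map_in_subtopology)
  moreover have "continuous_map (top_of_set {0..1}) Y g" using assms(3) by (simp add: pathin_def)
  ultimately have "continuous_map X Y (g \<circ> f)" by (rule continuous_map_compose)
  then show ?thesis by (simp add: o_def)
qed

lemma singular_simplex_path_simplex:
  assumes "pathin X g"
  shows "singular_simplex 1 X (path_simplex g)"
proof -
  have "continuous_map (subtopology (powertop_real UNIV) (standard_simplex 1)) X (\<lambda>x. g (x 1))"
    by (rule continuous_map_into_interval[OF continuous_map_simplex_coord _ assms])
       (use standard_simplex_1 in force)
  then have "continuous_map (subtopology (powertop_real UNIV) (standard_simplex 1)) X (path_simplex g)"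
    by (rule continuous_map_eq) (simp add: path_simplex_def)
  then show ?thesis
    by (simp add: singular_simplex_def path_simplex_def)
qed

lemma singular_chain_path_chain: "pathin X g \<Longrightarrow> singular_chain 1 X (path_chain g)"
  by (simp only: path_chain_def singular_chain_of singular_simplex_path_simplex)

lemma path_simplex_exhaust:
  assumes "singular_simplex 1 X f"
  obtains g where "pathin X g" "f = path_simplex g"
proof -
  \<comment> \<open>The point of the 1-simplex with barycentric coordinates 1 - t and t.\<close>
  define e where "e t i = (if i = 0 then 1 - t else if i = (1::nat) then t else 0)" for t :: real and i
  have e: "e t \<in> standard_simplex 1" if "0 \<le> t" "t \<le> 1" for t
    using that by (auto simp: standard_simplex_def e_def)
  have "continuous_map (top_of_set {0..1}) (powertop_real UNIV) e"
    unfolding continuous_map_componentwise_UNIV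
  proof
    fix k
    show "continuous_map (top_of_set {0..1}) euclideanreal (\<lambda>x. e x k)"
      unfolding e_def by (cases "k = 0"; cases "k = 1") (auto intro!: continuous_intros)
  qed
  then have "continuous_map (top_of_set {0..1}) (subtopology (powertop_real UNIV) (standard_simplex 1)) e"
    using e by (auto simp: continuous_map_in_subtopology)
  then have "pathin X (f \<circ> e)"
    unfolding pathin_def using assms singular_simplex_def continuous_map_compose by blast
  moreover have "f = path_simplex (f \<circ> e)"
  proof
    fix x
    show "f x = path_simplex (f \<circ> e) x"
    proof (cases "x \<in> standard_simplex 1")
      case True
      have "x i = e (x 1) i" for i
        using True standard_simplex_1[OF True] by (auto simp: e_def standard_simplex_def)
      then have "x = e (x 1)" by (rule ext)
      then show ?thesis using True by (simp add: path_simplex_def)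
    next
      case False
      then show ?thesis using assms by (simp add: path_simplex_def singular_simplex_def extensional_def)
    qed
  qed
  ultimately show ?thesis using that by blast
qed

lemma chain_boundary_path_chain:
  "chain_boundary 1 (path_chain g) = pt_chain (g 1) - pt_chain (g 0)"
proof -
  have x: "x \<in> standard_simplex 0 \<Longrightarrow> x 0 = 1" for x by (simp add: standard_simplex_0)
  have 0: "singular_face 1 0 (path_simplex g) = restrict (\<lambda>_. g 1) (standard_simplex 0)"
    unfolding singular_face_def
  proof (simp, rule restrict_ext)
    fix x :: "nat \<Rightarrow> real" assume x0: "x \<in> standard_simplex 0"
    show "(path_simplex g \<circ> simplical_face 0) x = g 1"
      using simplical_face_in_standard_simplex[of 1 0 x] x[OF x0] x0
      by (simp add: path_simplex_def simplical_face_def)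
  qed
  have 1: "singular_face 1 1 (path_simplex g) = restrict (\<lambda>_. g 0) (standard_simplex 0)"
    unfolding singular_face_def
  proof (simp, rule restrict_ext)
    fix x :: "nat \<Rightarrow> real" assume "x \<in> standard_simplex 0"
    then show "(path_simplex g \<circ> simplical_face (Suc 0)) x = g 0"
      using simplical_face_in_standard_simplex[of 1 1 x] x by (simp add: path_simplex_def simplical_face_def)
  qed
  have "{..1::nat} = {0, 1}" by auto
  then show ?thesis unfolding path_chain_def chain_boundary_of pt_chain_def 0[symmetric] 1[symmetric]
    by simp
qed

text \<open>The affine map of the 2-simplex that sends the vertices to \<open>a\<close>,
  \<open>b\<close>, \<open>c\<close>, followed by \<open>g\<close>, is a singular triangle with
  these segments as faces. Constant paths, reversal, concatenation and cutting are all
  instances.\<close>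

lemma path_triangle:
  assumes g: "pathin X g" and abc: "0 \<le> a" "a \<le> 1" "0 \<le> b" "b \<le> 1" "0 \<le> c" "c \<le> 1"
  shows "path_chain (seg g a b) + path_chain (seg g b c) - path_chain (seg g a c) \<in> bdry X"
proof -
  define f where "f = restrict (\<lambda>x::nat \<Rightarrow> real. g (a * x 0 + b * x 1 + c * x 2)) (standard_simplex 2)"
  have cont: "continuous_map (subtopology (powertop_real UNIV) (standard_simplex 2)) X
     (\<lambda>x. g (a * x 0 + b * x 1 + c * x 2))"
  proof (rule continuous_map_into_interval[OF _ _ g])
    show "continuous_map (subtopology (powertop_real UNIV) (standard_simplex 2)) euclideanreal
       (\<lambda>x. a * x 0 + b * x 1 + c * x 2)"
      by (intro continuous_map_add continuous_map_real_mult_left continuous_map_simplex_coord)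
    fix x :: "nat \<Rightarrow> real"
    assume "x \<in> topspace (subtopology (powertop_real UNIV) (standard_simplex 2))"
    then have "x \<in> standard_simplex 2" by simp
    then have x: "\<And>i. 0 \<le> x i" "x 0 + x 1 + x 2 = 1"
      by (auto simp: standard_simplex_def numeral_2_eq_2)
    have "a * x 0 + b * x 1 + c * x 2 \<le> 1 * x 0 + 1 * x 1 + 1 * x 2"
      by (intro add_mono mult_right_mono abc x)
    then show "0 \<le> a * x 0 + b * x 1 + c * x 2 \<and> a * x 0 + b * x 1 + c * x 2 \<le> 1"
      using abc x by simp
  qed
  have f: "singular_simplex 2 X f"
    unfolding singular_simplex_def f_def
    using continuous_map_eq[OF cont, of f] by (simp add: f_def)
  have face: "singular_face 2 k f = path_simplex h"
    if k: "k \<le> 2" and h: "\<And>x::nat \<Rightarrow> real. x 0 = 1 - x 1 \<Longrightarrow>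
        (a * simplical_face k x 0 + b * simplical_face k x 1 + c * simplical_face k x 2) = u * x 0 + v * x 1"
      and "h = seg g u v" for k h u v
    unfolding singular_face_def path_simplex_def
  proof (simp, rule restrict_ext)
    fix x :: "nat \<Rightarrow> real" assume x: "x \<in> standard_simplex (Suc 0)"
    then have "simplical_face k x \<in> standard_simplex 2"
      using simplical_face_in_standard_simplex[of 2 k x] k by (simp add: numeral_2_eq_2)
    then have "(f \<circ> simplical_face k) x = g (u * x 0 + v * x 1)"
      using h[of x] standard_simplex_1[of x] x by (simp add: f_def)
    also have "\<dots> = h (x 1)" using standard_simplex_1[of x] x that(3) by (simp add: seg_def mult.commute)
    finally show "(f \<circ> simplical_face k) x = h (x (Suc 0))" by simp
  qed
  have f0: "singular_face 2 0 f = path_simplex (seg g b c)"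
    by (rule face) (auto simp: simplical_face_def)
  have f1: "singular_face 2 1 f = path_simplex (seg g a c)"
    by (rule face) (auto simp: simplical_face_def)
  have f2: "singular_face 2 2 f = path_simplex (seg g a b)"
    by (rule face) (auto simp: simplical_face_def)
  have "{..2::nat} = {0, 1, 2}" by auto
  then have "chain_boundary 2 (frag_of f) = frag_of (singular_face 2 0 f) - frag_of (singular_face 2 1 f) + frag_of (singular_face 2 2 f)"
    by (simp add: chain_boundary_of)
  also have "\<dots> = path_chain (seg g a b) + path_chain (seg g b c) - path_chain (seg g a c)"
    by (simp only: f0 f1 f2 path_chain_def) simp
  finally have "chain_boundary 2 (frag_of f) = path_chain (seg g a b) + path_chain (seg g b c) - path_chain (seg g a c)" .
  moreover have "singular_chain 2 X (frag_of f)" using f by (simp only: singular_chain_of)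
  ultimately show ?thesis
    unfolding mem_Collect_eq singular_boundary by (intro exI[of _ "frag_of f"]) (simp add: numeral_2_eq_2)
qed

text \<open>A constant triangle has boundary c + c - c.\<close>

lemma path_chain_const_bdry:
  assumes "a \<in> topspace X"
  shows "path_chain (\<lambda>_. a) \<in> bdry X"
  using path_triangle[of X "\<lambda>_. a" 0 0 0] assms by (simp add: seg_def[abs_def])

lemma seg_0_1: "seg g 0 1 = g"
  by (simp add: seg_def fun_eq_iff)

lemma seg_same: "seg g a a = (\<lambda>_. g a)"
  by (simp add: seg_def fun_eq_iff algebra_simps)

lemma pathin_seg:
  assumes g: "pathin X g" and ab: "0 \<le> a" "a \<le> 1" "0 \<le> b" "b \<le> 1"
  shows "pathin X (seg g a b)"
proof -
  have "continuous_map (top_of_set {0..1}) X (\<lambda>t. g ((1 - t) * a + t * b))"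
  proof (rule continuous_map_into_interval[OF _ _ g])
    show "continuous_map (top_of_set {0..1}) euclideanreal (\<lambda>t. (1 - t) * a + t * b)"
      by (auto intro!: continuous_intros)
    fix t :: real assume "t \<in> topspace (top_of_set {0..1})"
    then have t: "0 \<le> t" "t \<le> 1" by auto
    have "(1 - t) * a + t * b \<le> (1 - t) * 1 + t * 1"
      using t ab by (intro add_mono mult_left_mono) auto
    then show "0 \<le> (1 - t) * a + t * b \<and> (1 - t) * a + t * b \<le> 1" using t ab by simp
  qed
  then show ?thesis by (simp add: pathin_def seg_def[abs_def])
qed

lemma path_chain_reverse:
  assumes "pathin X g"
  shows "path_chain g + path_chain (seg g 1 0) \<in> bdry X"
proof -
  have "g 0 \<in> topspace X" by (rule path_start_in_topspace[OF assms])
  then have "path_chain (seg g 0 0) \<in> bdry X" unfolding seg_same by (rule path_chain_const_bdry)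
  then show ?thesis
    using frag.subspace_add[OF subspace_bdry path_triangle[OF assms, of 0 1 0], of "path_chain (seg g 0 0)"]
    by (simp add: seg_0_1)
qed

lemma pathin_join:
  assumes p: "pathin X p" and q: "pathin X q" and pq: "p 1 = q 0"
  shows "pathin X (join_path p q)"
proof -
  let ?I = "top_of_set {0..1::real}"
  have "continuous_map ?I X (\<lambda>t. if t \<le> 1/2 then p (2 * t) else q (2 * t - 1))"
  proof (rule continuous_map_cases_le)
    show "continuous_map (subtopology ?I {t \<in> topspace ?I. t \<le> 1/2}) X (\<lambda>t. p (2 * t))"
      by (rule continuous_map_into_interval[OF _ _ p])
         (auto simp: subtopology_subtopology intro!: continuous_intros)
    show "continuous_map (subtopology ?I {t \<in> topspace ?I. 1/2 \<le> t}) X (\<lambda>t. q (2 * t - 1))"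
      by (rule continuous_map_into_interval[OF _ _ q])
         (auto simp: subtopology_subtopology intro!: continuous_intros)
    show "p (2 * t) = q (2 * t - 1)" if "t = 1/2" for t
    proof -
      have "2 * t = 1" "2 * t - 1 = 0" using that by simp_all
      then show ?thesis using pq by (simp only:)
    qed
  qed auto
  then show ?thesis by (simp add: pathin_def join_path_def[abs_def])
qed

lemma path_chain_join:
  assumes p: "pathin X p" and q: "pathin X q" and pq: "p 1 = q 0"
  shows "path_chain p + path_chain q - path_chain (join_path p q) \<in> bdry X"
proof -
  have 1: "path_chain (seg (join_path p q) 0 (1/2)) = path_chain p"
    by (rule path_chain_cong) (simp add: seg_def join_path_def)
  have 2: "path_chain (seg (join_path p q) (1/2) 1) = path_chain q"
  proof (rule path_chain_cong)
    fix t :: real assume t: "0 \<le> t" "t \<le> 1"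
    show "seg (join_path p q) (1/2) 1 t = q t"
    proof (cases "t = 0")
      case True
      then show ?thesis using pq by (simp add: seg_def join_path_def)
    next
      case False
      have 1: "(1 - t) * (1 / 2) + t * 1 = (1 + t) / 2" by (simp add: field_simps)
      have 2: "\<not> (1 + t) / 2 \<le> 1 / 2" using False t by simp
      have 3: "2 * ((1 + t) / 2) - 1 = t" by (simp add: field_simps)
      show ?thesis unfolding seg_def join_path_def 1 3 using 2 by (simp only: if_False)
    qed
  qed
  show ?thesis
    using path_triangle[OF pathin_join[OF assms], of 0 "1/2" 1] by (simp add: 1 2 seg_0_1)
qed

lemma join_path_ends [simp]: "join_path p q 0 = p 0" "join_path p q 1 = q 1"
  by (simp_all add: join_path_def)

lemma seg_ends [simp]: "seg g a b 0 = g a" "seg g a b 1 = g b"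
  by (simp_all add: seg_def)

lemma join_path_image:
  assumes "p \<in> {0..1} \<rightarrow> W" "q \<in> {0..1} \<rightarrow> W"
  shows "join_path p q \<in> {0..1} \<rightarrow> W"
proof
  fix t :: real assume "t \<in> {0..1}"
  then show "join_path p q t \<in> W"
    using assms by (cases "t \<le> 1/2") (auto simp: join_path_def Pi_iff)
qed

lemma seg_in_interval:
  assumes "0 \<le> a" "a \<le> b" "b \<le> 1" "0 \<le> t" "t \<le> (1::real)"
  shows "(1 - t) * a + t * b \<in> {a..b}"
proof -
  have "(1 - t) * a + t * a \<le> (1 - t) * a + t * b" "(1 - t) * a + t * b \<le> (1 - t) * b + t * b"
    using assms by (auto intro!: mult_left_mono)
  then show ?thesis by (simp add: algebra_simps)
qed

lemma seg_reverse_image: "g \<in> {0..1} \<rightarrow> W \<Longrightarrow> seg g 1 0 \<in> {0..1} \<rightarrow> W"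
  by (auto simp: seg_def Pi_iff)

section \<open>Compact metric spaces\<close>

locale compact_metric = Metric_space +
  assumes compact_M: "compact_space mtopology"
begin

text \<open>By a Lebesgue number of the cover of \<open>K\<close> by open sets that \<open>f\<close>
  maps into balls of radius \<epsilon>/2.\<close>

lemma uniformly_continuous_on_compact:
  fixes K :: "'k::metric_space set"
  assumes K: "compact K" and f: "continuous_map (top_of_set K) mtopology f" and "\<epsilon> > 0"
  obtains \<eta> where "\<eta> > 0" "\<And>x y. x \<in> K \<Longrightarrow> y \<in> K \<Longrightarrow> dist x y < \<eta> \<Longrightarrow> d (f x) (f y) < \<epsilon>"
proof (cases "K = {}")
  case True
  then show ?thesis using that[of 1] by auto
next
  case False
  have fM: "f x \<in> M" if "x \<in> K" for x
    using continuous_map_funspace[OF f] that by auto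
  define C where "C = {U. open U \<and> (\<exists>a\<in>M. \<forall>x\<in>K \<inter> U. f x \<in> mball a (\<epsilon>/2))}"
  have cov: "K \<subseteq> \<Union>C"
  proof
    fix x assume x: "x \<in> K"
    have "openin (top_of_set K) {y \<in> topspace (top_of_set K). f y \<in> mball (f x) (\<epsilon>/2)}"
      by (rule openin_continuous_map_preimage[OF f]) simp
    then obtain U where U: "open U" "{y \<in> K. f y \<in> mball (f x) (\<epsilon>/2)} = K \<inter> U"
      unfolding openin_open by auto
    have "x \<in> {y \<in> K. f y \<in> mball (f x) (\<epsilon>/2)}" using x fM[OF x] \<open>\<epsilon> > 0\<close> by simp
    then have "x \<in> U" unfolding U(2) by blast
    moreover have "\<forall>y\<in>K \<inter> U. f y \<in> mball (f x) (\<epsilon>/2)" unfolding U(2)[symmetric] by blast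
    then have "U \<in> C" unfolding C_def using U(1) fM[OF x] by blast
    ultimately show "x \<in> \<Union>C" by blast
  qed
  then have "C \<noteq> {}" using False by auto
  then obtain \<eta> where \<eta>: "\<eta> > 0" "\<And>T. T \<subseteq> K \<Longrightarrow> diameter T < \<eta> \<Longrightarrow> \<exists>U\<in>C. T \<subseteq> U"
    using Lebesgue_number_lemma[OF K, of C] cov unfolding C_def by blast
  show ?thesis
  proof (rule that[OF \<eta>(1)])
    fix x y assume xy: "x \<in> K" "y \<in> K" "dist x y < \<eta>"
    have "(SUP (u,v)\<in>{x,y}\<times>{x,y}. dist u v) \<le> dist x y"
      by (rule cSUP_least) (auto simp: dist_commute)
    then have "diameter {x, y} \<le> dist x y" by (simp only: diameter_def insert_not_empty if_False)
    then have "diameter {x, y} < \<eta>" using xy(3) by simp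
    then obtain U where "U \<in> C" "{x, y} \<subseteq> U" using \<eta>(2)[of "{x,y}"] xy by auto
    then obtain a where a: "f x \<in> mball a (\<epsilon>/2)" "f y \<in> mball a (\<epsilon>/2)" unfolding C_def using xy by blast
    then have "d (f x) (f y) \<le> d a (f x) + d a (f y)" using triangle'' by auto
    then show "d (f x) (f y) < \<epsilon>" using a by auto
  qed
qed

end

section \<open>Cycles modulo small loops\<close>

context compact_metric
begin

text \<open>By a Lebesgue number of the cover by path connected open sets that lie in balls of
  radius \<epsilon>/2: a path inside such a set stays \<epsilon>-close to its start.\<close>

lemma uniformly_locally_path_connected:
  assumes lpc: "locally_path_connected_space mtopology" and "\<epsilon> > 0"
  obtains \<delta> where "\<delta> > 0" "\<And>x y. x \<in> M \<Longrightarrow> y \<in> M \<Longrightarrow> d x y < \<delta> \<Longrightarrow>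
      \<exists>g. pathin mtopology g \<and> g 0 = x \<and> g 1 = y \<and> g \<in> {0..1} \<rightarrow> mball x \<epsilon>"
proof -
  define C where "C = {U. openin mtopology U \<and> path_connectedin mtopology U \<and> (\<exists>c\<in>M. U \<subseteq> mball c (\<epsilon>/2))}"
  have "M \<subseteq> \<Union>C"
  proof
    fix x assume x: "x \<in> M"
    then obtain U where "openin mtopology U" "path_connectedin mtopology U" "x \<in> U" "U \<subseteq> mball x (\<epsilon>/2)"
      using lpc[unfolded locally_path_connected_space, rule_format, of "mball x (\<epsilon>/2)" x] \<open>\<epsilon> > 0\<close> by auto
    then show "x \<in> \<Union>C" using x unfolding C_def by blast
  qed
  moreover have "compactin mtopology M" using compact_M by (simp add: compact_space_def)
  moreover have "openin mtopology U" if "U \<in> C" for U using that by (simp add: C_def)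
  ultimately have "\<exists>\<delta>>0. \<forall>x\<in>M. \<exists>U\<in>C. mball x \<delta> \<subseteq> U" by (intro lebesgue_number)
  then obtain \<delta> where \<delta>: "\<delta> > 0" "\<And>x. x \<in> M \<Longrightarrow> \<exists>U\<in>C. mball x \<delta> \<subseteq> U" by blast
  show ?thesis
  proof (rule that[OF \<delta>(1)])
    fix x y assume xy: "x \<in> M" "y \<in> M" "d x y < \<delta>"
    obtain U where U: "U \<in> C" "mball x \<delta> \<subseteq> U" using \<delta>(2)[OF xy(1)] by blast
    then have xyU: "x \<in> U" "y \<in> U" using xy \<delta>(1) by auto
    obtain c where c: "c \<in> M" "U \<subseteq> mball c (\<epsilon>/2)" using U(1) by (auto simp: C_def)
    have "path_connectedin mtopology U" using U(1) by (simp add: C_def)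
    then obtain g where g: "pathin mtopology g" "g \<in> {0..1} \<rightarrow> U" "g 0 = x" "g 1 = y"
      using xyU unfolding path_connectedin by blast
    have "U \<subseteq> mball x \<epsilon>"
    proof
      fix z assume "z \<in> U"
      then have z: "z \<in> M" "d c z < \<epsilon>/2" "d c x < \<epsilon>/2" using c xyU(1) by auto
      then have "d x z \<le> d c x + d c z" using triangle''[of x c z] c xy by (simp add: commute)
      then show "z \<in> mball x \<epsilon>" using z xy by simp
    qed
    then have "g \<in> {0..1} \<rightarrow> mball x \<epsilon>" using g(2) by blast
    then show "\<exists>g. pathin mtopology g \<and> g 0 = x \<and> g 1 = y \<and> g \<in> {0..1} \<rightarrow> mball x \<epsilon>"
      using g by blast
  qed
qed

lemma path_small_pieces:
  assumes "pathin mtopology g" "\<delta> > 0"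
  obtains n :: nat where "n > 0"
    "\<And>s t. s \<in> {0..1} \<Longrightarrow> t \<in> {0..1} \<Longrightarrow> \<bar>s - t\<bar> \<le> 1 / n \<Longrightarrow> d (g s) (g t) < \<delta>"
proof -
  have "continuous_map (top_of_set {0..1}) mtopology g" using assms(1) by (simp add: pathin_def)
  then obtain \<eta> where \<eta>: "\<eta> > 0" "\<And>x y. x \<in> {0..1} \<Longrightarrow> y \<in> {0..1} \<Longrightarrow> dist x y < \<eta> \<Longrightarrow> d (g x) (g y) < \<delta>"
    using uniformly_continuous_on_compact[OF compact_Icc _ assms(2)] by metis
  obtain n where n: "inverse (real (Suc n)) < \<eta>" using reals_Archimedean[OF \<eta>(1)] by blast
  show ?thesis
    by (rule that[of "Suc n"]) (use n \<eta>(2) in \<open>auto simp: dist_real_def inverse_eq_divide\<close>)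
qed

text \<open>The loop along \<open>qa\<close>, \<open>\<tau>\<close>, reversed \<open>qb\<close> and
  reversed \<open>p\<close> stays in the ball around its base point \<open>p 0\<close>, so
  \<open>N\<close> kills it; up to boundaries its chain is the alternating sum.\<close>

lemma loop_around_small_path:
  fixes q :: "'a \<Rightarrow> real \<Rightarrow> 'a"
  assumes kill: "\<And>g. pathin mtopology g \<Longrightarrow> g 0 = g 1 \<Longrightarrow> g \<in> {0..1} \<rightarrow> mball (g 0) \<epsilon>
        \<Longrightarrow> frag_cmul N (path_chain g) \<in> bdry mtopology"
    and \<tau>: "pathin mtopology \<tau>" and qa: "pathin mtopology qa" and qb: "pathin mtopology qb" and p: "pathin mtopology p"
    and ends: "qa 1 = \<tau> 0" "\<tau> 1 = qb 1" "p 0 = qa 0" "p 1 = qb 0"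
    and small: "\<tau> \<in> {0..1} \<rightarrow> mball (p 0) \<epsilon>" "qa \<in> {0..1} \<rightarrow> mball (p 0) \<epsilon>" "qb \<in> {0..1} \<rightarrow> mball (p 0) \<epsilon>" "p \<in> {0..1} \<rightarrow> mball (p 0) \<epsilon>"
  shows "frag_cmul N (path_chain \<tau> + path_chain qa - path_chain qb - path_chain p) \<in> bdry mtopology"
proof -
  let ?B = "bdry mtopology"
  note B = subspace_bdry[of mtopology]
  let ?j1 = "join_path qa \<tau>"
  let ?j2 = "join_path ?j1 (seg qb 1 0)"
  let ?j3 = "join_path ?j2 (seg p 1 0)"
  have j1: "pathin mtopology ?j1" by (rule pathin_join) (use \<tau> qa ends in auto)
  have rb: "pathin mtopology (seg qb 1 0)" by (rule pathin_seg[OF qb]) auto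
  have rp: "pathin mtopology (seg p 1 0)" by (rule pathin_seg[OF p]) auto
  have j2: "pathin mtopology ?j2" by (rule pathin_join[OF j1 rb]) (simp add: ends)
  have j3: "pathin mtopology ?j3" by (rule pathin_join[OF j2 rp]) (simp add: ends)
  have "?j3 \<in> {0..1} \<rightarrow> mball (?j3 0) \<epsilon>"
    unfolding join_path_ends ends(3)[symmetric]
    by (intro join_path_image seg_reverse_image small)
  then have k: "frag_cmul N (path_chain ?j3) \<in> ?B"
    by (intro kill j3) (simp_all add: ends)
  have 1: "path_chain qa + path_chain \<tau> - path_chain ?j1 \<in> ?B" by (rule path_chain_join[OF qa \<tau> ends(1)])
  have 2: "path_chain ?j1 + path_chain (seg qb 1 0) - path_chain ?j2 \<in> ?B"
    by (rule path_chain_join[OF j1 rb]) (simp add: ends)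
  have 3: "path_chain ?j2 + path_chain (seg p 1 0) - path_chain ?j3 \<in> ?B"
    by (rule path_chain_join[OF j2 rp]) (simp add: ends)
  have 4: "path_chain qb + path_chain (seg qb 1 0) \<in> ?B" by (rule path_chain_reverse[OF qb])
  have 5: "path_chain p + path_chain (seg p 1 0) \<in> ?B" by (rule path_chain_reverse[OF p])
  let ?s = "((path_chain qa + path_chain \<tau> - path_chain ?j1) + (path_chain ?j1 + path_chain (seg qb 1 0) - path_chain ?j2)
     + (path_chain ?j2 + path_chain (seg p 1 0) - path_chain ?j3)) - (path_chain qb + path_chain (seg qb 1 0)) - (path_chain p + path_chain (seg p 1 0))"
  have s: "?s \<in> ?B"
    by (rule frag.subspace_diff[OF B frag.subspace_diff[OF B frag.subspace_add[OF B frag.subspace_add[OF B 1 2] 3] 4] 5])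
  have "frag_cmul N ?s + frag_cmul N (path_chain ?j3) \<in> ?B"
    by (rule frag.subspace_add[OF B frag.subspace_scale[OF B s] k])
  moreover have "frag_cmul N ?s + frag_cmul N (path_chain ?j3) =
      frag_cmul N (path_chain \<tau> + path_chain qa - path_chain qb - path_chain p)"
    unfolding frag_cmul_distrib2[symmetric] by (rule arg_cong[of _ _ "frag_cmul N"]) simp
  ultimately show ?thesis by metis
qed

text \<open>Short paths \<open>q a\<close> from a net point to each point \<open>a\<close> complete
  a short path to a small loop, together with one of the finitely many paths between net points.
  When a long path is cut into short pieces the intermediate \<open>q a\<close> telescope, and on a
  cycle those at the ends cancel as well.\<close>

lemma cycles_multiple_in_finite_span:
  assumes lpc: "locally_path_connected_space mtopology" and "\<epsilon> > 0"
    and kill: "\<And>g. pathin mtopology g \<Longrightarrow> g 0 = g 1 \<Longrightarrow> g \<in> {0..1} \<rightarrow> mball (g 0) \<epsilon>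
        \<Longrightarrow> frag_cmul N (path_chain g) \<in> bdry mtopology"
  obtains F where "finite F"
    "\<And>c. singular_relcycle 1 mtopology {} c \<Longrightarrow> frag_cmul N c \<in> frag.span (F \<union> bdry mtopology)"
proof -
  let ?X = mtopology
  note B = subspace_bdry[of ?X]
  obtain \<delta> where \<delta>: "\<delta> > 0" and \<delta>path: "\<And>x y. x \<in> M \<Longrightarrow> y \<in> M \<Longrightarrow> d x y < \<delta> \<Longrightarrow>
      \<exists>g. pathin mtopology g \<and> g 0 = x \<and> g 1 = y \<and> g \<in> {0..1} \<rightarrow> mball x (\<epsilon>/2)"
    using uniformly_locally_path_connected[OF lpc, of "\<epsilon>/2"] \<open>\<epsilon> > 0\<close> by auto
  obtain pth where pth: "\<And>x y. x \<in> M \<Longrightarrow> y \<in> M \<Longrightarrow> d x y < \<delta> \<Longrightarrow>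
      pathin mtopology (pth x y) \<and> pth x y 0 = x \<and> pth x y 1 = y \<and> pth x y \<in> {0..1} \<rightarrow> mball x (\<epsilon>/2)"
    using \<delta>path by metis
  \<comment> \<open>A third of \<delta>, because three distances below \<rho> separate the net
    points of the two ends of a short path; the bound by \<epsilon> keeps the short path in the ball
    around the first net point.\<close>
  define \<rho> where "\<rho> = min (\<delta>/3) (\<epsilon>/4)"
  have \<rho>: "\<rho> > 0" "3 * \<rho> \<le> \<delta>" "4 * \<rho> \<le> \<epsilon>" using \<delta> \<open>\<epsilon> > 0\<close> by (auto simp: \<rho>_def)
  have "mtotally_bounded M" using compact_M compact_space_eq_mcomplete_mtotally_bounded by blast
  from this[unfolded mtotally_bounded_def, rule_format, OF \<rho>(1)]
  obtain V where V: "finite V" "V \<subseteq> M" "M \<subseteq> (\<Union>v\<in>V. mball v \<rho>)" by blast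
  have "\<exists>v. v \<in> V \<and> d v a < \<rho>" if "a \<in> M" for a using V(3) that by fastforce
  then obtain v where v: "\<And>a. a \<in> M \<Longrightarrow> v a \<in> V" "\<And>a. a \<in> M \<Longrightarrow> d (v a) a < \<rho>" by metis
  define q where "q a = pth (v a) a" for a
  have q: "pathin ?X (q a)" "q a 0 = v a" "q a 1 = a" "q a \<in> {0..1} \<rightarrow> mball (v a) (\<epsilon>/2)" if a: "a \<in> M" for a
  proof -
    have "d (v a) a < \<delta>" "v a \<in> M" using v[OF a] V(2) \<rho> by auto
    then show "pathin ?X (q a)" "q a 0 = v a" "q a 1 = a" "q a \<in> {0..1} \<rightarrow> mball (v a) (\<epsilon>/2)"
      using pth[of "v a" a] a by (simp_all add: q_def)
  qed
  define F where "F = (\<lambda>(u, w). path_chain (pth u w)) ` (V \<times> V)"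
  have F: "finite F" using V(1) by (simp add: F_def)
  let ?S = "frag.span (F \<union> bdry ?X)"
  let ?Q = "\<lambda>a. path_chain (q a)"
  have small: "frag_cmul N (path_chain \<tau> + ?Q (\<tau> 0) - ?Q (\<tau> 1)) \<in> ?S"
    if \<tau>: "pathin ?X \<tau>" and \<tau>s: "\<And>t. t \<in> {0..1} \<Longrightarrow> d (\<tau> 0) (\<tau> t) < \<rho>" for \<tau>
  proof -
    define a where "a = \<tau> 0"
    define b where "b = \<tau> 1"
    have \<tau>M: "\<tau> t \<in> M" if "t \<in> {0..1}" for t
      using path_image_subset_topspace[OF \<tau>] that by auto
    then have ab: "a \<in> M" "b \<in> M" by (simp_all add: a_def b_def)
    have vM: "v a \<in> M" "v b \<in> M" using v(1) ab V(2) by auto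
    have dab: "d a b < \<rho>" using \<tau>s[of 1] by (simp add: a_def b_def)
    have "d (v a) (v b) \<le> d (v a) a + d a (v b)" by (rule triangle) (use ab vM in auto)
    also have "d a (v b) \<le> d a b + d b (v b)" by (rule triangle) (use ab vM in auto)
    finally have dv: "d (v a) (v b) < \<delta>" using dab v(2)[OF ab(1)] v(2)[OF ab(2)] \<rho>(2) by (simp add: commute)
    define p where "p = pth (v a) (v b)"
    have p: "pathin ?X p" "p 0 = v a" "p 1 = v b" "p \<in> {0..1} \<rightarrow> mball (v a) (\<epsilon>/2)"
      using pth[OF vM dv] by (simp_all add: p_def)
    \<comment> \<open>The end of \<open>p\<close> uses up only \<epsilon>/2, which leaves
      \<epsilon>/2 for \<open>q b\<close>.\<close>
    have vab: "d (v a) (v b) < \<epsilon>/2" using funcset_mem[OF p(4), of 1] p(3) by simp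
    have "frag_cmul N (path_chain \<tau> + ?Q a - ?Q b - path_chain p) \<in> bdry ?X"
    proof (rule loop_around_small_path[of \<epsilon> N \<tau> "q a" "q b" p])
      show "frag_cmul N (path_chain g) \<in> bdry ?X"
        if "pathin ?X g" "g 0 = g 1" "g \<in> {0..1} \<rightarrow> mball (g 0) \<epsilon>" for g by (rule kill[OF that])
      show "\<tau> \<in> {0..1} \<rightarrow> mball (p 0) \<epsilon>"
      proof
        fix t :: real assume t: "t \<in> {0..1}"
        have "d (v a) (\<tau> t) \<le> d (v a) a + d a (\<tau> t)" by (rule triangle) (use ab vM \<tau>M t in auto)
        also have "\<dots> < \<rho> + \<rho>" using v(2)[OF ab(1)] \<tau>s[OF t] by (simp add: a_def)
        also have "\<dots> \<le> \<epsilon>" using \<rho> by simp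
        finally show "\<tau> t \<in> mball (p 0) \<epsilon>" using p(2) vM \<tau>M[OF t] by simp
      qed
      show "q a \<in> {0..1} \<rightarrow> mball (p 0) \<epsilon>"
        using q(4)[OF ab(1)] mball_subset_concentric[of "\<epsilon>/2" \<epsilon> "v a"] \<open>\<epsilon> > 0\<close> p(2) by auto
      show "p \<in> {0..1} \<rightarrow> mball (p 0) \<epsilon>"
        using p(4) mball_subset_concentric[of "\<epsilon>/2" \<epsilon> "v a"] \<open>\<epsilon> > 0\<close> p(2) by auto
      show "q b \<in> {0..1} \<rightarrow> mball (p 0) \<epsilon>"
      proof
        fix t :: real assume t: "t \<in> {0..1}"
        have qb: "q b t \<in> M" "d (v b) (q b t) < \<epsilon>/2" using funcset_mem[OF q(4)[OF ab(2)] t] by auto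
        have "d (v a) (q b t) \<le> d (v a) (v b) + d (v b) (q b t)" by (rule triangle) (use vM qb in auto)
        then show "q b t \<in> mball (p 0) \<epsilon>" using vab qb p(2) vM by simp
      qed
    qed (use \<tau> q[OF ab(1)] q[OF ab(2)] p in \<open>auto simp: a_def b_def\<close>)
    then have 1: "frag_cmul N (path_chain \<tau> + ?Q a - ?Q b - path_chain p) \<in> ?S"
      by (intro frag.span_base) auto
    have "path_chain p \<in> F" using v(1)[OF ab(1)] v(1)[OF ab(2)] by (force simp: F_def p_def)
    then have "frag_cmul N (path_chain p) \<in> ?S" by (intro frag.span_scale frag.span_base) auto
    from frag.span_add[OF 1 this] have "frag_cmul N (path_chain \<tau> + ?Q a - ?Q b - path_chain p + path_chain p) \<in> ?S"
      by (simp only: frag_cmul_distrib2)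
    then show ?thesis by (simp add: a_def b_def)
  qed
  have path: "frag_cmul N (path_chain g + ?Q (g 0) - ?Q (g 1)) \<in> ?S" if g: "pathin ?X g" for g
  proof -
    obtain n :: nat where n: "n > 0"
      "\<And>s t. s \<in> {0..1} \<Longrightarrow> t \<in> {0..1} \<Longrightarrow> \<bar>s - t\<bar> \<le> 1 / n \<Longrightarrow> d (g s) (g t) < \<rho>"
      using path_small_pieces[OF g \<rho>(1)] by blast
    have "frag_cmul N (path_chain (seg g 0 (k/n)) + ?Q (g 0) - ?Q (g (k/n))) \<in> ?S" if "k \<le> n" for k
      using that
    proof (induction k)
      case 0
      have "path_chain (\<lambda>_. g 0) \<in> bdry ?X"
        by (rule path_chain_const_bdry) (rule path_start_in_topspace[OF g])
      then show ?case
        by (simp add: seg_same) (intro frag.span_scale frag.span_base; simp)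
    next
      case (Suc k)
      let ?a = "real k / n" and ?b = "real (Suc k) / n"
      have ab: "0 \<le> ?a" "?a \<le> ?b" "?b \<le> 1" using Suc.prems n(1) by (auto simp: field_simps)
      then have a1: "?a \<le> 1" and b0: "0 \<le> ?b" by linarith+
      have "frag_cmul N (path_chain (seg g ?a ?b) + ?Q (seg g ?a ?b 0) - ?Q (seg g ?a ?b 1)) \<in> ?S"
      proof (rule small)
        show "pathin ?X (seg g ?a ?b)" by (rule pathin_seg[OF g ab(1) a1 b0 ab(3)])
        fix t :: real assume t: "t \<in> {0..1}"
        define z where "z = (1 - t) * ?a + t * ?b"
        have "z \<in> {?a..?b}" unfolding z_def by (rule seg_in_interval[OF ab]) (use t in auto)
        then have z: "?a \<le> z" "z \<le> ?b" by (simp_all only: atLeastAtMost_iff)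
        have "?b = ?a + 1 / n" by (simp add: add_divide_distrib)
        then have 1: "\<bar>?a - z\<bar> \<le> 1 / n" using z by linarith
        have 2: "?a \<in> {0..1}" unfolding atLeastAtMost_iff by (intro conjI ab a1)
        have 3: "z \<in> {0..1}" unfolding atLeastAtMost_iff using z ab by linarith
        have "d (g ?a) (g z) < \<rho>" by (rule n(2)[OF 2 3 1])
        then show "d (seg g ?a ?b 0) (seg g ?a ?b t) < \<rho>" by (simp only: seg_ends seg_def[of g _ _ t] z_def)
      qed
      then have 1: "frag_cmul N (path_chain (seg g ?a ?b) + ?Q (g ?a) - ?Q (g ?b)) \<in> ?S"
        by (simp only: seg_ends)
      have 2: "frag_cmul N (path_chain (seg g 0 ?a) + ?Q (g 0) - ?Q (g ?a)) \<in> ?S"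
        using Suc by simp
      have 3: "frag_cmul N (path_chain (seg g 0 ?a) + path_chain (seg g ?a ?b) - path_chain (seg g 0 ?b)) \<in> ?S"
        by (intro frag.span_scale frag.span_base UnI2 path_triangle[OF g]) (use ab a1 b0 in auto)
      have eq: "path_chain (seg g 0 ?b) + ?Q (g 0) - ?Q (g ?b) =
         (path_chain (seg g ?a ?b) + ?Q (g ?a) - ?Q (g ?b)) + (path_chain (seg g 0 ?a) + ?Q (g 0) - ?Q (g ?a))
         - (path_chain (seg g 0 ?a) + path_chain (seg g ?a ?b) - path_chain (seg g 0 ?b))" by simp
      have "frag_cmul N (path_chain (seg g 0 ?b) + ?Q (g 0) - ?Q (g ?b)) =
         frag_cmul N (path_chain (seg g ?a ?b) + ?Q (g ?a) - ?Q (g ?b)) + frag_cmul N (path_chain (seg g 0 ?a) + ?Q (g 0) - ?Q (g ?a))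
         - frag_cmul N (path_chain (seg g 0 ?a) + path_chain (seg g ?a ?b) - path_chain (seg g 0 ?b))"
        by (subst eq) (simp only: frag.scale_right_diff_distrib frag_cmul_distrib2)
      then show ?case using frag.span_diff[OF frag.span_add[OF 1 2] 3] by metis
    qed
    from this[of n] show ?thesis using n(1) by (simp add: seg_0_1)
  qed
  \<comment> \<open>The correction by the boundary makes the statement about single paths additive,
    hence valid for all chains, and it disappears on cycles. The evaluation point is the only point
    of the 0-simplex.\<close>
  define L where "L c = frag_cmul N (c - frag_extend (\<lambda>s. ?Q (s (\<lambda>j. if j = 0 then 1 else 0))) (chain_boundary 1 c))" for c
  have Lpath: "L (path_chain g) \<in> ?S" if g: "pathin ?X g" for g
  proof -
    have e: "frag_extend (\<lambda>s. ?Q (s (\<lambda>j. if j = 0 then 1 else 0))) (pt_chain a) = ?Q a" for a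
      by (simp add: pt_chain_def standard_simplex_0)
    have "L (path_chain g) = frag_cmul N (path_chain g + ?Q (g 0) - ?Q (g 1))"
      unfolding L_def chain_boundary_path_chain frag_extend_diff e
      by (rule arg_cong[of _ _ "frag_cmul N"]) simp
    then show ?thesis using path[OF g] by simp
  qed
  have L: "L c \<in> ?S" if "singular_chain 1 ?X c" for c
    using that unfolding singular_chain_def
  proof (induction c rule: frag_induction)
    case zero
    then show ?case by (simp add: L_def frag.span_zero)
  next
    case (one x)
    then obtain g where "pathin ?X g" "x = path_simplex g" using path_simplex_exhaust by blast
    then show ?case using Lpath[of g] by (simp add: path_chain_def)
  next
    case (diff a b)
    have "L (a - b) = L a - L b"
      unfolding L_def chain_boundary_diff frag_extend_diff frag.scale_right_diff_distrib[symmetric]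
      by (rule arg_cong[of _ _ "frag_cmul N"]) simp
    then show ?case using frag.span_diff[OF diff] by simp
  qed
  show ?thesis
  proof (rule that[OF F])
    fix c assume "singular_relcycle 1 ?X {} c"
    then have "singular_chain 1 ?X c" "chain_boundary 1 c = 0" by (simp_all add: singular_cycle)
    then show "frag_cmul N c \<in> ?S" using L[of c] by (simp add: L_def)
  qed
qed

end

section \<open>Infinite concatenations\<close>

text \<open>The loop \<open>l n\<close> is run on the interval from 1/(n+2) to 1/(n+1), whose length
  is the inverse of (n+1)(n+2); the intervals accumulate at 0. They are taken open, which makes the
  index unique, and the common endpoints go to \<open>x\<close>.\<close>

definition infinite_concat :: "'a \<Rightarrow> (nat \<Rightarrow> real \<Rightarrow> 'a) \<Rightarrow> (nat \<Rightarrow> bool) \<Rightarrow> real \<Rightarrow> 'a" where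
  "infinite_concat x l S t =
     (if \<exists>n. S n \<and> 1 / (real n + 2) < t \<and> t < 1 / (real n + 1)
      then let n = (THE n. 1 / (real n + 2) < t \<and> t < 1 / (real n + 1))
           in l n ((t - 1 / (real n + 2)) * ((real n + 1) * (real n + 2)))
      else x)"

lemma harmonic_gap: "(1 / (real n + 1) - 1 / (real n + 2)) * ((real n + 1) * (real n + 2)) = 1"
proof -
  have "real n + 1 \<noteq> 0" "real n + 2 \<noteq> 0" by linarith+
  then show ?thesis by (simp add: left_diff_distrib)
qed

lemma harmonic_interval_unique:
  assumes "1 / (real n + 2) < t" "t < 1 / (real n + 1)" "1 / (real m + 2) < t" "t < 1 / (real m + 1)"
  shows "n = m"
proof -
  have "\<not> n < m" if "1 / (real n + 2) < t" "t < 1 / (real m + 1)" for n m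
  proof
    assume "n < m"
    then have "1 / (real m + 1) \<le> 1 / (real n + 2)" by (intro divide_left_mono) auto
    then show False using that by linarith
  qed
  then show ?thesis using assms by (metis nat_neq_iff)
qed

lemma harmonic_interval_the:
  assumes "1 / (real n + 2) < t" "t < 1 / (real n + 1)"
  shows "(THE n. 1 / (real n + 2) < t \<and> t < 1 / (real n + 1)) = n"
  using assms harmonic_interval_unique by (intro the_equality) blast+

lemma infinite_concat_in:
  assumes "S n" "1 / (real n + 2) < t" "t < 1 / (real n + 1)"
  shows "infinite_concat x l S t = l n ((t - 1 / (real n + 2)) * ((real n + 1) * (real n + 2)))"
proof -
  have "\<exists>n. S n \<and> 1 / (real n + 2) < t \<and> t < 1 / (real n + 1)" using assms by blast
  then show ?thesis
    unfolding infinite_concat_def harmonic_interval_the[OF assms(2,3)] by (simp only: if_True Let_def)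
qed

lemma infinite_concat_out:
  assumes "\<And>n. S n \<Longrightarrow> 1 / (real n + 2) < t \<Longrightarrow> t < 1 / (real n + 1) \<Longrightarrow> False"
  shows "infinite_concat x l S t = x"
  unfolding infinite_concat_def by (rule if_not_P) (use assms in blast)

lemma infinite_concat_cong:
  assumes "\<And>n. 1 / (real n + 2) < t \<Longrightarrow> t < 1 / (real n + 1) \<Longrightarrow> S n = T n"
  shows "infinite_concat x l S t = infinite_concat x l T t"
proof -
  have "(\<exists>n. S n \<and> 1 / (real n + 2) < t \<and> t < 1 / (real n + 1)) = (\<exists>n. T n \<and> 1 / (real n + 2) < t \<and> t < 1 / (real n + 1))"
    using assms by blast
  then show ?thesis unfolding infinite_concat_def by (simp only:)
qed

lemma infinite_concat_ends: "infinite_concat x l S 0 = x" "infinite_concat x l S 1 = x"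
proof -
  show "infinite_concat x l S 0 = x"
  proof (rule infinite_concat_out)
    fix n assume "1 / (real n + 2) < 0"
    moreover have "0 < 1 / (real n + 2)" by simp
    ultimately show False by linarith
  qed
  show "infinite_concat x l S 1 = x"
  proof (rule infinite_concat_out)
    fix n assume "1 < 1 / (real n + 1)"
    then show False by (simp add: field_simps)
  qed
qed

text \<open>As \<open>l n\<close> starts and ends at \<open>x\<close>, the formula for the open
  interval extends to the endpoints, as gluing along closed sets requires.\<close>

lemma infinite_concat_on_interval:
  assumes l: "l n 0 = x" "l n 1 = x" and t: "1 / (real n + 2) \<le> t" "t \<le> 1 / (real n + 1)"
  shows "infinite_concat x l S t = (if S n then l n ((t - 1 / (real n + 2)) * ((real n + 1) * (real n + 2))) else x)"
proof (cases "1 / (real n + 2) < t \<and> t < 1 / (real n + 1)")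
  case int: True
  show ?thesis
  proof (cases "S n")
    case True
    then show ?thesis using infinite_concat_in[of S n t x l, OF True conjunct1[OF int] conjunct2[OF int]] by (simp only: if_True)
  next
    case False
    then have "infinite_concat x l S t = x"
      using harmonic_interval_unique[of n t] int by (intro infinite_concat_out) blast
    then show ?thesis using False by (simp only: if_False)
  qed
next
  case False
  then consider "t = 1 / (real n + 2)" | "t = 1 / (real n + 1)" using t by linarith
  then show ?thesis
  proof cases
    case 1
    have "infinite_concat x l S t = x"
    proof (rule infinite_concat_out)
      fix m assume m: "1 / (real m + 2) < t" "t < 1 / (real m + 1)"
      have "n < m" using m(1) unfolding 1 by (simp add: field_simps)
      moreover have "m < n + 1" using m(2) unfolding 1 by (simp add: field_simps)
      ultimately show False by simp
    qed
    then show ?thesis using l 1 by simp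
  next
    case 2
    have "infinite_concat x l S t = x"
    proof (rule infinite_concat_out)
      fix m assume m: "1 / (real m + 2) < t" "t < 1 / (real m + 1)"
      have "n < m + 1" using m(1) unfolding 2 by (simp add: field_simps)
      moreover have "m < n" using m(2) unfolding 2 by (simp add: field_simps)
      ultimately show False by simp
    qed
    moreover have "(t - 1 / (real n + 2)) * ((real n + 1) * (real n + 2)) = 1"
      unfolding 2 by (rule harmonic_gap)
    ultimately show ?thesis using l by (simp only: if_cancel split: if_split)
  qed
qed

context compact_metric
begin

text \<open>Conjugation with a path from \<open>x\<close> turns a loop in a path connected
  neighbourhood \<open>U\<close> of \<open>x\<close> into a loop at \<open>x\<close> with the same
  homology class, so the condition on loops at \<open>x\<close> covers all loops in
  \<open>U\<close>. A Lebesgue number of a finite cover by such sets is the \<epsilon>.\<close>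

lemma loops_killed_uniformly:
  assumes lpc: "locally_path_connected_space mtopology"
    and pt: "\<And>x. x \<in> M \<Longrightarrow> \<exists>k. \<forall>l. pathin mtopology l \<longrightarrow> l 0 = x \<longrightarrow> l 1 = x
       \<longrightarrow> l \<in> {0..1} \<rightarrow> mball x (1 / (real k + 1)) \<longrightarrow> frag_cmul (fact k) (path_chain l) \<in> bdry mtopology"
  obtains N :: nat and \<epsilon> :: real where "N > 0" "\<epsilon> > 0"
    "\<And>g. pathin mtopology g \<Longrightarrow> g 0 = g 1 \<Longrightarrow> g \<in> {0..1} \<rightarrow> mball (g 0) \<epsilon>
        \<Longrightarrow> frag_cmul (int N) (path_chain g) \<in> bdry mtopology"
proof -
  let ?X = mtopology
  note B = subspace_bdry[of ?X]
  have "\<forall>x\<in>M. \<exists>k U. openin ?X U \<and> x \<in> U \<and> (\<forall>g. pathin ?X g \<longrightarrow> g 0 = g 1 \<longrightarrow> g \<in> {0..1} \<rightarrow> U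
      \<longrightarrow> frag_cmul (fact k) (path_chain g) \<in> bdry ?X)"
  proof
    fix x assume x: "x \<in> M"
    obtain k where k: "\<And>l. pathin ?X l \<Longrightarrow> l 0 = x \<Longrightarrow> l 1 = x
       \<Longrightarrow> l \<in> {0..1} \<rightarrow> mball x (1 / (real k + 1)) \<Longrightarrow> frag_cmul (fact k) (path_chain l) \<in> bdry ?X"
      using pt[OF x] by metis
    have "openin ?X (mball x (1 / (real k + 1)))" "x \<in> mball x (1 / (real k + 1))" using x by simp_all
    then obtain U where U: "openin ?X U" "path_connectedin ?X U" "x \<in> U" "U \<subseteq> mball x (1 / (real k + 1))"
      using lpc[unfolded locally_path_connected_space] by meson
    have "frag_cmul (fact k) (path_chain g) \<in> bdry ?X"
      if g: "pathin ?X g" "g 0 = g 1" "g \<in> {0..1} \<rightarrow> U" for g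
    proof -
      have "g 0 \<in> U" using g(3) by auto
      then obtain q where q: "pathin ?X q" "q \<in> {0..1} \<rightarrow> U" "q 0 = x" "q 1 = g 0"
        using U(2,3) unfolding path_connectedin by blast
      have rq: "pathin ?X (seg q 1 0)" by (rule pathin_seg[OF q(1)]) auto
      let ?j1 = "join_path q g"
      let ?j2 = "join_path ?j1 (seg q 1 0)"
      have j1: "pathin ?X ?j1" by (rule pathin_join[OF q(1) g(1) q(4)])
      have j2: "pathin ?X ?j2" by (rule pathin_join[OF j1 rq]) (simp add: g q)
      have "?j2 \<in> {0..1} \<rightarrow> U" by (intro join_path_image seg_reverse_image q(2) g(3))
      then have "?j2 \<in> {0..1} \<rightarrow> mball x (1 / (real k + 1))" using U(4) by blast
      then have 0: "frag_cmul (fact k) (path_chain ?j2) \<in> bdry ?X" by (intro k j2) (simp_all add: q)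
      have 1: "path_chain q + path_chain g - path_chain ?j1 \<in> bdry ?X" by (rule path_chain_join[OF q(1) g(1) q(4)])
      have 2: "path_chain ?j1 + path_chain (seg q 1 0) - path_chain ?j2 \<in> bdry ?X"
        by (rule path_chain_join[OF j1 rq]) (simp add: g q)
      have 3: "path_chain q + path_chain (seg q 1 0) \<in> bdry ?X" by (rule path_chain_reverse[OF q(1)])
      have "(path_chain q + path_chain g - path_chain ?j1) + (path_chain ?j1 + path_chain (seg q 1 0) - path_chain ?j2)
         - (path_chain q + path_chain (seg q 1 0)) \<in> bdry ?X"
        by (rule frag.subspace_diff[OF B frag.subspace_add[OF B 1 2] 3])
      then have "path_chain g - path_chain ?j2 \<in> bdry ?X" by (simp add: algebra_simps)
      from frag.subspace_add[OF B frag.subspace_scale[OF B this, of "fact k"] 0]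
      show ?thesis by (simp add: frag_cmul_distrib2[symmetric])
    qed
    then show "\<exists>k U. openin ?X U \<and> x \<in> U \<and> (\<forall>g. pathin ?X g \<longrightarrow> g 0 = g 1 \<longrightarrow> g \<in> {0..1} \<rightarrow> U
      \<longrightarrow> frag_cmul (fact k) (path_chain g) \<in> bdry ?X)" using U by blast
  qed
  then obtain k U where U: "\<And>x. x \<in> M \<Longrightarrow> openin ?X (U x)" "\<And>x. x \<in> M \<Longrightarrow> x \<in> U x"
    and kU: "\<And>x g. x \<in> M \<Longrightarrow> pathin ?X g \<Longrightarrow> g 0 = g 1 \<Longrightarrow> g \<in> {0..1} \<rightarrow> U x
      \<Longrightarrow> frag_cmul (fact (k x)) (path_chain g) \<in> bdry ?X"
    by metis
  have cM: "compactin ?X M" using compact_M by (simp add: compact_space_def)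
  have "\<exists>F. finite F \<and> F \<subseteq> U ` M \<and> M \<subseteq> \<Union>F"
    by (rule compactinD[OF cM]) (use U in auto)
  then obtain V where V: "finite V" "V \<subseteq> M" "M \<subseteq> (\<Union>v\<in>V. U v)"
    by (metis finite_subset_image)
  have "\<exists>\<delta>>0. \<forall>x\<in>M. \<exists>W\<in>U ` V. mball x \<delta> \<subseteq> W"
    by (rule lebesgue_number[OF cM]) (use V U in auto)
  then obtain \<epsilon> where \<epsilon>: "\<epsilon> > 0" "\<And>x. x \<in> M \<Longrightarrow> \<exists>v\<in>V. mball x \<epsilon> \<subseteq> U v" by auto
  \<comment> \<open>The sum bounds each \<open>k v\<close>, so every \<open>fact (k v)\<close>
    divides \<open>fact n\<close>.\<close>
  define n where "n = (\<Sum>v\<in>V. k v)"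
  show ?thesis
  proof (rule that[of "fact n" \<epsilon>])
    fix g assume g: "pathin ?X g" "g 0 = g 1" "g \<in> {0..1} \<rightarrow> mball (g 0) \<epsilon>"
    have "g 0 \<in> M" using path_start_in_topspace[OF g(1)] by simp
    then obtain v where v: "v \<in> V" "mball (g 0) \<epsilon> \<subseteq> U v" using \<epsilon>(2) by blast
    have "g \<in> {0..1} \<rightarrow> U v" using g(3) v(2) by blast
    moreover have "v \<in> M" using v(1) V(2) by blast
    ultimately have "frag_cmul (fact (k v)) (path_chain g) \<in> bdry ?X" by (intro kU g)
    moreover have "k v \<le> n" unfolding n_def using v(1) V(1) by (intro member_le_sum) auto
    then obtain c :: int where "fact n = c * fact (k v)"
      by (metis fact_dvd dvdE mult.commute)
    ultimately have "frag_cmul (fact n) (path_chain g) \<in> bdry ?X"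
      using frag.subspace_scale[OF B, of "frag_cmul (fact (k v)) (path_chain g)" c] by (simp only: frag_cmul_cmul)
    then show "frag_cmul (int (fact n)) (path_chain g) \<in> bdry ?X" by (simp only: of_nat_fact)
  qed (use \<epsilon>(1) in simp_all)
qed

end

section \<open>Concatenations along a null sequence of loops\<close>

locale null_loops = compact_metric +
  fixes x :: 'a and l :: "nat \<Rightarrow> real \<Rightarrow> 'a"
  assumes x_in_M: "x \<in> M" and pathin_l: "\<And>n. pathin mtopology (l n)"
    and l0: "\<And>n. l n 0 = x" and l1: "\<And>n. l n 1 = x"
    and l_small: "\<And>n. l n \<in> {0..1} \<rightarrow> mball x (1 / (real n + 1))"
begin

abbreviation concat_on :: "(nat \<Rightarrow> bool) \<Rightarrow> real \<Rightarrow> 'a" where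
  "concat_on \<equiv> infinite_concat x l"

lemma concat_on_small:
  assumes t: "t < 1 / (real n + 1)"
  shows "concat_on S t \<in> mball x (1 / (real n + 1))"
proof (cases "\<exists>m. S m \<and> 1 / (real m + 2) < t \<and> t < 1 / (real m + 1)")
  case True
  then obtain m where m: "S m" "1 / (real m + 2) < t" "t < 1 / (real m + 1)" by blast
  have "1 / (real m + 2) < 1 / (real n + 1)" using m t by linarith
  then have "n \<le> m" by (simp add: field_simps)
  then have le: "1 / (real m + 1) \<le> 1 / (real n + 1)" by (intro divide_left_mono) auto
  let ?s = "(t - 1 / (real m + 2)) * ((real m + 1) * (real m + 2))"
  have "0 \<le> ?s" using m by (intro mult_nonneg_nonneg) auto
  moreover have "?s \<le> (1 / (real m + 1) - 1 / (real m + 2)) * ((real m + 1) * (real m + 2))"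
    using m by (intro mult_right_mono) auto
  ultimately have "?s \<in> {0..1}" by (simp only: atLeastAtMost_iff harmonic_gap)
  then have "l m ?s \<in> mball x (1 / (real m + 1))" by (rule funcset_mem[OF l_small])
  then show ?thesis unfolding infinite_concat_in[of S m t x l, OF m] using le by auto
next
  case False
  then have "concat_on S t = x" by (intro infinite_concat_out) blast
  then show ?thesis using x_in_M by simp
qed

lemma concat_on_agree:
  assumes "\<And>i. i < n \<Longrightarrow> S i = T i" "t \<ge> 1 / (real n + 1)"
  shows "concat_on S t = concat_on T t"
proof (rule infinite_concat_cong)
  fix m assume "1 / (real m + 2) < t" "t < 1 / (real m + 1)"
  then have "1 / (real n + 1) < 1 / (real m + 1)" using assms(2) by linarith
  then have "m < n" by (simp add: field_simps)
  then show "S m = T m" by (rule assms)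
qed

lemma concat_on_in_M: "concat_on S t \<in> M"
proof (cases "t < 1")
  case True
  then show ?thesis using concat_on_small[of t 0 S] by simp
next
  case False
  have "concat_on S t = x"
  proof (rule infinite_concat_out)
    fix n assume "t < 1 / (real n + 1)"
    then have "1 < 1 / (real n + 1)" using False by linarith
    then show False by (simp add: field_simps)
  qed
  then show ?thesis using x_in_M by simp
qed

text \<open>Before 1/(n+1) both paths stay within 1/(n+1) of \<open>x\<close>, and from there on
  they coincide. The bound is uniform in \<open>t\<close>; it yields both the continuity of each
  concatenation and its continuous dependence on the index set.\<close>

lemma concat_on_close:
  assumes "\<And>i. i < n \<Longrightarrow> S i = T i"
  shows "d (concat_on S t) (concat_on T t) < 2 / (real n + 1)"
proof (cases "t < 1 / (real n + 1)")
  case True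
  have "d (concat_on S t) (concat_on T t) \<le> d x (concat_on S t) + d x (concat_on T t)"
    by (rule triangle'') (use concat_on_in_M x_in_M in auto)
  also have "\<dots> < 1 / (real n + 1) + 1 / (real n + 1)"
    using concat_on_small[OF True, of S] concat_on_small[OF True, of T] by (intro add_strict_mono) auto
  finally show ?thesis by simp
next
  case False
  then have "concat_on S t = concat_on T t" using concat_on_agree[of n S T t] assms by simp
  then show ?thesis using concat_on_in_M by simp
qed

lemma pathin_concat_on_finite:
  "pathin mtopology (concat_on (\<lambda>i. S i \<and> i < n))"
proof -
  let ?I = "top_of_set {0..1::real}"
  \<comment> \<open>Finitely many closed pieces: the intervals of index below \<open>n\<close>, and
    as piece \<open>n\<close> the rest near 0, where the path stands still at
    \<open>x\<close>.\<close>
  define T where "T i = (if i < n then {1 / (real i + 2)..1 / (real i + 1)} else {0..1 / (real n + 1)})" for i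
  define f where "f i t = (if i < n \<and> S i then l i ((t - 1 / (real i + 2)) * ((real i + 1) * (real i + 2))) else x)" for i t
  have fT: "concat_on (\<lambda>i. S i \<and> i < n) t = f i t" if "i \<le> n" "t \<in> T i" for i t
  proof (cases "i < n")
    case True
    then show ?thesis using that infinite_concat_on_interval[of l i x t "\<lambda>i. S i \<and> i < n"] l0 l1
      by (simp add: T_def f_def)
  next
    case False
    then have t: "t \<le> 1 / (real n + 1)" using that by (simp add: T_def)
    have "concat_on (\<lambda>i. S i \<and> i < n) t = x"
    proof (rule infinite_concat_out)
      fix m assume m: "S m \<and> m < n" "1 / (real m + 2) < t"
      then have "1 / (real m + 2) < 1 / (real n + 1)" using t by linarith
      then have "n < m + 1" by (simp add: field_simps)
      then show False using m by simp
    qed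
    then show ?thesis using False by (simp add: f_def)
  qed
  have "continuous_map ?I mtopology (concat_on (\<lambda>i. S i \<and> i < n))"
  proof (rule pasting_lemma_closed[where I = "{..n}" and T = "\<lambda>i. T i \<inter> {0..1}" and f = f])
    show "closedin ?I (T i \<inter> {0..1})" for i
    proof -
      have "closed (T i)" by (simp add: T_def)
      then show ?thesis by (metis closedin_closed_Int inf_commute)
    qed
    show "continuous_map (subtopology ?I (T i \<inter> {0..1})) mtopology (f i)" if "i \<in> {..n}" for i
    proof (cases "i < n \<and> S i")
      case True
      have "continuous_map (subtopology ?I (T i \<inter> {0..1})) mtopology
          (\<lambda>t. l i ((t - 1 / (real i + 2)) * ((real i + 1) * (real i + 2))))"
      proof (rule continuous_map_into_interval[OF _ _ pathin_l])
        show "continuous_map (subtopology ?I (T i \<inter> {0..1})) euclideanreal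
            (\<lambda>t. (t - 1 / (real i + 2)) * ((real i + 1) * (real i + 2)))"
          by (auto simp: subtopology_subtopology intro!: continuous_intros)
        fix t assume "t \<in> topspace (subtopology ?I (T i \<inter> {0..1}))"
        then have t: "1 / (real i + 2) \<le> t" "t \<le> 1 / (real i + 1)" using True by (auto simp: T_def)
        have "(t - 1 / (real i + 2)) * ((real i + 1) * (real i + 2))
            \<le> (1 / (real i + 1) - 1 / (real i + 2)) * ((real i + 1) * (real i + 2))"
          using t by (intro mult_right_mono) auto
        also have "\<dots> = 1" by (rule harmonic_gap)
        finally show "0 \<le> (t - 1 / (real i + 2)) * ((real i + 1) * (real i + 2))
            \<and> (t - 1 / (real i + 2)) * ((real i + 1) * (real i + 2)) \<le> 1"
          using t by simp
      qed
      then show ?thesis using True by (simp add: f_def[abs_def])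
    next
      case False
      have "f i = (\<lambda>_. x)" by (rule ext) (simp only: f_def False if_False)
      then show ?thesis using x_in_M by simp
    qed
    show "f i t = f j t" if "i \<in> {..n}" "j \<in> {..n}" "t \<in> topspace ?I \<inter> (T i \<inter> {0..1}) \<inter> (T j \<inter> {0..1})" for i j t
      using fT[of i t] fT[of j t] that by simp
    show "\<exists>j. j \<in> {..n} \<and> t \<in> T j \<inter> {0..1} \<and> concat_on (\<lambda>i. S i \<and> i < n) t = f j t" if t: "t \<in> topspace ?I" for t
    proof -
      have "\<exists>j\<le>n. t \<in> T j"
      proof (cases "t \<le> 1 / (real n + 1)")
        case True
        then show ?thesis using t by (intro exI[of _ n]) (simp add: T_def)
      next
        case False
        have ex: "\<exists>j. 1 / (real j + 2) \<le> t" using False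
          by (intro exI[of _ n]) (smt (verit, best) frac_le of_nat_0_le_iff)
        \<comment> \<open>The least such \<open>j\<close> is the index of an interval around
          \<open>t\<close>: minimality supplies the upper bound.\<close>
        define j where "j = (LEAST j. 1 / (real j + 2) \<le> t)"
        have j: "1 / (real j + 2) \<le> t" unfolding j_def using ex by (rule LeastI_ex)
        have jn: "j < n"
        proof (rule ccontr)
          assume "\<not> j < n"
          show False
          proof (cases n)
            case 0
            then show False using False t by simp
          next
            case (Suc m)
            have "real n + 1 = real m + 2" using Suc by simp
            then have "1 / (real m + 2) \<le> t" using False by (simp only: not_le less_imp_le)
            then have "j \<le> m" unfolding j_def by (rule Least_le)
            then show False using \<open>\<not> j < n\<close> Suc by simp
          qed
        qed
        have "t \<le> 1 / (real j + 1)"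
        proof (cases j)
          case 0
          then show ?thesis using t by simp
        next
          case (Suc m)
          then have "\<not> 1 / (real m + 2) \<le> t" using not_less_Least[of m "\<lambda>j. 1 / (real j + 2) \<le> t"] j_def by simp
          then show ?thesis using Suc by (simp add: add.commute)
        qed
        then show ?thesis using j jn by (intro exI[of _ j]) (simp add: T_def)
      qed
      then show ?thesis using fT t by auto
    qed
  qed auto
  then show ?thesis by (simp add: pathin_def)
qed

text \<open>The truncations converge uniformly because the loops shrink.\<close>

lemma pathin_concat_on: "pathin mtopology (concat_on S)"
  unfolding pathin_def
proof (rule continuous_map_uniform_limit[where f = "\<lambda>n. concat_on (\<lambda>i. S i \<and> i < n)" and F = sequentially])
  show "\<forall>\<^sub>F n in sequentially. continuous_map (top_of_set {0..1}) mtopology (concat_on (\<lambda>i. S i \<and> i < n))"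
    using pathin_concat_on_finite by (simp add: pathin_def)
  fix \<epsilon> :: real assume "\<epsilon> > 0"
  then obtain N where N: "inverse (real (Suc N)) < \<epsilon> / 2" using reals_Archimedean[of "\<epsilon>/2"] by auto
  show "\<forall>\<^sub>F n in sequentially. \<forall>t\<in>topspace (top_of_set {0..1}). concat_on S t \<in> M
      \<and> d (concat_on (\<lambda>i. S i \<and> i < n) t) (concat_on S t) < \<epsilon>"
  proof (rule eventually_sequentiallyI[of N], intro ballI conjI concat_on_in_M)
    fix n t assume "N \<le> n"
    have "d (concat_on (\<lambda>i. S i \<and> i < n) t) (concat_on S t) < 2 / (real n + 1)"
      by (rule concat_on_close) simp
    also have "\<dots> \<le> 2 / (real N + 1)" using \<open>N \<le> n\<close> by (intro divide_left_mono) auto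
    also have "\<dots> < \<epsilon>" using N by (simp add: field_simps)
    finally show "d (concat_on (\<lambda>i. S i \<and> i < n) t) (concat_on S t) < \<epsilon>" .
  qed
qed simp

text \<open>Both paths are cut at the ends of the interval of index \<open>n\<close>. The outer
  pieces coincide, and the middle one is \<open>l n\<close> for \<open>S\<close> and constant for
  \<open>T\<close>.\<close>

lemma concat_on_flip:
  assumes S: "S n" "\<not> T n" and ST: "\<And>i. i \<noteq> n \<Longrightarrow> S i = T i"
  shows "path_chain (concat_on S) - path_chain (concat_on T) - path_chain (l n) \<in> bdry mtopology"
proof -
  let ?B = "bdry mtopology"
  note B = subspace_bdry[of mtopology]
  define a where "a = 1 / (real n + 2)"
  define b where "b = 1 / (real n + 1)"
  have ab: "0 \<le> a" "a \<le> b" "b \<le> 1" by (simp_all add: a_def b_def field_simps)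
  then have a1: "a \<le> 1" and b0: "0 \<le> b" by linarith+
  have ba: "(b - a) * ((real n + 1) * (real n + 2)) = 1" unfolding a_def b_def by (rule harmonic_gap)
  have eq: "concat_on S t = concat_on T t" if "t \<le> a \<or> b \<le> t" for t
  proof (rule infinite_concat_cong)
    fix m assume m: "1 / (real m + 2) < t" "t < 1 / (real m + 1)"
    have "m \<noteq> n" using m that by (auto simp: a_def b_def)
    then show "S m = T m" by (rule ST)
  qed
  have 1: "path_chain (seg (concat_on S) 0 a) = path_chain (seg (concat_on T) 0 a)"
  proof (rule path_chain_cong)
    fix t :: real assume t: "0 \<le> t" "t \<le> 1"
    have "(1 - t) * 0 + t * a \<in> {0..a}" by (rule seg_in_interval) (use t ab a1 in auto)
    then show "seg (concat_on S) 0 a t = seg (concat_on T) 0 a t" unfolding seg_def by (intro eq) simp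
  qed
  have 2: "path_chain (seg (concat_on S) b 1) = path_chain (seg (concat_on T) b 1)"
  proof (rule path_chain_cong)
    fix t :: real assume t: "0 \<le> t" "t \<le> 1"
    have "(1 - t) * b + t * 1 \<in> {b..1}" by (rule seg_in_interval) (use t ab b0 in auto)
    then show "seg (concat_on S) b 1 t = seg (concat_on T) b 1 t" unfolding seg_def by (intro eq) simp
  qed
  have mid: "path_chain (seg (concat_on U) a b) = path_chain (if U n then l n else (\<lambda>_. x))" for U
  proof (rule path_chain_cong)
    fix t :: real assume t: "0 \<le> t" "t \<le> 1"
    have z: "(1 - t) * a + t * b \<in> {a..b}" by (rule seg_in_interval) (use t ab in auto)
    have "((1 - t) * a + t * b - a) * ((real n + 1) * (real n + 2)) = t * ((b - a) * ((real n + 1) * (real n + 2)))"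
      by (simp add: algebra_simps)
    then have "((1 - t) * a + t * b - a) * ((real n + 1) * (real n + 2)) = t" unfolding ba by simp
    then show "seg (concat_on U) a b t = (if U n then l n else (\<lambda>_. x)) t"
      using infinite_concat_on_interval[of l n x "(1 - t) * a + t * b" U, OF l0 l1] z
      by (simp add: seg_def a_def b_def)
  qed
  have *: "path_chain (concat_on U) - (path_chain (seg (concat_on U) 0 a) + path_chain (if U n then l n else (\<lambda>_. x))
      + path_chain (seg (concat_on U) b 1)) \<in> ?B" for U
  proof -
    have t1: "path_chain (seg (concat_on U) 0 a) + path_chain (seg (concat_on U) a b) - path_chain (seg (concat_on U) 0 b) \<in> ?B"
      by (rule path_triangle[OF pathin_concat_on]) (use ab a1 b0 in auto)
    have t2: "path_chain (seg (concat_on U) 0 b) + path_chain (seg (concat_on U) b 1) - path_chain (seg (concat_on U) 0 1) \<in> ?B"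
      by (rule path_triangle[OF pathin_concat_on]) (use ab a1 b0 in auto)
    from frag.subspace_neg[OF B frag.subspace_add[OF B t1 t2]]
    show ?thesis unfolding mid[symmetric] by (simp add: seg_0_1 algebra_simps)
  qed
  have c: "path_chain (\<lambda>_. x) \<in> ?B" by (rule path_chain_const_bdry) (use x_in_M in simp)
  have sS: "path_chain (concat_on S) - (path_chain (seg (concat_on T) 0 a) + path_chain (l n) + path_chain (seg (concat_on T) b 1)) \<in> ?B"
    using *[of S] S by (simp add: 1 2)
  have sT: "path_chain (concat_on T) - (path_chain (seg (concat_on T) 0 a) + path_chain (\<lambda>_. x) + path_chain (seg (concat_on T) b 1)) \<in> ?B"
    using *[of T] S by simp
  from frag.subspace_diff[OF B frag.subspace_diff[OF B sS sT] c]
  show ?thesis by (simp add: algebra_simps)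
qed

end

section \<open>Homologous infinite concatenations\<close>

text \<open>The last hypothesis makes \<open>\<tau> p\<close> \<mapsto> \<open>\<tau>' p\<close> a
  map of generators; its linear extension carries the first sum to the second.\<close>

lemma frag_sum_collapse:
  assumes "(\<Sum>p\<in>P. frag_cmul (c p) (frag_of (\<tau> p))) = 0" "finite P"
    and "\<And>p q. p \<in> P \<Longrightarrow> q \<in> P \<Longrightarrow> \<tau> p = \<tau> q \<Longrightarrow> \<tau>' p = \<tau>' q"
  shows "(\<Sum>p\<in>P. frag_cmul (c p) (frag_of (\<tau>' p))) = 0"
proof -
  define \<phi> where "\<phi> t = \<tau>' (SOME p. p \<in> P \<and> \<tau> p = t)" for t
  have \<phi>: "\<phi> (\<tau> p) = \<tau>' p" if "p \<in> P" for p
  proof -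
    have "(SOME q. q \<in> P \<and> \<tau> q = \<tau> p) \<in> P \<and> \<tau> (SOME q. q \<in> P \<and> \<tau> q = \<tau> p) = \<tau> p"
      by (rule someI[of _ p]) (use that in simp)
    then show ?thesis unfolding \<phi>_def using assms(3) that by blast
  qed
  have "frag_extend (frag_of \<circ> \<phi>) (\<Sum>p\<in>P. frag_cmul (c p) (frag_of (\<tau> p))) = (\<Sum>p\<in>P. frag_cmul (c p) (frag_of (\<phi> (\<tau> p))))"
    using assms(2) by (simp add: frag_extend_sum o_def frag_extend_cmul)
  also have "\<dots> = (\<Sum>p\<in>P. frag_cmul (c p) (frag_of (\<tau>' p)))"
    by (rule sum.cong) (simp_all add: \<phi>)
  finally show ?thesis unfolding assms(1) by simp
qed

context compact_metric
begin

text \<open>Separability of the continuous maps for the uniform metric. A map is described by a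
  scale \<open>k\<close> and by values from a finite net of \<open>M\<close> at the points of a
  finite net of \<open>K\<close>. The scale depends on the modulus of continuity and is not bounded
  in advance, so the descriptions form the countable set \<open>A\<close>.\<close>

lemma countable_uniform_code:
  fixes K :: "'k::metric_space set"
  assumes K: "compact K" and "\<epsilon> > 0"
  obtains code :: "('k \<Rightarrow> 'a) \<Rightarrow> nat" where
    "\<And>f g x. continuous_map (top_of_set K) mtopology f \<Longrightarrow> continuous_map (top_of_set K) mtopology g
       \<Longrightarrow> code f = code g \<Longrightarrow> x \<in> K \<Longrightarrow> d (f x) (g x) < \<epsilon>"
proof -
  have "\<exists>F. finite F \<and> F \<subseteq> K \<and> K \<subseteq> (\<Union>c\<in>F. ball c (1 / real (Suc k)))" for k
  proof -
    have "K \<subseteq> (\<Union>c\<in>K. ball c (1 / real (Suc k)))"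
    proof
      fix c assume "c \<in> K"
      moreover have "c \<in> ball c (1 / real (Suc k))" by simp
      ultimately show "c \<in> (\<Union>c\<in>K. ball c (1 / real (Suc k)))" by blast
    qed
    then obtain F where "F \<subseteq> K" "finite F" "K \<subseteq> (\<Union>c\<in>F. ball c (1 / real (Suc k)))"
      using compactE_image[OF K, of K "\<lambda>c. ball c (1 / real (Suc k))"] by auto
    then show ?thesis by blast
  qed
  then obtain F where F: "\<And>k. finite (F k)" "\<And>k. F k \<subseteq> K" "\<And>k. K \<subseteq> (\<Union>c\<in>F k. ball c (1 / real (Suc k)))"
    by metis
  have "mtotally_bounded M" using compact_M compact_space_eq_mcomplete_mtotally_bounded by blast
  from this[unfolded mtotally_bounded_def, rule_format, of "\<epsilon>/4"] \<open>\<epsilon> > 0\<close>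
  obtain G where G: "finite G" "G \<subseteq> M" "M \<subseteq> (\<Union>v\<in>G. mball v (\<epsilon>/4))" by auto
  define A where "A = (SIGMA k:UNIV. PiE (F k) (\<lambda>_. G))"
  have cA: "countable A" unfolding A_def
    by (rule countable_SIGMA, simp, rule countable_finite, rule finite_PiE, rule F(1), rule G(1))
  \<comment> \<open>Closeness is required on whole balls around the net points, so maps sharing a
    description can be compared at every point of \<open>K\<close>.\<close>
  define approx where "approx f kh \<longleftrightarrow> (\<forall>c\<in>F (fst kh). \<forall>x\<in>K. dist c x < 1 / real (Suc (fst kh)) \<longrightarrow> d (snd kh c) (f x) < \<epsilon>/2)"
    for f and kh :: "nat \<times> ('k \<Rightarrow> 'a)"
  have ex: "\<exists>kh\<in>A. approx f kh" if f: "continuous_map (top_of_set K) mtopology f" for f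
  proof -
    have fM: "f x \<in> M" if "x \<in> K" for x
      using continuous_map_funspace[OF f] that by auto
    obtain \<eta> where \<eta>: "\<eta> > 0" "\<And>x y. x \<in> K \<Longrightarrow> y \<in> K \<Longrightarrow> dist x y < \<eta> \<Longrightarrow> d (f x) (f y) < \<epsilon>/4"
      using uniformly_continuous_on_compact[OF K f, of "\<epsilon>/4"] \<open>\<epsilon> > 0\<close> by auto
    obtain k where k: "inverse (real (Suc k)) < \<eta>" using reals_Archimedean[OF \<eta>(1)] by blast
    have "\<forall>c\<in>F k. \<exists>v\<in>G. d v (f c) < \<epsilon>/4"
    proof
      fix c assume "c \<in> F k"
      then have "f c \<in> M" using F(2) fM by blast
      then show "\<exists>v\<in>G. d v (f c) < \<epsilon>/4" using G(3) by fastforce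
    qed
    then obtain h where h: "\<And>c. c \<in> F k \<Longrightarrow> h c \<in> G" "\<And>c. c \<in> F k \<Longrightarrow> d (h c) (f c) < \<epsilon>/4" by metis
    have "(k, restrict h (F k)) \<in> A" using h(1) by (auto simp: A_def)
    moreover have "approx f (k, restrict h (F k))"
      unfolding approx_def fst_conv snd_conv
    proof (intro ballI impI)
      fix c x assume c: "c \<in> F k" and x: "x \<in> K" and dx: "dist c x < 1 / real (Suc k)"
      have cK: "c \<in> K" using c F(2) by blast
      have "dist c x < \<eta>" using dx k by (simp add: inverse_eq_divide)
      then have "d (f c) (f x) < \<epsilon>/4" using \<eta>(2)[OF cK x] by simp
      moreover have "d (h c) (f x) \<le> d (h c) (f c) + d (f c) (f x)"
        using h(1)[OF c] G(2) fM[OF cK] fM[OF x] by (intro triangle) auto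
      ultimately show "d (restrict h (F k) c) (f x) < \<epsilon>/2" using h(2)[OF c] c by simp
    qed
    ultimately show ?thesis by blast
  qed
  define pick where "pick f = (SOME kh. kh \<in> A \<and> approx f kh)" for f
  have pick: "pick f \<in> A" "approx f (pick f)" if f: "continuous_map (top_of_set K) mtopology f" for f
  proof -
    have "\<exists>kh. kh \<in> A \<and> approx f kh" using ex[OF f] by blast
    from someI_ex[OF this] show "pick f \<in> A" "approx f (pick f)" unfolding pick_def by simp_all
  qed
  show ?thesis
  proof (rule that[of "\<lambda>f. to_nat_on A (pick f)"])
    fix f g x
    assume f: "continuous_map (top_of_set K) mtopology f" and g: "continuous_map (top_of_set K) mtopology g"
      and eq: "to_nat_on A (pick f) = to_nat_on A (pick g)" and x: "x \<in> K"
    have "pick f = pick g"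
      using inj_onD[OF inj_on_to_nat_on[OF cA] eq pick(1)[OF f] pick(1)[OF g]] .
    then have ag: "approx g (pick f)" using pick(2)[OF g] by simp
    obtain k h where kh: "pick f = (k, h)" by force
    obtain c where c: "c \<in> F k" "dist c x < 1 / real (Suc k)" using F(3)[of k] x by auto
    have hc: "h c \<in> M" using pick(1)[OF f] c(1) G(2) unfolding kh A_def by auto
    have "d (h c) (f x) < \<epsilon>/2" using pick(2)[OF f] c x unfolding kh approx_def by auto
    moreover have "d (h c) (g x) < \<epsilon>/2" using ag c x unfolding kh approx_def by auto
    moreover have "d (f x) (g x) \<le> d (h c) (f x) + d (h c) (g x)"
      using hc x continuous_map_funspace[OF f] continuous_map_funspace[OF g] by (intro triangle'') auto
    ultimately show "d (f x) (g x) < \<epsilon>" by linarith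
  qed
qed

end

lemma compact_standard_simplex: "compact (standard_simplex p)"
  using compactin_standard_simplex[of p] by (simp add: euclidean_product_topology)

text \<open>
  The faces \<open>(i, f)\<close>, \<open>f \<le> 2\<close>, of \<open>k\<close> triangles and the two paths \<open>(k, 0)\<close>, \<open>(k, 1)\<close>.  The sum over these
  indices vanishes iff the triangles bound \<open>m!\<close> times the difference of the paths.
\<close>

definition term_index :: "nat \<Rightarrow> (nat \<times> nat) list" where
  "term_index k = List.product [0..<k] [0..<3] @ [(k, 0), (k, 1)]"

lemma set_term_index: "set (term_index k) = {..<k} \<times> {..2} \<union> {(k, 0), (k, 1)}"
  by (auto simp: term_index_def)

text \<open>\<open>(-1) ^ snd p\<close> is the sign of a face in the boundary; the paths carry
  opposite signs of \<open>fact m\<close> since they are moved to the side of the boundary.\<close>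

definition term_coeff :: "nat \<Rightarrow> int list \<Rightarrow> nat \<times> nat \<Rightarrow> int" where
  "term_coeff m cl p = (if fst p < length cl then (-1) ^ snd p * cl ! fst p
      else if snd p = 0 then - fact m else fact m)"

definition term_simplex ::
    "nat \<Rightarrow> (nat \<Rightarrow> (nat \<Rightarrow> real) \<Rightarrow> 'a) \<Rightarrow> (real \<Rightarrow> 'a) \<Rightarrow> (real \<Rightarrow> 'a) \<Rightarrow> nat \<times> nat \<Rightarrow> (nat \<Rightarrow> real) \<Rightarrow> 'a" where
  "term_simplex k \<sigma> g h p = (if fst p < k then singular_face 2 (snd p) (\<sigma> (fst p))
      else if snd p = 0 then path_simplex g else path_simplex h)"

lemma sum_terms:
  "(\<Sum>p\<in>set (term_index (length cl)). frag_cmul (term_coeff m cl p) (frag_of (term_simplex (length cl) \<sigma> g h p)))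
   = chain_boundary 2 (\<Sum>i<length cl. frag_cmul (cl ! i) (frag_of (\<sigma> i)))
     - frag_cmul (fact m) (path_chain g - path_chain h)"
proof -
  let ?k = "length cl"
  let ?t = "\<lambda>p. frag_cmul (term_coeff m cl p) (frag_of (term_simplex ?k \<sigma> g h p))"
  have "(\<Sum>p\<in>set (term_index ?k). ?t p) = (\<Sum>p\<in>{..<?k} \<times> {..2}. ?t p) + (\<Sum>p\<in>{(?k, 0), (?k, 1)}. ?t p)"
    unfolding set_term_index by (rule sum.union_disjoint) auto
  also have "(\<Sum>p\<in>{..<?k} \<times> {..2}. ?t p) = (\<Sum>i<?k. \<Sum>f\<le>2. ?t (i, f))"
    by (simp add: sum.cartesian_product)
  also have "\<dots> = (\<Sum>i<?k. frag_cmul (cl ! i) (chain_boundary 2 (frag_of (\<sigma> i))))"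
  proof (rule sum.cong[OF refl])
    fix i assume "i \<in> {..<?k}"
    then show "(\<Sum>f\<le>2. ?t (i, f)) = frag_cmul (cl ! i) (chain_boundary 2 (frag_of (\<sigma> i)))"
      by (simp add: chain_boundary_of frag_cmul_sum term_coeff_def term_simplex_def mult.commute)
  qed
  also have "\<dots> = chain_boundary 2 (\<Sum>i<?k. frag_cmul (cl ! i) (frag_of (\<sigma> i)))"
    by (simp add: chain_boundary_sum chain_boundary_cmul o_def)
  also have "(\<Sum>p\<in>{(?k, 0), (?k, 1)}. ?t p) = - frag_cmul (fact m) (path_chain g - path_chain h)"
  proof -
    have sum2: "(\<Sum>p\<in>{a, b}. f p) = f a + f b" if "a \<noteq> b" for f and a b :: "nat \<times> nat"
      using that by simp
    have "(?k, 0::nat) \<noteq> (?k, 1)" by simp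
    then have "(\<Sum>p\<in>{(?k, 0), (?k, 1)}. ?t p) = ?t (?k, 0) + ?t (?k, 1)" by (rule sum2)
    also have "\<dots> = frag_cmul (- fact m) (path_chain g) + frag_cmul (fact m) (path_chain h)"
      unfolding term_coeff_def term_simplex_def path_chain_def
      by (simp only: fst_conv snd_conv less_irrefl if_False if_True zero_neq_one[symmetric] simp_thms)
    also have "\<dots> = - frag_cmul (fact m) (path_chain g - path_chain h)"
      by (simp add: frag.scale_right_diff_distrib)
    finally show ?thesis .
  qed
  finally show ?thesis by (simp only: add_uminus_conv_diff)
qed

text \<open>Listing the coefficients puts them into a countable type, so that they can be part of a
  code.\<close>

lemma chain_explicit:
  assumes "singular_chain p X c"
  obtains cl :: "int list" and \<sigma> where "\<And>i. i < length cl \<Longrightarrow> singular_simplex p X (\<sigma> i)"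
    "c = (\<Sum>i<length cl. frag_cmul (cl ! i) (frag_of (\<sigma> i)))"
proof -
  obtain ks where ks: "set ks = Poly_Mapping.keys c" "distinct ks"
    using finite_distinct_list[OF finite_keys[of c]] by auto
  let ?cl = "map (Poly_Mapping.lookup c) ks"
  show ?thesis
  proof (rule that[of ?cl "\<lambda>i. ks ! i"])
    show "singular_simplex p X (ks ! i)" if "i < length ?cl" for i
    proof -
      have "ks ! i \<in> set ks" using that by simp
      then show ?thesis using assms unfolding singular_chain_def ks(1)[symmetric] by blast
    qed
    have "c = (\<Sum>t\<in>set ks. frag_cmul (Poly_Mapping.lookup c t) (frag_of t))"
      unfolding ks(1) using frag_expansion[of c] by (simp add: frag_extend_def)
    also have "\<dots> = (\<Sum>i<length ks. frag_cmul (Poly_Mapping.lookup c (ks ! i)) (frag_of (ks ! i)))"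
      using sum.reindex_bij_betw[OF bij_betw_nth[OF ks(2) refl refl],
          of "\<lambda>t. frag_cmul (Poly_Mapping.lookup c t) (frag_of t)"] by simp
    finally show "c = (\<Sum>i<length ?cl. frag_cmul (?cl ! i) (frag_of (ks ! i)))" by simp
  qed
qed

context null_loops
begin

definition homologous_pairs :: "nat \<Rightarrow> (nat \<Rightarrow> bool \<times> bool) set" where
  "homologous_pairs m = {z. frag_cmul (fact m)
      (path_chain (concat_on (fst \<circ> z)) - path_chain (concat_on (snd \<circ> z))) \<in> bdry mtopology}"

text \<open>The space of witnesses whose projection is the relation: triangles with coefficients
  that bound \<open>fact m\<close> times the difference of the two paths.\<close>

definition bounding_data :: "nat \<Rightarrow> ((nat \<Rightarrow> bool \<times> bool) \<times> int list \<times> (nat \<Rightarrow> (nat \<Rightarrow> real) \<Rightarrow> 'a)) set" where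
  "bounding_data m = {(z, cl, \<sigma>). (\<forall>i<length cl. singular_simplex 2 mtopology (\<sigma> i)) \<and>
     (\<Sum>p\<in>set (term_index (length cl)). frag_cmul (term_coeff m cl p)
        (frag_of (term_simplex (length cl) \<sigma> (concat_on (fst \<circ> z)) (concat_on (snd \<circ> z)) p))) = 0}"

lemma homologous_pairs_eq_image: "homologous_pairs m = fst ` bounding_data m"
proof (intro subset_antisym subsetI)
  fix z assume "z \<in> homologous_pairs m"
  then obtain e where e: "singular_chain 2 mtopology e" "chain_boundary 2 e = frag_cmul (fact m)
      (path_chain (concat_on (fst \<circ> z)) - path_chain (concat_on (snd \<circ> z)))"
    unfolding homologous_pairs_def mem_Collect_eq singular_boundary by (auto simp: numeral_2_eq_2)
  obtain cl \<sigma> where cl: "\<And>i. i < length cl \<Longrightarrow> singular_simplex 2 mtopology (\<sigma> i)"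
      "e = (\<Sum>i<length cl. frag_cmul (cl ! i) (frag_of (\<sigma> i)))"
    using chain_explicit[OF e(1)] by blast
  have "(z, cl, \<sigma>) \<in> bounding_data m"
    unfolding bounding_data_def mem_Collect_eq prod.case sum_terms using cl(1) e(2)[unfolded cl(2)] by simp
  then show "z \<in> fst ` bounding_data m" by force
next
  fix z assume "z \<in> fst ` bounding_data m"
  then obtain cl \<sigma> where *: "(z, cl, \<sigma>) \<in> bounding_data m" by auto
  let ?e = "\<Sum>i<length cl. frag_cmul (cl ! i) (frag_of (\<sigma> i))"
  have "chain_boundary 2 ?e = frag_cmul (fact m) (path_chain (concat_on (fst \<circ> z)) - path_chain (concat_on (snd \<circ> z)))"
    using * unfolding bounding_data_def mem_Collect_eq prod.case sum_terms by simp
  moreover have "singular_chain 2 mtopology ?e"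
    using * by (intro singular_chain_sum singular_chain_cmul) (simp add: bounding_data_def singular_chain_of)
  ultimately show "z \<in> homologous_pairs m"
    unfolding homologous_pairs_def mem_Collect_eq singular_boundary by (intro exI[of _ ?e]) (simp add: numeral_2_eq_2)
qed

lemma limitin_concat_on:
  assumes "\<And>n i. i < n \<Longrightarrow> S n i = T i"
  shows "limitin mtopology (\<lambda>n. concat_on (S n) t) (concat_on T t) sequentially"
  unfolding limit_metric_sequentially
proof (intro conjI allI impI concat_on_in_M)
  fix \<epsilon> :: real assume "\<epsilon> > 0"
  then obtain N where N: "inverse (real (Suc N)) < \<epsilon> / 2" using reals_Archimedean[of "\<epsilon>/2"] by auto
  show "\<exists>N. \<forall>n\<ge>N. concat_on (S n) t \<in> M \<and> d (concat_on (S n) t) (concat_on T t) < \<epsilon>"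
  proof (intro exI[of _ N] allI impI conjI concat_on_in_M)
    fix n assume "N \<le> n"
    have "d (concat_on (S n) t) (concat_on T t) < 2 / (real n + 1)"
      by (rule concat_on_close) (simp add: assms)
    also have "\<dots> \<le> 2 / (real N + 1)" using \<open>N \<le> n\<close> by (intro divide_left_mono) auto
    also have "\<dots> < \<epsilon>" using N by (simp add: field_simps)
    finally show "d (concat_on (S n) t) (concat_on T t) < \<epsilon>" .
  qed
qed

text \<open>
  Whether a formal sum of simplices with given coefficients vanishes depends only on which of the
  simplices coincide, and coincidences survive limits.
\<close>

definition eq_table :: "(nat \<Rightarrow> bool \<times> bool) \<times> int list \<times> (nat \<Rightarrow> (nat \<Rightarrow> real) \<Rightarrow> 'a) \<Rightarrow> ((nat \<times> nat) \<times> (nat \<times> nat)) list" where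
  "eq_table = (\<lambda>(z, cl, \<sigma>). let \<tau> = term_simplex (length cl) \<sigma> (concat_on (fst \<circ> z)) (concat_on (snd \<circ> z))
      in filter (\<lambda>(p, q). \<tau> p = \<tau> q) (List.product (term_index (length cl)) (term_index (length cl))))"

text \<open>\<open>code j\<close> records the coefficients, the coincidences among the simplices,
  and each triangle up to 1/(j+1). Along a sequence with agreeing codes the first two are constant
  and the triangles are uniformly Cauchy; their limits keep all recorded coincidences, so the same
  formal sum still vanishes.\<close>

lemma homologous_pairs_analytic:
  "\<exists>code :: nat \<Rightarrow> (nat \<Rightarrow> bool \<times> bool) \<times> int list \<times> (nat \<Rightarrow> (nat \<Rightarrow> real) \<Rightarrow> 'a)
        \<Rightarrow> int list \<times> ((nat \<times> nat) \<times> (nat \<times> nat)) list \<times> nat list.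
     \<forall>s y z. (\<forall>n. y n \<in> bounding_data m) \<longrightarrow> (\<forall>n j. j < n \<longrightarrow> code j (y n) = s j)
       \<longrightarrow> (\<forall>n i. i < n \<longrightarrow> fst (y n) i = z i) \<longrightarrow> z \<in> fst ` bounding_data m"
proof -
  let ?\<Delta> = "standard_simplex 2"
  have "\<exists>uc :: ((nat \<Rightarrow> real) \<Rightarrow> 'a) \<Rightarrow> nat. \<forall>f g x. continuous_map (top_of_set ?\<Delta>) mtopology f \<longrightarrow>
      continuous_map (top_of_set ?\<Delta>) mtopology g \<longrightarrow> uc f = uc g \<longrightarrow> x \<in> ?\<Delta> \<longrightarrow> d (f x) (g x) < inverse (real (Suc j))" for j
    by (rule countable_uniform_code[OF compact_standard_simplex[of 2], of "inverse (real (Suc j))"]) (simp, metis)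
  then obtain uc :: "nat \<Rightarrow> ((nat \<Rightarrow> real) \<Rightarrow> 'a) \<Rightarrow> nat" where
    uc: "\<And>j f g x. continuous_map (top_of_set ?\<Delta>) mtopology f \<Longrightarrow>
      continuous_map (top_of_set ?\<Delta>) mtopology g \<Longrightarrow> uc j f = uc j g \<Longrightarrow> x \<in> ?\<Delta> \<Longrightarrow> d (f x) (g x) < inverse (real (Suc j))"
    by metis
  define code where "code j y = (fst (snd y), eq_table y, map (\<lambda>i. uc j (snd (snd y) i)) [0..<length (fst (snd y))])"
    for j and y :: "(nat \<Rightarrow> bool \<times> bool) \<times> int list \<times> (nat \<Rightarrow> (nat \<Rightarrow> real) \<Rightarrow> 'a)"
  have "z \<in> fst ` bounding_data m"
    if Y: "\<And>n. y n \<in> bounding_data m" and cy: "\<And>n j. j < n \<Longrightarrow> code j (y n) = s j"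
      and lim: "\<And>n i. i < n \<Longrightarrow> fst (y n) i = z i" for s y z
  proof -
    define cl where "cl = fst (s 0)"
    define k where "k = length cl"
    \<comment> \<open>The shift by one is needed because \<open>code j\<close> is prescribed only
      for \<open>j < n\<close>, which says nothing about \<open>y 0\<close>.\<close>
    define zz where "zz n = fst (y (Suc n))" for n
    define \<sigma> where "\<sigma> n = snd (snd (y (Suc n)))" for n
    have yn: "y (Suc n) = (zz n, cl, \<sigma> n)" for n
      using cy[of 0 "Suc n"] by (auto simp: code_def cl_def zz_def \<sigma>_def prod_eq_iff)
    have cont: "continuous_map (top_of_set ?\<Delta>) mtopology (\<sigma> n i)" if "i < k" for n i
      using Y[of "Suc n"] that unfolding yn bounding_data_def
      by (simp add: k_def singular_simplex_def euclidean_product_topology)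
    have close: "d (\<sigma> n i t) (\<sigma> n' i t) < inverse (real (Suc j))"
      if "i < k" "t \<in> ?\<Delta>" "j \<le> n" "j \<le> n'" for i t j n n'
    proof (rule uc[OF cont[OF that(1)] cont[OF that(1)] _ that(2)])
      have "code j (y (Suc n)) = code j (y (Suc n'))" using cy[of j "Suc n"] cy[of j "Suc n'"] that by simp
      then have "map (\<lambda>i. uc j (\<sigma> n i)) [0..<k] = map (\<lambda>i. uc j (\<sigma> n' i)) [0..<k]"
        unfolding code_def yn by (simp add: k_def)
      then have "map (\<lambda>i. uc j (\<sigma> n i)) [0..<k] ! i = map (\<lambda>i. uc j (\<sigma> n' i)) [0..<k] ! i" by (rule arg_cong)
      then show "uc j (\<sigma> n i) = uc j (\<sigma> n' i)" using that(1) by simp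
    qed
    have "\<exists>f. singular_simplex 2 mtopology f \<and> (\<forall>t\<in>?\<Delta>. limitin mtopology (\<lambda>n. \<sigma> n i t) (f t) sequentially)"
      if i: "i < k" for i
    proof -
      have mc: mcomplete by (rule compact_space_imp_mcomplete[OF compact_M])
      have ev: "\<forall>\<^sub>F n in sequentially. continuous_map (top_of_set ?\<Delta>) mtopology (\<sigma> n i)"
        using cont[OF i] by simp
      have cau: "\<exists>N. \<forall>n n' t. N \<le> n \<longrightarrow> N \<le> n' \<longrightarrow> t \<in> topspace (top_of_set ?\<Delta>) \<longrightarrow> d (\<sigma> n i t) (\<sigma> n' i t) < \<epsilon>"
        if eps: "\<epsilon> > 0" for \<epsilon>
      proof -
        obtain N where "inverse (real (Suc N)) < \<epsilon>" using reals_Archimedean[OF eps] by blast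
        then show ?thesis
          using close[OF i, of _ N] by (intro exI[of _ N] allI impI) (metis less_trans topspace_euclidean_subtopology)
      qed
      obtain f where f: "continuous_map (top_of_set ?\<Delta>) mtopology f"
        and fl: "\<And>\<epsilon>. 0 < \<epsilon> \<Longrightarrow> \<forall>\<^sub>F n in sequentially. \<forall>t\<in>topspace (top_of_set ?\<Delta>). d (\<sigma> n i t) (f t) < \<epsilon>"
        using continuous_map_uniformly_Cauchy_limit[OF mc ev cau] by blast
      have "continuous_map (top_of_set ?\<Delta>) mtopology (restrict f ?\<Delta>)"
        by (rule continuous_map_eq[OF f]) simp
      then have "singular_simplex 2 mtopology (restrict f ?\<Delta>)"
        by (simp add: singular_simplex_def euclidean_product_topology)
      moreover have "limitin mtopology (\<lambda>n. \<sigma> n i t) (restrict f ?\<Delta> t) sequentially" if t: "t \<in> ?\<Delta>" for t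
        unfolding limitin_metric
      proof (intro conjI allI impI)
        show "restrict f ?\<Delta> t \<in> M" using continuous_map_funspace[OF f] t by auto
        fix \<epsilon> :: real assume "\<epsilon> > 0"
        have sM: "\<sigma> n i t \<in> M" for n using continuous_map_funspace[OF cont[OF i]] t by auto
        show "\<forall>\<^sub>F n in sequentially. \<sigma> n i t \<in> M \<and> d (\<sigma> n i t) (restrict f ?\<Delta> t) < \<epsilon>"
          using fl[OF \<open>\<epsilon> > 0\<close>] by (rule eventually_mono) (use sM t in auto)
      qed
      ultimately show ?thesis by blast
    qed
    then obtain \<rho> where \<rho>: "\<And>i. i < k \<Longrightarrow> singular_simplex 2 mtopology (\<rho> i)"
      "\<And>i t. i < k \<Longrightarrow> t \<in> ?\<Delta> \<Longrightarrow> limitin mtopology (\<lambda>n. \<sigma> n i t) (\<rho> i t) sequentially"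
      by metis
    define \<tau> where "\<tau> n = term_simplex k (\<sigma> n) (concat_on (fst \<circ> zz n)) (concat_on (snd \<circ> zz n))" for n
    define \<theta> where "\<theta> = term_simplex k \<rho> (concat_on (fst \<circ> z)) (concat_on (snd \<circ> z))"
    have zlim: "zz n i = z i" if "i < n" for n i using lim[of i "Suc n"] that by (simp add: zz_def)
    have conv: "limitin mtopology (\<lambda>n. \<tau> n p t) (\<theta> p t) sequentially"
      if p: "p \<in> set (term_index k)" and t: "t \<in> standard_simplex 1" for p t
    proof -
      obtain a b where ab: "p = (a, b)" by force
      have x1: "limitin mtopology (\<lambda>n. path_simplex (concat_on (fst \<circ> zz n)) t) (path_simplex (concat_on (fst \<circ> z)) t) sequentially"
        using limitin_concat_on[of "\<lambda>n. fst \<circ> zz n" "fst \<circ> z" "t 1"] zlim t by (simp add: path_simplex_def)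
      have x2: "limitin mtopology (\<lambda>n. path_simplex (concat_on (snd \<circ> zz n)) t) (path_simplex (concat_on (snd \<circ> z)) t) sequentially"
        using limitin_concat_on[of "\<lambda>n. snd \<circ> zz n" "snd \<circ> z" "t 1"] zlim t by (simp add: path_simplex_def)
      show ?thesis
      proof (cases "a < k")
        case True
        then have b: "b \<le> 2" using p ab by (auto simp: set_term_index)
        then have "simplical_face b t \<in> ?\<Delta>"
          using simplical_face_in_standard_simplex[of 2 b t] t by simp
        from \<rho>(2)[OF True this] show ?thesis
          using True t by (simp add: \<tau>_def \<theta>_def term_simplex_def ab singular_face_def)
      next
        case False
        show ?thesis
        proof (cases "b = 0")
          case True
          then show ?thesis using x1 False by (simp add: \<tau>_def \<theta>_def term_simplex_def ab)
        next
          case b: False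
          then show ?thesis using x2 False by (simp add: \<tau>_def \<theta>_def term_simplex_def ab)
        qed
      qed
    qed
    \<comment> \<open>Simplices are compared as total functions; off the standard simplex they all
      take the default value.\<close>
    have ext: "\<theta> p t = undefined" if "t \<notin> standard_simplex 1" for p t
      using that by (simp add: \<theta>_def term_simplex_def singular_face_def path_simplex_def)
    have tab: "\<tau> 0 p = \<tau> 0 q \<longleftrightarrow> \<tau> n p = \<tau> n q" if p: "p \<in> set (term_index k)" "q \<in> set (term_index k)" for p q n
    proof -
      have "code 0 (y (Suc 0)) = code 0 (y (Suc n))" using cy[of 0 "Suc n"] cy[of 0 "Suc 0"] by simp
      then have "eq_table (y (Suc 0)) = eq_table (y (Suc n))" by (simp add: code_def)
      then have "filter (\<lambda>(p, q). \<tau> 0 p = \<tau> 0 q) (List.product (term_index k) (term_index k))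
          = filter (\<lambda>(p, q). \<tau> n p = \<tau> n q) (List.product (term_index k) (term_index k))"
        unfolding yn eq_table_def \<tau>_def k_def by (simp only: Let_def prod.case)
      then have "set (filter (\<lambda>(p, q). \<tau> 0 p = \<tau> 0 q) (List.product (term_index k) (term_index k)))
          = set (filter (\<lambda>(p, q). \<tau> n p = \<tau> n q) (List.product (term_index k) (term_index k)))"
        by (rule arg_cong)
      then have "(p, q) \<in> set (filter (\<lambda>(p, q). \<tau> 0 p = \<tau> 0 q) (List.product (term_index k) (term_index k)))
          \<longleftrightarrow> (p, q) \<in> set (filter (\<lambda>(p, q). \<tau> n p = \<tau> n q) (List.product (term_index k) (term_index k)))"
        by (simp only:)
      then show ?thesis using p by simp
    qed
    have merge: "\<theta> p = \<theta> q" if p: "p \<in> set (term_index k)" "q \<in> set (term_index k)" and eq: "\<tau> 0 p = \<tau> 0 q" for p q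
    proof
      fix t
      show "\<theta> p t = \<theta> q t"
      proof (cases "t \<in> standard_simplex 1")
        case True
        have "\<tau> n p t = \<tau> n q t" for n using tab[OF p, of n] eq by simp
        then have "limitin mtopology (\<lambda>n. \<tau> n p t) (\<theta> q t) sequentially" using conv[OF p(2) True] by simp
        then show ?thesis
          using limitin_metric_unique conv[OF p(1) True] trivial_limit_sequentially by blast
      next
        case False
        then show ?thesis using ext by simp
      qed
    qed
    have "(\<Sum>p\<in>set (term_index k). frag_cmul (term_coeff m cl p) (frag_of (\<tau> 0 p))) = 0"
      using Y[of "Suc 0"] unfolding yn bounding_data_def \<tau>_def k_def by simp
    then have "(\<Sum>p\<in>set (term_index k). frag_cmul (term_coeff m cl p) (frag_of (\<theta> p))) = 0"
      by (rule frag_sum_collapse[OF _ finite_set merge])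
    then have "(z, cl, \<rho>) \<in> bounding_data m"
      using \<rho>(1) unfolding bounding_data_def \<theta>_def k_def by simp
    then show ?thesis by force
  qed
  then show ?thesis by (intro exI[of _ code]) blast
qed

end

section \<open>Genericity and the change of one coordinate\<close>

lemma nwd_vimage_update:
  fixes f :: "'a \<Rightarrow> 'a"
  assumes "nwd N"
  shows "nwd ((\<lambda>z. z(n := f (z n))) -` N)"
  unfolding nwd_def
proof
  fix w :: "'a list"
  \<comment> \<open>Padding makes the word long enough to decide coordinate \<open>n\<close>; the
    update then maps its cylinder into the cylinder of the updated word.\<close>
  define v where "v = w @ replicate (Suc n) undefined"
  have n: "n < length v" by (simp add: v_def)
  obtain q where q: "cyl (v[n := f (v ! n)] @ q) \<inter> N = {}" using assms nwd_def by blast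
  have upd: "z(n := f (z n)) \<in> cyl (v[n := f (v ! n)] @ q)" if "z \<in> cyl (v @ q)" for z
    using that n by (auto simp: cyl_def nth_append nth_list_update)
  have "cyl (v @ q) \<inter> (\<lambda>z. z(n := f (z n))) -` N = {}"
  proof (rule equals0I)
    fix z assume "z \<in> cyl (v @ q) \<inter> (\<lambda>z. z(n := f (z n))) -` N"
    then have "z(n := f (z n)) \<in> cyl (v[n := f (v ! n)] @ q) \<inter> N" using upd by simp
    then show False using q by blast
  qed
  then show "\<exists>q. cyl (w @ q) \<inter> (\<lambda>z. z(n := f (z n))) -` N = {}"
    by (intro exI[of _ "replicate (Suc n) undefined @ q"]) (simp only: v_def append_assoc)
qed

lemma meagre_vimage_update:
  fixes f :: "'a \<Rightarrow> 'a"
  assumes "meagre M"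
  shows "meagre ((\<lambda>z. z(n := f (z n))) -` M)"
proof -
  obtain N :: "nat \<Rightarrow> _" where N: "\<And>i. nwd (N i)" "M \<subseteq> (\<Union>i. N i)"
    using assms meagre_def by blast
  have "(\<lambda>z. z(n := f (z n))) -` M \<subseteq> (\<Union>i. (\<lambda>z. z(n := f (z n))) -` N i)" using N(2) by blast
  then show ?thesis unfolding meagre_def
    by (intro exI[of _ "\<lambda>i. (\<lambda>z. z(n := f (z n))) -` N i"]) (simp add: nwd_vimage_update N(1))
qed

context null_loops
begin

text \<open>Were the relation comeagre in a cylinder, a generic pair and the same pair with one
  coordinate of the first sequence flipped would both satisfy it. Subtraction cancels the second
  sequence and leaves \<open>fact m\<close> times one loop.\<close>

lemma homologous_pairs_meagre:
  assumes l_big: "\<And>k. frag_cmul (fact k) (path_chain (l k)) \<notin> bdry mtopology"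
  shows "meagre (homologous_pairs m)"
proof (rule ccontr)
  let ?B = "bdry mtopology"
  note B = subspace_bdry[of mtopology]
  assume nm: "\<not> meagre (homologous_pairs m)"
  obtain code :: "nat \<Rightarrow> (nat \<Rightarrow> bool \<times> bool) \<times> int list \<times> (nat \<Rightarrow> (nat \<Rightarrow> real) \<Rightarrow> 'a)
        \<Rightarrow> int list \<times> ((nat \<times> nat) \<times> (nat \<times> nat)) list \<times> nat list"
    where code: "\<forall>s y z. (\<forall>n. y n \<in> bounding_data m) \<longrightarrow> (\<forall>n j. j < n \<longrightarrow> code j (y n) = s j)
       \<longrightarrow> (\<forall>n i. i < n \<longrightarrow> fst (y n) i = z i) \<longrightarrow> z \<in> fst ` bounding_data m"
    using homologous_pairs_analytic[of m] by (elim exE)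
  have "\<exists>p. meagre (cyl p - fst ` bounding_data m)"
  proof (rule analytic_meagre_or_comeagre)
    show "z \<in> fst ` bounding_data m"
      if "\<And>n. y n \<in> bounding_data m" "\<And>n j. j < n \<Longrightarrow> code j (y n) = s j" "\<And>n i. i < n \<Longrightarrow> fst (y n) i = z i"
      for s y z
      using code[THEN spec[of _ s], THEN spec[of _ y], THEN spec[of _ z]] that by simp
    show "\<not> meagre (fst ` bounding_data m)" using nm homologous_pairs_eq_image by simp
  qed
  then obtain p where p: "meagre (cyl p - homologous_pairs m)" unfolding homologous_pairs_eq_image by blast
  \<comment> \<open>\<open>length p \<le> n\<close> keeps the flipped pair in \<open>cyl p\<close>,
    and \<open>m \<le> n\<close> makes \<open>fact m\<close> divide \<open>fact n\<close>, which
    contradicts \<open>l_big\<close> at \<open>n\<close>.\<close>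
  define n where "n = max (length p) m"
  define \<phi> where "\<phi> z = z(n := (\<lambda>(s, t). (\<not> s, t)) (z n))" for z :: "nat \<Rightarrow> bool \<times> bool"
  let ?M = "cyl p - homologous_pairs m"
  have "meagre (?M \<union> \<phi> -` ?M)"
    unfolding \<phi>_def[abs_def] by (intro meagre_Un p meagre_vimage_update)
  \<comment> \<open>The positions before \<open>n\<close> outside \<open>p\<close> are filled
    arbitrarily. Fixing the pair at \<open>n\<close> ensures that the flip removes
    \<open>l n\<close> from the first concatenation.\<close>
  then obtain z where z: "z \<in> cyl ((p @ replicate (n - length p) undefined) @ [(True, False)])" "z \<notin> ?M \<union> \<phi> -` ?M"
    by (rule baire_cyl)
  have len: "length (p @ replicate (n - length p) undefined) = n" by (simp add: n_def)
  have zn: "z n = (True, False)"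
    using z(1) len unfolding cyl_def by (auto simp: nth_append dest!: spec[of _ n])
  have "z \<in> cyl p" using z(1) cyl_append by blast
  moreover have "\<phi> z \<in> cyl p" using \<open>z \<in> cyl p\<close> by (auto simp: cyl_def \<phi>_def n_def)
  ultimately have hp: "z \<in> homologous_pairs m" "\<phi> z \<in> homologous_pairs m" using z(2) by auto
  define S where "S = fst \<circ> z"
  define S' where "S' = fst \<circ> \<phi> z"
  define T where "T = snd \<circ> z"
  have \<phi>z: "\<phi> z = z(n := (False, False))" by (simp add: \<phi>_def zn)
  have T': "snd \<circ> \<phi> z = T" unfolding T_def \<phi>z by (rule ext) (simp add: zn)
  have 1: "frag_cmul (fact m) (path_chain (concat_on S) - path_chain (concat_on T)) \<in> ?B"
    using hp(1) by (simp only: homologous_pairs_def mem_Collect_eq S_def T_def)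
  have 2: "frag_cmul (fact m) (path_chain (concat_on S') - path_chain (concat_on T)) \<in> ?B"
    using hp(2) by (simp only: homologous_pairs_def mem_Collect_eq S'_def T')
  have 3: "path_chain (concat_on S) - path_chain (concat_on S') - path_chain (l n) \<in> ?B"
  proof (rule concat_on_flip)
    show "S n" "\<not> S' n" by (simp_all add: S_def S'_def \<phi>z zn)
    show "S i = S' i" if "i \<noteq> n" for i using that by (simp add: S_def S'_def \<phi>z)
  qed
  have "frag_cmul (fact m) (path_chain (concat_on S) - path_chain (concat_on T))
     - frag_cmul (fact m) (path_chain (concat_on S') - path_chain (concat_on T))
     - frag_cmul (fact m) (path_chain (concat_on S) - path_chain (concat_on S') - path_chain (l n)) \<in> ?B"
    by (rule frag.subspace_diff[OF B frag.subspace_diff[OF B 1 2] frag.subspace_scale[OF B 3]])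
  then have lm: "frag_cmul (fact m) (path_chain (l n)) \<in> ?B"
    unfolding frag.scale_right_diff_distrib[symmetric] by simp
  have "m \<le> n" by (simp add: n_def)
  then obtain c :: int where "fact n = c * fact m" by (metis fact_dvd dvdE mult.commute)
  then have "frag_cmul (fact n) (path_chain (l n)) \<in> ?B"
    using frag.subspace_scale[OF B lm, of c] by (simp only: frag_cmul_cmul)
  then show False using l_big by blast
qed

lemma path_chain_loop_cycle: "singular_relcycle 1 mtopology {} (path_chain (concat_on S))"
  unfolding singular_cycle chain_boundary_path_chain infinite_concat_ends
  using singular_chain_path_chain[OF pathin_concat_on] by simp

text \<open>The countably many relations account for all torsion orders, because a positive
  \<open>n\<close> divides \<open>fact n\<close>.\<close>

lemma many_independent_cycles:
  assumes l_big: "\<And>k. frag_cmul (fact k) (path_chain (l k)) \<notin> bdry mtopology"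
  shows "\<exists>h::(nat \<Rightarrow> bool) \<Rightarrow> 'a chain. (\<forall>x. singular_relcycle 1 mtopology {} (h x)) \<and>
     (\<forall>x y. x \<noteq> y \<longrightarrow> (\<forall>n::nat. n > 0 \<longrightarrow> frag_cmul (int n) (h x - h y) \<notin> bdry mtopology))"
proof -
  have "meagre (\<Union>m. homologous_pairs m)"
    by (rule meagre_UN_nat) (rule homologous_pairs_meagre[OF l_big])
  from meagre_avoiding_pairs[OF this] obtain \<phi> :: "(nat \<Rightarrow> bool) \<Rightarrow> nat \<Rightarrow> bool" where
    \<phi>: "\<forall>x y. x \<noteq> y \<longrightarrow> pair_seq (\<phi> x) (\<phi> y) \<notin> (\<Union>m. homologous_pairs m)" by (elim exE)
  have comp: "fst \<circ> pair_seq a b = a" "snd \<circ> pair_seq a b = b" for a b :: "nat \<Rightarrow> bool"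
    by (simp_all add: pair_seq_def fun_eq_iff)
  show ?thesis
  proof (intro exI[of _ "\<lambda>x. path_chain (concat_on (\<phi> x))"] conjI allI impI path_chain_loop_cycle notI)
    fix x y :: "nat \<Rightarrow> bool" and n :: nat
    assume "x \<noteq> y" "n > 0"
      and nB: "frag_cmul (int n) (path_chain (concat_on (\<phi> x)) - path_chain (concat_on (\<phi> y))) \<in> bdry mtopology"
    have "int n dvd fact n" using \<open>n > 0\<close> dvd_fact[of n n] by (metis int_dvd_int_iff of_nat_fact order_refl Suc_leI One_nat_def)
    then obtain c where "fact n = c * int n" by (metis dvdE mult.commute)
    then have "frag_cmul (fact n) (path_chain (concat_on (\<phi> x)) - path_chain (concat_on (\<phi> y))) \<in> bdry mtopology"
      using frag.subspace_scale[OF subspace_bdry nB, of c] by (simp only: frag_cmul_cmul)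
    then have "pair_seq (\<phi> x) (\<phi> y) \<in> homologous_pairs n"
      by (simp only: homologous_pairs_def mem_Collect_eq comp)
    then show False using \<phi> \<open>x \<noteq> y\<close> by blast
  qed
qed

end

context compact_metric
begin

text \<open>Failure of the pointwise condition at one \<open>x\<close> gives for each
  \<open>k\<close> a loop that is both within 1/(k+1) of \<open>x\<close> and not killed by
  \<open>fact k\<close>, the input for the infinite concatenations. Its validity at all points is
  made uniform by compactness.\<close>

theorem small_loops_dichotomy:
  assumes lpc: "locally_path_connected_space mtopology"
  shows "(\<exists>h::(nat \<Rightarrow> bool) \<Rightarrow> 'a chain. (\<forall>x. singular_relcycle 1 mtopology {} (h x)) \<and>
       (\<forall>x y. x \<noteq> y \<longrightarrow> (\<forall>n::nat. n > 0 \<longrightarrow> frag_cmul (int n) (h x - h y) \<notin> bdry mtopology)))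
    \<or> (\<exists>(N::nat) F. N > 0 \<and> finite F \<and>
        (\<forall>c. singular_relcycle 1 mtopology {} c \<longrightarrow> frag_cmul (int N) c \<in> frag.span (F \<union> bdry mtopology)))"
proof (cases "\<forall>x\<in>M. \<exists>k. \<forall>l. pathin mtopology l \<longrightarrow> l 0 = x \<longrightarrow> l 1 = x
       \<longrightarrow> l \<in> {0..1} \<rightarrow> mball x (1 / (real k + 1)) \<longrightarrow> frag_cmul (fact k) (path_chain l) \<in> bdry mtopology")
  case True
  obtain N :: nat and \<epsilon> :: real where N: "N > 0" "\<epsilon> > 0"
    and kill: "\<And>g. pathin mtopology g \<Longrightarrow> g 0 = g 1 \<Longrightarrow> g \<in> {0..1} \<rightarrow> mball (g 0) \<epsilon>
        \<Longrightarrow> frag_cmul (int N) (path_chain g) \<in> bdry mtopology"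
    using loops_killed_uniformly[OF lpc] True by metis
  obtain F where "finite F"
    "\<And>c. singular_relcycle 1 mtopology {} c \<Longrightarrow> frag_cmul (int N) c \<in> frag.span (F \<union> bdry mtopology)"
    using cycles_multiple_in_finite_span[OF lpc N(2) kill] by metis
  then show ?thesis using N(1) by blast
next
  case False
  then obtain x where x: "x \<in> M" and ex: "\<forall>k. \<exists>l. pathin mtopology l \<and> l 0 = x \<and> l 1 = x
       \<and> l \<in> {0..1} \<rightarrow> mball x (1 / (real k + 1)) \<and> frag_cmul (fact k) (path_chain l) \<notin> bdry mtopology"
    by meson
  obtain l where l: "\<And>k. pathin mtopology (l k)" "\<And>k. l k 0 = x" "\<And>k. l k 1 = x"
       "\<And>k. l k \<in> {0..1} \<rightarrow> mball x (1 / (real k + 1))" "\<And>k. frag_cmul (fact k) (path_chain (l k)) \<notin> bdry mtopology"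
    using choice[OF ex] by blast
  interpret null_loops M d x l by unfold_locales (use x l in auto)
  show ?thesis using many_independent_cycles[OF l(5)] by (rule disjI1)
qed

end

section \<open>The first homology group\<close>

lemma comm_group_homology: "comm_group (homology_group 1 X)"
  using abelian_relcycle_group comm_group.abelian_FactGroup subgroup_singular_relboundary_relcycle
  unfolding relative_homology_group_def by fastforce

definition hclass :: "'a topology \<Rightarrow> 'a chain \<Rightarrow> 'a chain set" where
  "hclass X c = homologous_rel_set 1 X {} c"

abbreviation cycles1 :: "'a topology \<Rightarrow> 'a chain set" where
  "cycles1 X \<equiv> singular_relcycle_set 1 X {}"

lemma hclass_onto: "hclass X ` cycles1 X = carrier (homology_group 1 X)"
  using carrier_relative_homology_group[of 1 X "{}"] by (simp add: hclass_def)

lemma hclass_add: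
  assumes "x \<in> cycles1 X" "y \<in> cycles1 X"
  shows "hclass X (x + y) = hclass X x \<otimes>\<^bsub>homology_group 1 X\<^esub> hclass X y"
proof -
  \<comment> \<open>The product of cosets is their elementwise sum, so a member \<open>w\<close> of
    the coset of the sum has to be split; \<open>x\<close> and \<open>w - x\<close> do.\<close>
  have "homologous_rel 1 X {} (x + y) w \<longleftrightarrow> (\<exists>r s. homologous_rel 1 X {} x r \<and> homologous_rel 1 X {} y s \<and> w = r + s)" for w
  proof
    assume "homologous_rel 1 X {} (x + y) w"
    then have "homologous_rel 1 X {} y (w - x)" by (simp add: homologous_rel_def algebra_simps)
    then show "\<exists>r s. homologous_rel 1 X {} x r \<and> homologous_rel 1 X {} y s \<and> w = r + s"
      by (intro exI[of _ x] exI[of _ "w - x"]) simp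
  qed (auto intro: homologous_rel_add)
  then show ?thesis
    using mult_relative_homology_group[of 1 X "{}"] unfolding hclass_def by auto
qed

lemma hclass_eq_one: "hclass X x = \<one>\<^bsub>homology_group 1 X\<^esub> \<longleftrightarrow> x \<in> bdry X"
  using one_relative_homology_group[of 1 X "{}"] homologous_rel_set_eq_relboundary[of 1 X "{}" x]
  by (simp add: hclass_def)

lemma subspace_cycles1: "frag.subspace (cycles1 X)"
  by (rule frag.subspaceI) (auto intro: singular_relcycle_add singular_relcycle_cmul)

lemma bdry_subset_cycles1: "bdry X \<subseteq> cycles1 X"
  using singular_relboundary_imp_relcycle by blast

lemma hclass_pow:
  assumes "x \<in> cycles1 X"
  shows "hclass X x [^]\<^bsub>homology_group 1 X\<^esub> (n::nat) = hclass X (frag_cmul (int n) x)"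
proof -
  have "hclass X (frag_cmul (int n) x) = hclass X x [^]\<^bsub>homology_group 1 X\<^esub> int n"
    by (rule frag.additive_onto_group_scale[OF comm_group_homology subspace_cycles1 _ hclass_add assms])
       (simp only: hclass_onto order_refl)
  then show ?thesis by (simp only: int_pow_int)
qed

lemma (in comm_group) subgroup_tor_set: "subgroup (tor_set G) G"
proof (rule subgroupI)
  show "tor_set G \<subseteq> carrier G" by (auto simp: tor_set_def)
  show "tor_set G \<noteq> {}" by (auto simp: tor_set_def intro!: exI[of _ \<one>] exI[of _ "1::nat"])
  show "inv a \<in> tor_set G" if a: "a \<in> tor_set G" for a
  proof -
    obtain n :: nat where n: "n > 0" "a [^] n = \<one>" "a \<in> carrier G" using a by (auto simp: tor_set_def)
    then have "inv a [^] n = \<one>" by (simp add: nat_pow_inv)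
    then show ?thesis using n by (auto simp: tor_set_def)
  qed
  show "a \<otimes> b \<in> tor_set G" if a: "a \<in> tor_set G" and b: "b \<in> tor_set G" for a b
  proof -
    obtain n :: nat where n: "n > 0" "a [^] n = \<one>" "a \<in> carrier G" using a by (auto simp: tor_set_def)
    obtain m :: nat where m: "m > 0" "b [^] m = \<one>" "b \<in> carrier G" using b by (auto simp: tor_set_def)
    have "a [^] (n * m) = \<one>" using n by (simp flip: nat_pow_pow)
    moreover have "b [^] (n * m) = \<one>" using m by (simp add: mult.commute flip: nat_pow_pow)
    ultimately have "(a \<otimes> b) [^] (n * m) = \<one>" using n m by (simp add: pow_mult_distrib m_comm)
    then show ?thesis using n m by (auto simp: tor_set_def intro!: exI[of _ "n * m"])
  qed
qed

text \<open>If two cosets of the torsion subgroup agree, the difference of the classes is torsion,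
  so a positive multiple of the difference of the cycles bounds.\<close>

lemma many_cycles_imp_large_tf:
  fixes h :: "(nat \<Rightarrow> bool) \<Rightarrow> 'a chain"
  assumes cyc: "\<And>S. h S \<in> cycles1 X"
    and ind: "\<And>S T n. S \<noteq> T \<Longrightarrow> (n::nat) > 0 \<Longrightarrow> frag_cmul (int n) (h S - h T) \<notin> bdry X"
  shows "Pow (UNIV :: nat set) \<lesssim> carrier (tf_group (homology_group 1 X))"
proof -
  let ?G = "homology_group 1 X"
  interpret comm_group ?G by (rule comm_group_homology)
  let ?j = "\<lambda>A. tor_set ?G #>\<^bsub>?G\<^esub> hclass X (h (\<lambda>i. i \<in> A))"
  have hc: "hclass X (h S) \<in> carrier ?G" for S using cyc hclass_onto by blast
  have "inj_on ?j (Pow UNIV)"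
  proof (rule inj_onI, rule ccontr)
    fix A B :: "nat set"
    assume eq: "?j A = ?j B" and ne: "A \<noteq> B"
    let ?a = "h (\<lambda>i. i \<in> A)" and ?b = "h (\<lambda>i. i \<in> B)"
    have "hclass X ?a \<in> ?j B"
      using rcos_self[OF hc subgroup_tor_set] eq by metis
    then obtain t where t: "t \<in> tor_set ?G" "hclass X ?a = t \<otimes>\<^bsub>?G\<^esub> hclass X ?b"
      unfolding r_coset_def by blast
    obtain n :: nat where n: "n > 0" "t [^]\<^bsub>?G\<^esub> n = \<one>\<^bsub>?G\<^esub>" "t \<in> carrier ?G"
      using t(1) by (auto simp: tor_set_def)
    have diff: "?a - ?b \<in> cycles1 X" by (rule frag.subspace_diff[OF subspace_cycles1 cyc cyc])
    have "hclass X (?a - ?b) \<otimes>\<^bsub>?G\<^esub> hclass X ?b = t \<otimes>\<^bsub>?G\<^esub> hclass X ?b"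
      using hclass_add[OF diff cyc[of "\<lambda>i. i \<in> B"]] t(2) by simp
    moreover have "hclass X (?a - ?b) \<in> carrier ?G" using diff hclass_onto by blast
    ultimately have "hclass X (?a - ?b) = t" using hc n(3) by simp
    then have "hclass X (frag_cmul (int n) (?a - ?b)) = \<one>\<^bsub>?G\<^esub>" using hclass_pow[OF diff] n(2) by metis
    then have "frag_cmul (int n) (?a - ?b) \<in> bdry X" by (simp only: hclass_eq_one)
    moreover have "(\<lambda>i. i \<in> A) \<noteq> (\<lambda>i. i \<in> B)" using ne by (auto simp: fun_eq_iff)
    ultimately show False using ind n(1) by blast
  qed
  moreover have "?j ` Pow UNIV \<subseteq> carrier (tf_group ?G)"
    using hc by (auto simp: tf_group_def FactGroup_def RCOSETS_def)
  ultimately show ?thesis unfolding lepoll_def by blast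
qed

theorem theoremA:
  fixes X :: "'a topology"
  assumes "peano_continuum X"
    and "carrier (tf_group (homology_group 1 X)) \<prec> Pow (UNIV :: nat set)"
  shows "direct_sum_of_cyclic (homology_group 1 X)
         \<and> bounded_exponent (homology_group 1 X) (tor_set (homology_group 1 X))"
proof -
  let ?G = "homology_group 1 X"
  have "metrizable_space X" using assms(1) by (simp add: peano_continuum_def)
  then obtain M d where Md: "Metric_space M d" "X = Metric_space.mtopology M d"
    unfolding metrizable_space_def by blast
  interpret compact_metric M d
    using Md assms(1) by (simp add: compact_metric_def compact_metric_axioms_def peano_continuum_def)
  have lpc: "locally_path_connected_space mtopology"
    using assms(1) Md(2) by (simp add: peano_continuum_def)
  from small_loops_dichotomy[OF lpc, folded Md(2)] show ?thesis
  proof (elim disjE exE conjE)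
    fix h :: "(nat \<Rightarrow> bool) \<Rightarrow> 'a chain"
    assume h: "\<forall>x. singular_relcycle 1 X {} (h x)"
      "\<forall>x y. x \<noteq> y \<longrightarrow> (\<forall>n::nat. n > 0 \<longrightarrow> frag_cmul (int n) (h x - h y) \<notin> bdry X)"
    have "Pow (UNIV :: nat set) \<lesssim> carrier (tf_group ?G)"
      by (rule many_cycles_imp_large_tf[of h]) (use h in simp_all)
    then have "Pow (UNIV :: nat set) \<prec> Pow (UNIV :: nat set)" using assms(2) by (rule lesspoll_trans1)
    then show ?thesis by simp
  next
    fix N :: nat and F
    assume NF: "N > 0" "finite F"
      and "\<forall>c. singular_relcycle 1 X {} c \<longrightarrow> frag_cmul (int N) c \<in> frag.span (F \<union> bdry X)"
    then have sp: "frag_cmul (int N) c \<in> frag.span (F \<union> bdry X)" if "c \<in> cycles1 X" for c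
      using that by simp
    note fin = frag.multiple_in_finite_span[OF subspace_bdry NF(2) subspace_cycles1 bdry_subset_cycles1 NF(1) sp]
    have "direct_sum_of_cyclic ?G"
      by (rule frag.direct_sum_of_cyclic_quotient[OF comm_group_homology subspace_bdry subspace_cycles1
            hclass_onto hclass_add hclass_eq_one bdry_subset_cycles1 fin(1)])
    moreover have "bounded_exponent ?G (tor_set ?G)"
    proof -
      \<comment> \<open>A single exponent for all cycles of finite order modulo boundaries, to be
        read in the homology group through \<open>hclass_pow\<close>.\<close>
      obtain K :: nat where K: "K > 0"
        "\<And>c n. c \<in> cycles1 X \<Longrightarrow> (n::nat) > 0 \<Longrightarrow> frag_cmul (int n) c \<in> bdry X \<Longrightarrow> frag_cmul (int K) c \<in> bdry X"
        using fin(2) by blast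
      have "x [^]\<^bsub>?G\<^esub> K = \<one>\<^bsub>?G\<^esub>" if x: "x \<in> tor_set ?G" for x
      proof -
        obtain n :: nat where n: "n > 0" "x [^]\<^bsub>?G\<^esub> n = \<one>\<^bsub>?G\<^esub>" "x \<in> carrier ?G"
          using x by (auto simp: tor_set_def)
        obtain c where c: "c \<in> cycles1 X" "x = hclass X c" using n(3) hclass_onto by blast
        have "frag_cmul (int n) c \<in> bdry X" using n(2) unfolding c(2) hclass_pow[OF c(1)] hclass_eq_one .
        then have "frag_cmul (int K) c \<in> bdry X" by (rule K(2)[OF c(1) n(1)])
        then show ?thesis unfolding c(2) hclass_pow[OF c(1)] hclass_eq_one .
      qed
      then show ?thesis using K(1) unfolding bounded_exponent_def by blast
    qed
    ultimately show ?thesis by blast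
  qed
qed

end
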